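(* Let $\Gamma$ be a connected negative definite plumbing graph (with arbitrary genus decorations and possibly with cycles). If $\mathbb H^0(\Gamma,K)=\mathcal T_0^+$ (isomorphism of graded $\mathbb Z[U]$-modules), then $\Gamma$ is rational.
   Context: Graphs and lattices. $\Gamma$ is a finite connected plumbing graph (without loops) with vertex set $\mathcal J=\{1,\dots,s\}$; vertex $j$ carries an Euler number $e_j\in\mathbb Z$ and a genus $g_j\ge 0$. $L=\bigoplus_j\mathbb Z E_j$ with form $(E_j,E_j)=e_j$, $(E_i,E_j)=$ number of edges joining $i,j$ ($i\ne j$), assumed negative definite. $L'=\{l'\in L\otimes\mathbb Q:(l',l)\in\mathbb Z\ \forall l\in L\}$. $K\in L'$ is given by $(K,E_j)=-e_j-2+2g_j$ for all $j$; $\mathrm{Char}=K+2L'$. For $k\in\mathrm{Char}$, $\chi_k(l)=-(l,l+k)/2$. $L_e=\{\sum n_jE_j\in L: n_j\ge0\ \forall j\}$. $\Gamma$ is rational if $\min_{l\in L_e\setminus 0}\chi_K(l)>0$. Weights (for $k\in\mathrm{Char}$). For integers $g,n\ge0$ let $M^g(n)$ be the maximum of $\dim H^1(C,\mathcal L)$ over all compact Riemann surfaces $C$ of genus $g$ and holomorphic line bundles $\mathcal L$ on $C$ with $\chi(\mathcal L)=n$. In the cubical decomposition of $L\otimes\mathbb R=\mathbb R^s$ a $q$-cube is given by $l\in L$ and $I\subset\mathcal J$, $|I|=q$, with vertices $l+\sum_{j\in I'}E_j$, $I'\subset I$ (oriented using the order of indices); $\mathcal Q_q$ is the set of $q$-cubes.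 $w_0(l)=\chi_k(l)$; for $S=[l,l+E_j]$, $w_1(S)=\max\{\chi_k(l),\chi_k(l+E_j)\}+M^{g_j}(|\chi_k(l)-\chi_k(l+E_j)|)$; for $q\ge2$, $w_q(\square_q)=\max\{w_1(S):S\text{ a segment of }\square_q\}$. Lattice cohomology. $\mathcal T_0^+=\mathbb Z[U,U^{-1}]/U\,\mathbb Z[U]$, $\deg U^{-d}=2d$. $\mathcal F^q=\mathrm{Hom}_{\mathbb Z}(\mathcal C_q,\mathcal T_0^+)$, $\mathcal C_q$ free on $\mathcal Q_q$; $\phi\in\mathcal F^q$ is homogeneous of degree $d$ if each nonzero $\phi(\square_q)$ is homogeneous of degree $d-2w(\square_q)$. If $\partial\square_{q+1}=\sum_k\varepsilon_k\square_q^k$, then $(\delta_w\phi)(\square_{q+1})=\sum_k\varepsilon_kU^{w(\square_{q+1})-w(\square_q^k)}\phi(\square_q^k)$. $\mathbb H^q(\Gamma,k)$ is the $q$-th cohomology of $(\mathcal F^*,\delta_w)$, a graded $\mathbb Z[U]$-module. *)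

theory Defs
  imports "HOL-Analysis.Analysis" "HOL-Computational_Algebra.Polynomial"
begin

section \<open>Compact Riemann surfaces and line bundles\<close>

type_synonym 'a atlas = "('a set \<times> ('a \<Rightarrow> complex)) set"

definition compact_riemann_surface :: "'a topology \<Rightarrow> 'a atlas \<Rightarrow> bool" where
  "compact_riemann_surface X A \<longleftrightarrow>
     topspace X \<noteq> {} \<and> Hausdorff_space X \<and> compact_space X \<and> connected_space X \<and>
     topspace X = (\<Union>(U, \<phi>)\<in>A. U) \<and>
     (\<forall>(U, \<phi>)\<in>A. openin X U \<and> open (\<phi> ` U) \<and>
        homeomorphic_map (subtopology X U) (top_of_set (\<phi> ` U)) \<phi>) \<and>
     (\<forall>(U, \<phi>)\<in>A. \<forall>(V, \<psi>)\<in>A. (\<psi> \<circ> inv_into U \<phi>) holomorphic_on \<phi> ` (U \<inter> V))"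

definition holomorphic_fun :: "'a atlas \<Rightarrow> 'a set \<Rightarrow> ('a \<Rightarrow> complex) \<Rightarrow> bool" where
  "holomorphic_fun A W f \<longleftrightarrow>
     (\<forall>(U, \<phi>)\<in>A. (f \<circ> inv_into U \<phi>) holomorphic_on \<phi> ` (U \<inter> W))"

text \<open>
  A line bundle is presented by the transition functions \<open>t U V\<close> of trivialisations over the
  members of an open cover \<open>\<V>\<close>. A section is then the family of its coordinate functions:
  \<open>s (U, p)\<close> is the value at \<open>p \<in> U\<close> in the trivialisation over \<open>U\<close>.
\<close>

type_synonym 'a transition = "'a set \<Rightarrow> 'a set \<Rightarrow> 'a \<Rightarrow> complex"

definition line_bundle ::
    "'a topology \<Rightarrow> 'a atlas \<Rightarrow> 'a set set \<Rightarrow> 'a transition \<Rightarrow> bool" where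
  "line_bundle X A \<V> t \<longleftrightarrow>
     (\<forall>U\<in>\<V>. openin X U) \<and> \<Union>\<V> = topspace X \<and>
     (\<forall>U\<in>\<V>. \<forall>V\<in>\<V>. holomorphic_fun A (U \<inter> V) (t U V) \<and> (\<forall>p\<in>U \<inter> V. t U V p \<noteq> 0)) \<and>
     (\<forall>U\<in>\<V>. \<forall>V\<in>\<V>. \<forall>W\<in>\<V>. \<forall>p\<in>U \<inter> V \<inter> W. t U V p * t V W p = t U W p)"

definition holomorphic_section ::
    "'a atlas \<Rightarrow> 'a set set \<Rightarrow> 'a transition \<Rightarrow> 'a set \<Rightarrow> ('a set \<times> 'a \<Rightarrow> complex) \<Rightarrow> bool" where
  "holomorphic_section A \<V> t W s \<longleftrightarrow>
     (\<forall>U\<in>\<V>. holomorphic_fun A (U \<inter> W) (\<lambda>p. s (U, p))) \<and>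
     (\<forall>U\<in>\<V>. \<forall>V\<in>\<V>. \<forall>p\<in>U \<inter> V \<inter> W. s (U, p) = t U V p * s (V, p))"

text \<open>The quotient \<open>Z / B\<close> of complex vector spaces of functions has a basis with \<open>n\<close> elements.\<close>

definition has_quotient_dim :: "('i \<Rightarrow> complex) set \<Rightarrow> ('i \<Rightarrow> complex) set \<Rightarrow> nat \<Rightarrow> bool" where
  "has_quotient_dim Z B n \<longleftrightarrow>
     (\<exists>b :: nat \<Rightarrow> 'i \<Rightarrow> complex.
        (\<forall>i<n. b i \<in> Z) \<and>
        (\<forall>z\<in>Z. \<exists>c :: nat \<Rightarrow> complex. (\<lambda>x. z x - (\<Sum>i<n. c i * b i x)) \<in> B) \<and>
        (\<forall>c :: nat \<Rightarrow> complex. (\<lambda>x. \<Sum>i<n. c i * b i x) \<in> B \<longrightarrow> (\<forall>i<n. c i = 0)))"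

text \<open>
  The value of a coordinate family at \<open>(U, p)\<close> is irrelevant when \<open>p \<notin> U\<close>; families representing
  the zero section are therefore divided out.
\<close>

definition has_h0 ::
    "'a topology \<Rightarrow> 'a atlas \<Rightarrow> 'a set set \<Rightarrow> 'a transition \<Rightarrow> nat \<Rightarrow> bool" where
  "has_h0 X A \<V> t n \<longleftrightarrow>
     has_quotient_dim {s. holomorphic_section A \<V> t (topspace X) s}
       {s. \<forall>U\<in>\<V>. \<forall>p\<in>U. s (U, p) = 0} n"

text \<open>
  \<open>H\<^sup>1\<close> is Cech cohomology, the direct limit over all open covers. As usual it suffices to use the
  cofinal system of covers \<open>(N x)\<^sub>x\<close> indexed by the points, with \<open>x \<in> N x\<close>, whose refinement maps
  are the identity on indices. In the limit a cochain matters only after restriction to a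
  sufficiently small \<open>N\<close>, so the limit is the quotient of the two spaces below, in both of which
  the cover is existentially quantified. Here \<open>f (x, y, _)\<close> is the component on \<open>N x \<inter> N y\<close>.
\<close>

definition pointed_cover :: "'a topology \<Rightarrow> ('a \<Rightarrow> 'a set) \<Rightarrow> bool" where
  "pointed_cover X N \<longleftrightarrow> (\<forall>x\<in>topspace X. openin X (N x) \<and> x \<in> N x)"

definition cech_cocycles1 ::
    "'a topology \<Rightarrow> 'a atlas \<Rightarrow> 'a set set \<Rightarrow> 'a transition \<Rightarrow> ('a \<times> 'a \<times> 'a set \<times> 'a \<Rightarrow> complex) set" where
  "cech_cocycles1 X A \<V> t = {f. \<exists>N. pointed_cover X N \<and>
     (\<forall>x\<in>topspace X. \<forall>y\<in>topspace X.
        holomorphic_section A \<V> t (N x \<inter> N y) (\<lambda>(U, p). f (x, y, U, p))) \<and>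
     (\<forall>x\<in>topspace X. \<forall>y\<in>topspace X. \<forall>z\<in>topspace X. \<forall>U\<in>\<V>. \<forall>p\<in>U \<inter> N x \<inter> N y \<inter> N z.
        f (x, z, U, p) = f (x, y, U, p) + f (y, z, U, p))}"

definition cech_coboundaries1 ::
    "'a topology \<Rightarrow> 'a atlas \<Rightarrow> 'a set set \<Rightarrow> 'a transition \<Rightarrow> ('a \<times> 'a \<times> 'a set \<times> 'a \<Rightarrow> complex) set" where
  "cech_coboundaries1 X A \<V> t = {f. \<exists>N h. pointed_cover X N \<and>
     (\<forall>x\<in>topspace X. holomorphic_section A \<V> t (N x) (\<lambda>(U, p). h (x, U, p))) \<and>
     (\<forall>x\<in>topspace X. \<forall>y\<in>topspace X. \<forall>U\<in>\<V>. \<forall>p\<in>U \<inter> N x \<inter> N y.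
        f (x, y, U, p) = h (y, U, p) - h (x, U, p))}"

definition has_h1 ::
    "'a topology \<Rightarrow> 'a atlas \<Rightarrow> 'a set set \<Rightarrow> 'a transition \<Rightarrow> nat \<Rightarrow> bool" where
  "has_h1 X A \<V> t n \<longleftrightarrow>
     has_quotient_dim (cech_cocycles1 X A \<V> t) (cech_coboundaries1 X A \<V> t) n"

text \<open>The genus is \<open>dim H\<^sup>1(X, \<O>)\<close>; \<open>\<O>\<close> is the sheaf of sections of the product bundle.\<close>

definition has_genus :: "'a topology \<Rightarrow> 'a atlas \<Rightarrow> nat \<Rightarrow> bool" where
  "has_genus X A g \<longleftrightarrow> has_h1 X A {topspace X} (\<lambda>_ _ _. 1) g"

text \<open>
  The point set of a Riemann surface has the cardinality of the continuum, so up to isomorphism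
  every surface has its points in the type \<^typ>\<open>complex\<close>, used here only as a set: the topology
  \<open>X\<close> on a subset of it is arbitrary. The Euler characteristic of a line bundle is \<open>h\<^sup>0 - h\<^sup>1\<close>.
\<close>

definition h1_values :: "nat \<Rightarrow> nat \<Rightarrow> nat set" where
  "h1_values g n = {h1. \<exists>(X :: complex topology) A \<V> t h0.
     compact_riemann_surface X A \<and> has_genus X A g \<and> line_bundle X A \<V> t \<and>
     has_h0 X A \<V> t h0 \<and> has_h1 X A \<V> t h1 \<and> int h0 - int h1 = int n}"

definition max_h1 :: "nat \<Rightarrow> nat \<Rightarrow> nat" where
  "max_h1 g n = Max (h1_values g n)"

section \<open>Plumbing graphs\<close>

text \<open>
  The vertices are the elements of the finite linearly ordered type \<open>'v\<close>, and
  \<open>edges \<Gamma> i j\<close> is the number of edges joining \<open>i\<close> and \<open>j\<close>. Elements of \<open>L\<close> are functions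
  \<open>'v \<Rightarrow> int\<close> and elements of \<open>L \<otimes> \<rat>\<close> are functions \<open>'v \<Rightarrow> rat\<close>, giving the coefficients of
  the \<open>E\<^sub>j\<close>.
\<close>

record 'v plumbing =
  euler :: "'v \<Rightarrow> int"
  genus :: "'v \<Rightarrow> nat"
  edges :: "'v \<Rightarrow> 'v \<Rightarrow> nat"

definition plumbing_graph :: "'v::{finite,linorder} plumbing \<Rightarrow> bool" where
  "plumbing_graph \<Gamma> \<longleftrightarrow>
     (\<forall>i j. edges \<Gamma> i j = edges \<Gamma> j i) \<and> (\<forall>i. edges \<Gamma> i i = 0)"

definition connected_plumbing :: "'v::{finite,linorder} plumbing \<Rightarrow> bool" where
  "connected_plumbing \<Gamma> \<longleftrightarrow> (\<forall>i j. (i, j) \<in> {(a, b). edges \<Gamma> a b > 0}\<^sup>*)"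

definition form :: "'v::{finite,linorder} plumbing \<Rightarrow> ('v \<Rightarrow> rat) \<Rightarrow> ('v \<Rightarrow> rat) \<Rightarrow> rat" where
  "form \<Gamma> x y = (\<Sum>i\<in>UNIV. \<Sum>j\<in>UNIV.
     x i * y j * (if i = j then of_int (euler \<Gamma> i) else of_nat (edges \<Gamma> i j)))"

definition emb :: "('v \<Rightarrow> int) \<Rightarrow> 'v \<Rightarrow> rat" where
  "emb l = (\<lambda>j. of_int (l j))"

definition base :: "'v \<Rightarrow> 'v \<Rightarrow> int" where
  "base j = (\<lambda>i. if i = j then 1 else 0)"

definition negative_definite :: "'v::{finite,linorder} plumbing \<Rightarrow> bool" where
  "negative_definite \<Gamma> \<longleftrightarrow> (\<forall>l :: 'v \<Rightarrow> int. l \<noteq> (\<lambda>_. 0) \<longrightarrow> form \<Gamma> (emb l) (emb l) < 0)"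

definition dual_lattice :: "'v::{finite,linorder} plumbing \<Rightarrow> ('v \<Rightarrow> rat) set" where
  "dual_lattice \<Gamma> = {x. \<forall>l. form \<Gamma> x (emb l) \<in> \<int>}"

definition canonical :: "'v::{finite,linorder} plumbing \<Rightarrow> 'v \<Rightarrow> rat" where
  "canonical \<Gamma> = (THE k. k \<in> dual_lattice \<Gamma> \<and>
     (\<forall>j. form \<Gamma> k (emb (base j)) = of_int (- euler \<Gamma> j - 2 + 2 * int (genus \<Gamma> j))))"

definition Char :: "'v::{finite,linorder} plumbing \<Rightarrow> ('v \<Rightarrow> rat) set" where
  "Char \<Gamma> = {\<lambda>j. canonical \<Gamma> j + 2 * x j | x. x \<in> dual_lattice \<Gamma>}"

definition chi :: "'v::{finite,linorder} plumbing \<Rightarrow> ('v \<Rightarrow> rat) \<Rightarrow> ('v \<Rightarrow> int) \<Rightarrow> rat" where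
  "chi \<Gamma> k l = - form \<Gamma> (emb l) (\<lambda>j. emb l j + k j) / 2"

definition rational_graph :: "'v::{finite,linorder} plumbing \<Rightarrow> bool" where
  "rational_graph \<Gamma> \<longleftrightarrow>
     (let S = {l :: 'v \<Rightarrow> int. (\<forall>j. 0 \<le> l j) \<and> l \<noteq> (\<lambda>_. 0)}
      in \<exists>m\<in>S. (\<forall>l\<in>S. chi \<Gamma> (canonical \<Gamma>) m \<le> chi \<Gamma> (canonical \<Gamma>) l) \<and>
               0 < chi \<Gamma> (canonical \<Gamma>) m)"

section \<open>Weighted cubes\<close>

text \<open>The pair \<open>(l, I)\<close> is the cube with vertices \<open>l + (\<Sum>j\<in>I'. E\<^sub>j)\<close> for \<open>I' \<subseteq> I\<close>.\<close>

type_synonym 'v cube = "('v \<Rightarrow> int) \<times> 'v set"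

definition translate :: "('v \<Rightarrow> int) \<Rightarrow> 'v set \<Rightarrow> 'v \<Rightarrow> int" where
  "translate l I = (\<lambda>j. l j + (if j \<in> I then 1 else 0))"

text \<open>For \<open>k \<in> Char \<Gamma>\<close>, the only case of interest, \<open>chi \<Gamma> k l\<close> is an integer.\<close>

definition weight0 :: "'v::{finite,linorder} plumbing \<Rightarrow> ('v \<Rightarrow> rat) \<Rightarrow> ('v \<Rightarrow> int) \<Rightarrow> int" where
  "weight0 \<Gamma> k l = \<lfloor>chi \<Gamma> k l\<rfloor>"

definition weight1 ::
    "'v::{finite,linorder} plumbing \<Rightarrow> ('v \<Rightarrow> rat) \<Rightarrow> ('v \<Rightarrow> int) \<Rightarrow> 'v \<Rightarrow> int" where
  "weight1 \<Gamma> k l j =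
     (let a = weight0 \<Gamma> k l; b = weight0 \<Gamma> k (translate l {j})
      in max a b + int (max_h1 (genus \<Gamma> j) (nat \<bar>a - b\<bar>)))"

text \<open>
  The segments of \<open>(l, I)\<close> in direction \<open>j \<in> I\<close> start at \<open>translate l I'\<close> with \<open>I' \<subseteq> I - {j}\<close>;
  a segment is its own only segment, so the second case covers all \<open>q \<ge> 1\<close>.
\<close>

definition weight :: "'v::{finite,linorder} plumbing \<Rightarrow> ('v \<Rightarrow> rat) \<Rightarrow> 'v cube \<Rightarrow> int" where
  "weight \<Gamma> k = (\<lambda>(l, I).
     if I = {} then weight0 \<Gamma> k l
     else Max {weight1 \<Gamma> k (translate l I') j | I' j. j \<in> I \<and> I' \<subseteq> I - {j}})"

section \<open>Lattice cohomology\<close>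

text \<open>
  \<open>\<T>\<^sub>0\<^sup>+ = \<int>[U, U\<^sup>-\<^sup>1] / U \<int>[U]\<close> has the \<open>\<int>\<close>-basis \<open>U\<^sup>-\<^sup>d\<close>, \<open>d \<ge> 0\<close>. Its elements are represented
  by polynomials in \<open>U\<^sup>-\<^sup>1\<close>, the coefficient of index \<open>d\<close> being that of \<open>U\<^sup>-\<^sup>d\<close>; multiplication by
  \<open>U\<^sup>n\<close> is \<^term>\<open>poly_shift n\<close>, which drops the coefficients of index less than \<open>n\<close>.
\<close>

type_synonym tower = "int poly"

definition tower_homogeneous :: "int \<Rightarrow> tower \<Rightarrow> bool" where
  "tower_homogeneous n x \<longleftrightarrow> (\<forall>d. coeff x d \<noteq> 0 \<longrightarrow> 2 * int d = n)"

definition cochains :: "nat \<Rightarrow> ('v cube \<Rightarrow> tower) set" where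
  "cochains q = {\<phi>. \<forall>l I. card I \<noteq> q \<longrightarrow> \<phi> (l, I) = 0}"

definition cochain_homogeneous ::
    "'v::{finite,linorder} plumbing \<Rightarrow> ('v \<Rightarrow> rat) \<Rightarrow> int \<Rightarrow> ('v cube \<Rightarrow> tower) \<Rightarrow> bool" where
  "cochain_homogeneous \<Gamma> k n \<phi> \<longleftrightarrow>
     (\<forall>c. \<phi> c \<noteq> 0 \<longrightarrow> tower_homogeneous (n - 2 * weight \<Gamma> k c) (\<phi> c))"

text \<open>
  The boundary of the cube \<open>(l, I)\<close> is the sum over \<open>i \<in> I\<close> of
  \<open>(-1)\<^sup>m ((l + E\<^sub>i, I - {i}) - (l, I - {i}))\<close>, where \<open>m\<close> is the number of elements of \<open>I\<close> below \<open>i\<close>.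
\<close>

definition delta ::
    "'v::{finite,linorder} plumbing \<Rightarrow> ('v \<Rightarrow> rat) \<Rightarrow> ('v cube \<Rightarrow> tower) \<Rightarrow> 'v cube \<Rightarrow> tower" where
  "delta \<Gamma> k \<phi> = (\<lambda>(l, I). \<Sum>i\<in>I. (-1) ^ card {j \<in> I. j < i} *
     (let face = (\<lambda>c. poly_shift (nat (weight \<Gamma> k (l, I) - weight \<Gamma> k c)) (\<phi> c))
      in face (translate l {i}, I - {i}) - face (l, I - {i})))"

definition cocycles ::
    "'v::{finite,linorder} plumbing \<Rightarrow> ('v \<Rightarrow> rat) \<Rightarrow> nat \<Rightarrow> ('v cube \<Rightarrow> tower) set" where
  "cocycles \<Gamma> k q = {\<phi> \<in> cochains q. delta \<Gamma> k \<phi> = (\<lambda>_. 0)}"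

definition coboundaries ::
    "'v::{finite,linorder} plumbing \<Rightarrow> ('v \<Rightarrow> rat) \<Rightarrow> nat \<Rightarrow> ('v cube \<Rightarrow> tower) set" where
  "coboundaries \<Gamma> k q = (if q = 0 then {\<lambda>_. 0} else delta \<Gamma> k ` cochains (q - 1))"

definition cohomology_class ::
    "'v::{finite,linorder} plumbing \<Rightarrow> ('v \<Rightarrow> rat) \<Rightarrow> nat \<Rightarrow> ('v cube \<Rightarrow> tower) \<Rightarrow> ('v cube \<Rightarrow> tower) set" where
  "cohomology_class \<Gamma> k q \<phi> =
     {\<psi> \<in> cocycles \<Gamma> k q. (\<lambda>c. \<psi> c - \<phi> c) \<in> coboundaries \<Gamma> k q}"

definition lattice_cohomology ::
    "'v::{finite,linorder} plumbing \<Rightarrow> ('v \<Rightarrow> rat) \<Rightarrow> nat \<Rightarrow> ('v cube \<Rightarrow> tower) set set" where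
  "lattice_cohomology \<Gamma> k q = cohomology_class \<Gamma> k q ` cocycles \<Gamma> k q"

definition lattice_cohomology_degree ::
    "'v::{finite,linorder} plumbing \<Rightarrow> ('v \<Rightarrow> rat) \<Rightarrow> nat \<Rightarrow> int \<Rightarrow> ('v cube \<Rightarrow> tower) set set" where
  "lattice_cohomology_degree \<Gamma> k q n =
     cohomology_class \<Gamma> k q ` {\<phi> \<in> cocycles \<Gamma> k q. cochain_homogeneous \<Gamma> k n \<phi>}"

text \<open>Existence of an isomorphism of graded \<open>\<int>[U]\<close>-modules from \<open>\<bbbH>\<^sup>q(\<Gamma>, k)\<close> onto \<open>\<T>\<^sub>0\<^sup>+\<close>.\<close>

definition lattice_cohomology_iso_tower ::
    "'v::{finite,linorder} plumbing \<Rightarrow> ('v \<Rightarrow> rat) \<Rightarrow> nat \<Rightarrow> bool" where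
  "lattice_cohomology_iso_tower \<Gamma> k q \<longleftrightarrow>
     (\<exists>F :: ('v cube \<Rightarrow> tower) set \<Rightarrow> tower.
        bij_betw F (lattice_cohomology \<Gamma> k q) UNIV \<and>
        (\<forall>\<phi>\<in>cocycles \<Gamma> k q. \<forall>\<psi>\<in>cocycles \<Gamma> k q.
           F (cohomology_class \<Gamma> k q (\<lambda>c. \<phi> c + \<psi> c)) =
             F (cohomology_class \<Gamma> k q \<phi>) + F (cohomology_class \<Gamma> k q \<psi>)) \<and>
        (\<forall>\<phi>\<in>cocycles \<Gamma> k q.
           F (cohomology_class \<Gamma> k q (\<lambda>c. poly_shift 1 (\<phi> c))) =
             poly_shift 1 (F (cohomology_class \<Gamma> k q \<phi>))) \<and>
        (\<forall>n. F ` lattice_cohomology_degree \<Gamma> k q n = {x. tower_homogeneous n x}))"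

end

theory Submission
  imports Defs "HOL-Complex_Analysis.Complex_Analysis"
begin

text \<open>
  In degree \<open>0\<close> there are no coboundaries, and a cocycle of degree \<open>2n\<close> is a function on the lattice
  points of weight at most \<open>n\<close> that is constant along edges of weight at most \<open>n\<close>. So the hypothesis
  says that \<open>\<chi>\<^sub>K \<ge> 0\<close> everywhere and that the points with \<open>\<chi>\<^sub>K = 0\<close> are connected by edges of
  weight \<open>0\<close>. Suppose \<open>\<chi>\<^sub>K(l) = 0\<close> for some \<open>l > 0\<close>. Since
  \<open>\<chi>\<^sub>K(max(x, 0)) + \<chi>\<^sub>K(min(x, 0)) \<le> \<chi>\<^sub>K(x)\<close>, taking positive parts along a path from \<open>0\<close> to \<open>l\<close> gives
  a path of points with \<open>\<chi>\<^sub>K = 0\<close> in the positive orthant. Its first step leads to some \<open>E\<^sub>j\<close>, so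
  \<open>0 = \<chi>\<^sub>K(E\<^sub>j) = 1 - g\<^sub>j\<close>; but an edge in a direction of genus \<open>1\<close> has weight at least
  \<open>M\<^sup>1(0) > 0\<close>.

  That \<open>M\<^sup>1(0) > 0\<close> has two parts. The maximum exists: if a line bundle on a surface of genus \<open>1\<close> has
  a section \<open>s \<noteq> 0\<close>, then multiplication by \<open>s\<close> maps \<open>H\<^sup>1(\<O>)\<close> onto its \<open>H\<^sup>1\<close>, which is thus at most
  one-dimensional. The value \<open>1\<close> occurs for the trivial bundle on the torus \<open>\<complex>/(\<int> + \<int>\<i>)\<close>, whose
  \<open>H\<^sup>1(\<O>)\<close> is computed from Cauchy integrals: a cocycle lifts to the plane, is split near a closed
  fundamental square by bisection, and the splitting is then made periodic in the direction \<open>1\<close> and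
  periodic up to an additive constant in the direction \<open>\<i>\<close>. This constant determines the class, and
  by Liouville's theorem it vanishes for coboundaries.
\<close>

section \<open>Additive splittings of holomorphic functions\<close>

text \<open>Connectedness by paths is used in dual form. Edges of weight 0 do not cross the boundary
  of the nonpositive orthant, so the indicators of that orthant and of its complement on the zeros
  of \<chi> are cocycles of degree 0; a zero l > 0 would make both nonzero, but the tower has rank
  one in degree 0. Only genus 1 matters, because \<chi>(E_j) = 1 - g_j is neither 0 in genus 0 nor
  nonnegative in genus 2 or more. \<open>max_h1\<close> is a \<open>Max\<close>, which is
  uninformative on infinite sets, so beside one example a bound over all surfaces of genus 1 is
  needed. Euler characteristic 0 means that h^0 and h^1 agree, hence a positive h^1 provides the
  section by which one multiplies. The genus is itself a Cech dimension, so the torus has to be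
  computed from arbitrary cocycles on arbitrary pointed covers. The square lattice suits this
  because \<open>Re\<close> and \<open>Im\<close> separate its periods and the two directions can be
  treated one after the other. The second can no longer be solved freely: a function with period 1
  has a constant Fourier term, and this term is the one-dimensional cohomology.\<close>

lemma holomorphic_on_if_differentiable_at:
  "(\<And>z. z \<in> S \<Longrightarrow> f field_differentiable at z) \<Longrightarrow> f holomorphic_on S"
  by (simp add: holomorphic_on_def field_differentiable_at_within)

section \<open>Cauchy transforms, splittings and difference equations\<close>

lemma cauchy_transform_holomorphic_on:
  assumes "valid_path \<gamma>" "continuous_on (path_image \<gamma>) f"
    and "\<And>t. t \<in> {0..1} \<Longrightarrow> norm (vector_derivative \<gamma> (at t)) \<le> B"
    and int: "\<And>z. z \<notin> path_image \<gamma> \<Longrightarrow> (\<lambda>w. f w / (w - z)) contour_integrable_on \<gamma>"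
  shows "(\<lambda>z. contour_integral \<gamma> (\<lambda>w. f w / (w - z))) holomorphic_on - path_image \<gamma>"
proof -
  have "((\<lambda>z. contour_integral \<gamma> (\<lambda>w. f w / (w - z))) has_field_derivative
      (of_nat 1 * contour_integral \<gamma> (\<lambda>w. f w / (w - z) ^ Suc 1))) (at z)"
    if "z \<in> - path_image \<gamma>" for z
    by (rule Cauchy_next_derivative(2)[where S = UNIV and B = B])
       (use assms that in \<open>auto intro!: has_contour_integral_integral\<close>)
  then show ?thesis
    by (auto simp: holomorphic_on_def field_differentiable_def
        intro: has_field_derivative_at_within)
qed

text \<open>The third clause is a far-field bound: at distance at least 1 from the segment the
  kernel \<open>1 / (w - z)\<close> has norm at most 1. It later controls the sums over integer
  translates.\<close>

lemma cauchy_transform_linepath: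
  assumes "continuous_on (closed_segment a b) f"
  shows "z \<notin> closed_segment a b \<Longrightarrow> (\<lambda>w. f w / (w - z)) contour_integrable_on linepath a b"
    and "(\<lambda>z. contour_integral (linepath a b) (\<lambda>w. f w / (w - z))) holomorphic_on - closed_segment a b"
    and "\<exists>C. \<forall>z. (\<forall>w\<in>closed_segment a b. 1 \<le> norm (w - z)) \<longrightarrow>
      norm (contour_integral (linepath a b) (\<lambda>w. f w / (w - z))) \<le> C"
proof -
  show int: "(\<lambda>w. f w / (w - z)) contour_integrable_on linepath a b"
    if "z \<notin> closed_segment a b" for z
    using that by (intro contour_integrable_continuous_linepath continuous_intros assms) auto
  show "(\<lambda>z. contour_integral (linepath a b) (\<lambda>w. f w / (w - z))) holomorphic_on - closed_segment a b"
    using cauchy_transform_holomorphic_on[of "linepath a b" f "norm (b - a)"] assms int by simp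
  obtain M where M: "\<And>w. w \<in> closed_segment a b \<Longrightarrow> norm (f w) \<le> M"
    using compact_imp_bounded[OF compact_continuous_image[OF assms compact_segment]]
    by (auto simp: bounded_iff)
  have "norm (contour_integral (linepath a b) (\<lambda>w. f w / (w - z))) \<le> M * norm (b - a)"
    if z: "\<forall>w\<in>closed_segment a b. 1 \<le> norm (w - z)" for z
  proof (rule contour_integral_bound_linepath)
    have "z \<notin> closed_segment a b" using z by force
    then show "(\<lambda>w. f w / (w - z)) contour_integrable_on linepath a b" by (rule int)
    show "0 \<le> M" using order_trans[OF norm_ge_zero M[of a]] by simp
    fix w assume w: "w \<in> closed_segment a b"
    have "norm (f w / (w - z)) = norm (f w) / norm (w - z)" by (rule norm_divide)
    also have "\<dots> \<le> M / 1" using M[OF w] z w \<open>0 \<le> M\<close> by (intro frac_le) auto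
    finally show "norm (f w / (w - z)) \<le> M" by simp
  qed
  then show "\<exists>C. \<forall>z. (\<forall>w\<in>closed_segment a b. 1 \<le> norm (w - z)) \<longrightarrow>
      norm (contour_integral (linepath a b) (\<lambda>w. f w / (w - z))) \<le> C" by blast
qed

text \<open>Cauchy's formula on the boundary of the rectangle, distributed over its sides: the right
  side yields \<open>g1\<close>, the other three yield \<open>g2\<close>. Each is holomorphic off
  its own sides, hence on a half-strip reaching far beyond the rectangle; the open strip avoids the
  horizontal sides.\<close>

lemma rectangle_splitting:
  assumes f: "f holomorphic_on S" and S: "cbox (Complex x0 y0) (Complex x1 y1) \<subseteq> S"
    and x: "x0 < x1" and y: "y0 < y1"
  obtains g1 g2 C where
    "g1 holomorphic_on {z. Re z < x1 \<and> y0 < Im z \<and> Im z < y1}"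
    "g2 holomorphic_on {z. x0 < Re z \<and> y0 < Im z \<and> Im z < y1}"
    "\<And>z. z \<in> box (Complex x0 y0) (Complex x1 y1) \<Longrightarrow> f z = g1 z + g2 z"
    "\<And>z. Re z \<le> x0 - 1 \<Longrightarrow> norm (g1 z) \<le> C"
    "\<And>z. x1 + 1 \<le> Re z \<Longrightarrow> norm (g2 z) \<le> C"
proof -
  define a1 a2 a3 a4 where a: "a1 = Complex x0 y0" "a2 = Complex x1 y0" "a3 = Complex x1 y1" "a4 = Complex x0 y1"
  have fS: "f holomorphic_on cbox a1 a3" using f S a holomorphic_on_subset by metis
  have seg: "closed_segment a1 a2 \<subseteq> cbox a1 a3" "closed_segment a2 a3 \<subseteq> cbox a1 a3"
     "closed_segment a3 a4 \<subseteq> cbox a1 a3" "closed_segment a4 a1 \<subseteq> cbox a1 a3"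
    by (rule closed_segment_subset; use x y in \<open>simp add: a in_cbox_complex_iff\<close>)+
  have mem: "w \<in> closed_segment a1 a2 \<Longrightarrow> Im w = y0" "w \<in> closed_segment a2 a3 \<Longrightarrow> Re w = x1"
     "w \<in> closed_segment a3 a4 \<Longrightarrow> Im w = y1" "w \<in> closed_segment a4 a1 \<Longrightarrow> Re w = x0" for w
    using x y
    by (auto simp: a closed_segment_same_Re closed_segment_same_Im)
  have ct: "continuous_on (cbox a1 a3) f" using fS by (rule holomorphic_on_imp_continuous_on)
  note cont = continuous_on_subset[OF ct seg(1)] continuous_on_subset[OF ct seg(2)]
     continuous_on_subset[OF ct seg(3)] continuous_on_subset[OF ct seg(4)]
  define T where "T u v z = contour_integral (linepath u v) (\<lambda>w. f w / (w - z))" for u v z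
  note hol = cauchy_transform_linepath(2)[OF cont(1)] cauchy_transform_linepath(2)[OF cont(2)]
     cauchy_transform_linepath(2)[OF cont(3)] cauchy_transform_linepath(2)[OF cont(4)]
  obtain C1 C2 C3 C4 where C:
    "\<And>z. (\<forall>w\<in>closed_segment a1 a2. 1 \<le> norm (w - z)) \<Longrightarrow> norm (T a1 a2 z) \<le> C1"
    "\<And>z. (\<forall>w\<in>closed_segment a2 a3. 1 \<le> norm (w - z)) \<Longrightarrow> norm (T a2 a3 z) \<le> C2"
    "\<And>z. (\<forall>w\<in>closed_segment a3 a4. 1 \<le> norm (w - z)) \<Longrightarrow> norm (T a3 a4 z) \<le> C3"
    "\<And>z. (\<forall>w\<in>closed_segment a4 a1. 1 \<le> norm (w - z)) \<Longrightarrow> norm (T a4 a1 z) \<le> C4"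
    using cauchy_transform_linepath(3)[OF cont(1), folded T_def] cauchy_transform_linepath(3)[OF cont(2), folded T_def]
     cauchy_transform_linepath(3)[OF cont(3), folded T_def] cauchy_transform_linepath(3)[OF cont(4), folded T_def]
    by blast
  have far: "1 \<le> norm (w - z)" if "w \<in> cbox a1 a3" "Re z \<le> x0 - 1 \<or> x1 + 1 \<le> Re z" for w z
  proof -
    have "1 \<le> \<bar>Re (w - z)\<bar>" using that by (auto simp: a in_cbox_complex_iff)
    then show ?thesis using abs_Re_le_cmod[of "w - z"] by linarith
  qed
  let ?g1 = "\<lambda>z. T a2 a3 z / (2 * pi * \<i>)"
  let ?g2 = "\<lambda>z. (T a1 a2 z + T a3 a4 z + T a4 a1 z) / (2 * pi * \<i>)"
  show ?thesis
  proof (rule that[of ?g1 ?g2 "\<bar>C1\<bar> + \<bar>C2\<bar> + \<bar>C3\<bar> + \<bar>C4\<bar>"])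
    show "?g1 holomorphic_on {z. Re z < x1 \<and> y0 < Im z \<and> Im z < y1}"
      unfolding T_def by (intro holomorphic_intros holomorphic_on_subset[OF hol(2)]) (auto dest: mem)
    show "?g2 holomorphic_on {z. x0 < Re z \<and> y0 < Im z \<and> Im z < y1}"
      unfolding T_def
      by (intro holomorphic_intros holomorphic_on_subset[OF hol(1)] holomorphic_on_subset[OF hol(3)]
          holomorphic_on_subset[OF hol(4)]) (auto dest: mem)
    show "f z = ?g1 z + ?g2 z" if "z \<in> box (Complex x0 y0) (Complex x1 y1)" for z
    proof -
      have z: "z \<in> box a1 a3" using that a by simp
      have ni: "z \<notin> closed_segment a1 a2" "z \<notin> closed_segment a2 a3" "z \<notin> closed_segment a3 a4"
          "z \<notin> closed_segment a4 a1"
        using z mem by (auto simp: a in_box_complex_iff)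
      have r: "rectpath a1 a3 = linepath a1 a2 +++ linepath a2 a3 +++ linepath a3 a4 +++ linepath a4 a1"
        by (simp add: rectpath_def a Let_def)
      have img: "path_image (rectpath a1 a3) \<subseteq> cbox a1 a3 - {z}"
        using path_image_rectpath_subset_cbox[of a1 a3] path_image_rectpath_inter_box[of a1 a3] z x y
        by (auto simp: a)
      have "((\<lambda>w. f w / (w - z)) has_contour_integral (2 * pi * \<i> * winding_number (rectpath a1 a3) z * f z)) (rectpath a1 a3)"
        by (rule Cauchy_integral_formula_convex_simple[OF convex_box(1) fS])
           (use z img in auto)
      then have 1: "contour_integral (rectpath a1 a3) (\<lambda>w. f w / (w - z)) = 2 * pi * \<i> * f z"
        using winding_number_rectpath[OF z] by (auto dest!: contour_integral_unique)
      have "contour_integral (rectpath a1 a3) (\<lambda>w. f w / (w - z)) = T a1 a2 z + (T a2 a3 z + (T a3 a4 z + T a4 a1 z))"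
        unfolding T_def r using cauchy_transform_linepath(1)[OF cont(1) ni(1)] cauchy_transform_linepath(1)[OF cont(2) ni(2)]
          cauchy_transform_linepath(1)[OF cont(3) ni(3)] cauchy_transform_linepath(1)[OF cont(4) ni(4)]
        by simp
      with 1 have "2 * pi * \<i> * f z = T a1 a2 z + (T a2 a3 z + (T a3 a4 z + T a4 a1 z))" by simp
      then show ?thesis by (simp add: field_simps)
    qed
    have d: "norm (u / (2 * pi * \<i>)) \<le> norm u" for u
    proof -
      have "1 \<le> 2 * pi" using pi_gt3 by linarith
      then show ?thesis by (simp add: norm_divide norm_mult divide_le_eq mult_right_le_one_le
          mult_le_cancel_left1)
    qed
    show "norm (?g1 z) \<le> \<bar>C1\<bar> + \<bar>C2\<bar> + \<bar>C3\<bar> + \<bar>C4\<bar>"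
      if "Re z \<le> x0 - 1" for z
    proof -
      have "norm (T a2 a3 z) \<le> C2" using C(2)[of z] far seg that by blast
      then show ?thesis using d[of "T a2 a3 z"] by linarith
    qed
    show "norm (?g2 z) \<le> \<bar>C1\<bar> + \<bar>C2\<bar> + \<bar>C3\<bar> + \<bar>C4\<bar>"
      if "x1 + 1 \<le> Re z" for z
    proof -
      have "norm (T a1 a2 z) \<le> C1" "norm (T a3 a4 z) \<le> C3" "norm (T a4 a1 z) \<le> C4"
        using C(1,3,4)[of z] far seg that by blast+
      then show ?thesis
        using d[of "T a1 a2 z + T a3 a4 z + T a4 a1 z"]
          norm_triangle_ineq[of "T a1 a2 z + T a3 a4 z" "T a4 a1 z"]
          norm_triangle_ineq[of "T a1 a2 z" "T a3 a4 z"] by linarith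
    qed
  qed
qed

text \<open>Substituting \<open>\<i> * z\<close> for \<open>z\<close> exchanges the horizontal and
  the vertical direction. This version joins solutions that lie above each other.\<close>

lemma rectangle_splitting_vertical:
  assumes f: "f holomorphic_on S" and S: "cbox (Complex x0 y0) (Complex x1 y1) \<subseteq> S"
    and x: "x0 < x1" and y: "y0 < y1"
  obtains g1 g2 where
    "g1 holomorphic_on {z. Im z < y1 \<and> x0 < Re z \<and> Re z < x1}"
    "g2 holomorphic_on {z. y0 < Im z \<and> x0 < Re z \<and> Re z < x1}"
    "\<And>z. z \<in> box (Complex x0 y0) (Complex x1 y1) \<Longrightarrow> f z = g1 z + g2 z"
proof -
  have hol: "(\<lambda>z. f (\<i> * z)) holomorphic_on cbox (Complex y0 (- x1)) (Complex y1 (- x0))"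
    by (rule holomorphic_on_compose_gen[OF _ f, unfolded o_def])
       (use S in \<open>auto intro!: holomorphic_intros simp: in_cbox_complex_iff subset_iff\<close>)
  obtain g1 g2 C where g: "g1 holomorphic_on {z. Re z < y1 \<and> - x1 < Im z \<and> Im z < - x0}"
    "g2 holomorphic_on {z. y0 < Re z \<and> - x1 < Im z \<and> Im z < - x0}"
    "\<And>z. z \<in> box (Complex y0 (- x1)) (Complex y1 (- x0)) \<Longrightarrow> f (\<i> * z) = g1 z + g2 z"
    by (rule rectangle_splitting[OF hol order_refl y]) (use x in auto)
  show ?thesis
  proof (rule that[of "\<lambda>z. g1 (- \<i> * z)" "\<lambda>z. g2 (- \<i> * z)"])
    show "(\<lambda>z. g1 (- \<i> * z)) holomorphic_on {z. Im z < y1 \<and> x0 < Re z \<and> Re z < x1}"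
      by (rule holomorphic_on_compose_gen[OF _ g(1), unfolded o_def]) (auto intro!: holomorphic_intros)
    show "(\<lambda>z. g2 (- \<i> * z)) holomorphic_on {z. y0 < Im z \<and> x0 < Re z \<and> Re z < x1}"
      by (rule holomorphic_on_compose_gen[OF _ g(2), unfolded o_def]) (auto intro!: holomorphic_intros)
    show "f z = g1 (- \<i> * z) + g2 (- \<i> * z)" if "z \<in> box (Complex x0 y0) (Complex x1 y1)" for z
      using g(3)[of "- \<i> * z"] that by (auto simp: in_box_complex_iff)
  qed
qed

lemma cbox_enlarge:
  assumes W: "open W" "cbox (Complex a c) (Complex b d) \<subseteq> W" and ab: "a \<le> b" "c \<le> d"
  obtains \<epsilon> where "0 < \<epsilon>" "cbox (Complex (a - \<epsilon>) (c - \<epsilon>)) (Complex (b + \<epsilon>) (d + \<epsilon>)) \<subseteq> W"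
proof -
  obtain e where e: "0 < e" "(\<Union>x\<in>cbox (Complex a c) (Complex b d). ball x e) \<subseteq> W"
    using compact_subset_open_imp_ball_epsilon_subset[OF compact_cbox W] by auto
  \<comment> \<open>With \<open>e/3\<close> in each coordinate the sum of both deviations, which
    bounds the norm, stays below \<open>e\<close>.\<close>
  have "z \<in> W" if z: "z \<in> cbox (Complex (a - e/3) (c - e/3)) (Complex (b + e/3) (d + e/3))" for z
  proof -
    \<comment> \<open>The point of the rectangle nearest to \<open>z\<close>, obtained by clamping
      both coordinates.\<close>
    define u where "u = Complex (max a (min b (Re z))) (max c (min d (Im z)))"
    have u: "u \<in> cbox (Complex a c) (Complex b d)" using ab by (auto simp: u_def in_cbox_complex_iff)
    have "\<bar>Re (u - z)\<bar> \<le> e/3" "\<bar>Im (u - z)\<bar> \<le> e/3"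
      using z ab e by (auto simp: u_def in_cbox_complex_iff abs_le_iff max_def min_def)
    then have "norm (u - z) < e" using cmod_le[of "u - z"] e by linarith
    then have "z \<in> ball u e" by (simp add: dist_norm)
    then show ?thesis using u e(2) by blast
  qed
  then show ?thesis using that[of "e/3"] e by auto
qed

text \<open>The bound is asked for only eventually because the first translates of a point may still
  lie too close to the contour for the far-field estimates.\<close>

lemma holomorphic_series_M_test:
  fixes f :: "nat \<Rightarrow> complex \<Rightarrow> complex" and h :: "nat \<Rightarrow> real"
  assumes "open S" "\<And>n. f n holomorphic_on S" "summable h" "\<And>n. 0 \<le> h n"
    and bound: "\<forall>\<^sub>F n in sequentially. \<forall>z\<in>S. norm (f n z) \<le> h n"
  obtains F where "F holomorphic_on S" "\<And>z. z \<in> S \<Longrightarrow> (\<lambda>n. f n z) sums F z"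
proof -
  have "\<exists>d g. 0 < d \<and> summable g \<and> range g \<subseteq> \<real>\<^sub>\<ge>\<^sub>0 \<and>
      (\<forall>\<^sub>F n in sequentially. \<forall>y\<in>ball z d \<inter> S. cmod (f n y) \<le> cmod (g n))" for z
  proof (intro exI conjI)
    show "\<forall>\<^sub>F n in sequentially. \<forall>y\<in>ball z 1 \<inter> S. cmod (f n y) \<le> cmod (complex_of_real (h n))"
      using bound by eventually_elim (use assms(4) in auto)
  qed (use assms(3,4) in auto)
  note comparison = this
  obtain F where "\<forall>z\<in>S. (\<lambda>n. f n z) sums F z \<and> F field_differentiable at z"
    by (rule series_differentiable_comparison_complex[OF assms(1)
          holomorphic_on_imp_differentiable_at[OF assms(2,1)] comparison])
  then show ?thesis using that[of F] by (auto simp: holomorphic_on_def intro: field_differentiable_at_within)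
qed

text \<open>With \<open>f = g\<^sub>1 + g\<^sub>2\<close> split along the thin rectangle, the solution is
  \<open>u(z) = (\<Sum>n\<ge>1. g\<^sub>1(z - n)) - (\<Sum>n\<ge>0. g\<^sub>2(z + n))\<close>. The rectangle splitting is only bounded, so it
  is applied to \<open>f(z) (z - p)\<^sup>2\<close> to make these sums converge.\<close>

lemma horizontal_difference_equation:
  assumes f: "f holomorphic_on S" and S: "cbox (Complex (- \<epsilon>) y0) (Complex \<epsilon> y1) \<subseteq> S"
    and \<epsilon>: "0 < \<epsilon>" "\<epsilon> < 1/2" and y: "y0 < y1"
  obtains u where
    "u holomorphic_on {z. - \<epsilon> < Re z \<and> Re z < 1 + \<epsilon> \<and> y0 < Im z \<and> Im z < y1}"
    "\<And>z. z \<in> box (Complex (- \<epsilon>) y0) (Complex \<epsilon> y1) \<Longrightarrow> u (z + 1) - u z = f z"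
proof -
  \<comment> \<open>A point on the upper edge: it lies outside the open strip and all its horizontal
    translates, so dividing by \<open>(z - p)^2\<close> creates no pole.\<close>
  define p where "p = Complex 0 y1"
  have "(\<lambda>z. f z * (z - p)^2) holomorphic_on S" by (intro holomorphic_intros f)
  then obtain G1 G2 C where
    G1: "G1 holomorphic_on {z. Re z < \<epsilon> \<and> y0 < Im z \<and> Im z < y1}" and
    G2: "G2 holomorphic_on {z. - \<epsilon> < Re z \<and> y0 < Im z \<and> Im z < y1}" and
    G: "\<And>z. z \<in> box (Complex (- \<epsilon>) y0) (Complex \<epsilon> y1) \<Longrightarrow> f z * (z - p)^2 = G1 z + G2 z" and
    C1: "\<And>z. Re z \<le> - \<epsilon> - 1 \<Longrightarrow> norm (G1 z) \<le> C" and
    C2: "\<And>z. \<epsilon> + 1 \<le> Re z \<Longrightarrow> norm (G2 z) \<le> C"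
    by (rule rectangle_splitting[OF _ S]) (use \<epsilon> y in auto)
  define g1 g2 where g: "g1 z = G1 z / (z - p)^2" "g2 z = G2 z / (z - p)^2" for z
  let ?S1 = "{z. Re z < \<epsilon> \<and> y0 < Im z \<and> Im z < y1}"
  let ?S2 = "{z. - \<epsilon> < Re z \<and> y0 < Im z \<and> Im z < y1}"
  let ?S3 = "{z. Re z < 1 + \<epsilon> \<and> y0 < Im z \<and> Im z < y1}"
  have o: "open ?S1" "open ?S2" "open ?S3"
    by (intro open_Collect_conj open_Collect_less continuous_intros)+
  have p: "z \<noteq> p" if "Im z < y1" for z using that by (auto simp: p_def)
  have g1: "g1 holomorphic_on ?S1" and g2: "g2 holomorphic_on ?S2"
    unfolding g by (intro holomorphic_intros G1 G2; use p in auto)+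
  have C0: "0 \<le> C" using order_trans[OF norm_ge_zero C2[of "of_real (\<epsilon> + 1)"]] by simp
  have decay: "norm (a / (z - p)^2) \<le> 4 * C / real n ^ 2"
    if "norm a \<le> C" "real n / 2 \<le> \<bar>Re z\<bar>" "1 \<le> n" for a z n
  proof -
    have "real n / 2 \<le> norm (z - p)"
      using that(2) abs_Re_le_cmod[of "z - p"] by (simp add: p_def)
    then have "(real n / 2)^2 \<le> norm (z - p)^2" by (intro power_mono) auto
    then have "norm a / norm (z - p)^2 \<le> C / (real n / 2)^2"
      using that C0 by (intro frac_le) auto
    then show ?thesis using C0 by (simp add: norm_divide norm_power norm_mult field_simps)
  qed
  have summ: "summable (\<lambda>n. 4 * C / real n ^ 2)"
    using summable_mult[OF inverse_power_summable[of 2, where 'a=real], of "4 * C"]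
    by (simp add: field_simps)
  obtain F2 where F2: "F2 holomorphic_on ?S2" "\<And>z. z \<in> ?S2 \<Longrightarrow> (\<lambda>n. g2 (z + of_nat n)) sums F2 z"
  proof (rule holomorphic_series_M_test[OF o(2), of "\<lambda>n z. g2 (z + of_nat n)"])
    show "(\<lambda>z. g2 (z + of_nat n)) holomorphic_on ?S2" for n
      by (rule holomorphic_on_compose_gen[OF _ g2, unfolded o_def]) (auto intro!: holomorphic_intros)
    show "\<forall>\<^sub>F n in sequentially. \<forall>z\<in>?S2. norm (g2 (z + of_nat n)) \<le> 4 * C / real n ^ 2"
      \<comment> \<open>From \<open>n = 2\<close> on, \<open>\<epsilon> < 1/2\<close> gives
        \<open>n - \<epsilon> \<ge> 1 + \<epsilon>\<close>, where the far-field bound holds, and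
        \<open>n - \<epsilon> \<ge> n / 2\<close>, which gives the quadratic decay.\<close>
      using eventually_ge_at_top[of 2]
    proof eventually_elim
      case (elim n)
      show ?case unfolding g
      proof (intro ballI decay C2)
        fix z assume "z \<in> ?S2"
        then show "\<epsilon> + 1 \<le> Re (z + of_nat n)" "real n / 2 \<le> \<bar>Re (z + of_nat n)\<bar>"
          using elim \<epsilon> by auto
      qed (use elim in auto)
    qed
  qed (use summ C0 in auto)
  obtain F1 where F1: "F1 holomorphic_on ?S3" "\<And>z. z \<in> ?S3 \<Longrightarrow> (\<lambda>n. g1 (z - 1 - of_nat n)) sums F1 z"
  proof (rule holomorphic_series_M_test[OF o(3), of "\<lambda>n z. g1 (z - 1 - of_nat n)"])
    show "(\<lambda>z. g1 (z - 1 - of_nat n)) holomorphic_on ?S3" for n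
      by (rule holomorphic_on_compose_gen[OF _ g1, unfolded o_def]) (auto intro!: holomorphic_intros)
    show "\<forall>\<^sub>F n in sequentially. \<forall>z\<in>?S3. norm (g1 (z - 1 - of_nat n)) \<le> 4 * C / real n ^ 2"
      using eventually_ge_at_top[of 2]
    proof eventually_elim
      case (elim n)
      show ?case unfolding g
      proof (intro ballI decay C1)
        fix z assume "z \<in> ?S3"
        then show "Re (z - 1 - of_nat n) \<le> - \<epsilon> - 1" "real n / 2 \<le> \<bar>Re (z - 1 - of_nat n)\<bar>"
          using elim \<epsilon> by auto
      qed (use elim in auto)
    qed
  qed (use summ C0 in auto)
  show ?thesis
  proof (rule that[of "\<lambda>z. F1 z - F2 z"])
    show "(\<lambda>z. F1 z - F2 z) holomorphic_on {z. - \<epsilon> < Re z \<and> Re z < 1 + \<epsilon> \<and> y0 < Im z \<and> Im z < y1}"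
      by (intro holomorphic_intros holomorphic_on_subset[OF F1(1)] holomorphic_on_subset[OF F2(1)]) auto
    fix z assume z: "z \<in> box (Complex (- \<epsilon>) y0) (Complex \<epsilon> y1)"
    then have zz: "- \<epsilon> < Re z" "Re z < \<epsilon>" "y0 < Im z" "Im z < y1" by (auto simp: in_box_complex_iff)
    have "(\<lambda>n. g2 ((z + 1) + of_nat n)) sums F2 (z + 1)" by (rule F2(2)) (use zz in auto)
    then have "(\<lambda>n. g2 (z + of_nat (Suc n))) sums F2 (z + 1)" by (simp add: add_ac)
    then have "(\<lambda>n. g2 (z + of_nat n)) sums (F2 (z + 1) + g2 z)" by (subst (asm) sums_Suc_iff) simp
    then have 2: "F2 z = F2 (z + 1) + g2 z" using F2(2)[of z] zz by (auto dest: sums_unique2)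
    have "(\<lambda>n. g1 (z - 1 - of_nat n)) sums F1 z" by (rule F1(2)) (use zz \<epsilon> in auto)
    then have "(\<lambda>n. g1 (z + 1 - 1 - of_nat (Suc n))) sums F1 z" by (simp add: algebra_simps)
    then have "(\<lambda>n. g1 (z + 1 - 1 - of_nat n)) sums (F1 z + g1 z)" by (subst (asm) sums_Suc_iff) simp
    then have 1: "F1 (z + 1) = F1 z + g1 z" using F1(2)[of "z + 1"] zz by (auto dest: sums_unique2)
    have "f z * (z - p)^2 = (g1 z + g2 z) * (z - p)^2" using G[OF z] p zz by (simp add: g field_simps)
    then have "f z = g1 z + g2 z" using p zz by auto
    with 1 2 show "F1 (z + 1) - F2 (z + 1) - (F1 z - F2 z) = f z" by simp
  qed
qed

text \<open>The Laurent decomposition: \<open>f1\<close> is the Cauchy transform over the outer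
  circle and \<open>f2\<close> the negative of the one over the inner circle. The last clause makes
  \<open>f2\<close> tend to 0 at infinity, which fixes where the constant term goes, namely into
  \<open>f1\<close>.\<close>

lemma annulus_splitting:
  assumes f: "f holomorphic_on {q. r < norm q \<and> norm q < R}"
    and r: "0 \<le> r" "r < r1" "r1 < R1" "R1 < R"
  obtains f1 f2 C where
    "f1 holomorphic_on ball 0 R1" "f2 holomorphic_on {q. r1 < norm q}"
    "\<And>q. r1 < norm q \<Longrightarrow> norm q < R1 \<Longrightarrow> f q = f1 q + f2 q"
    "\<And>q. r1 < norm q \<Longrightarrow> norm (f2 q) \<le> C / (norm q - r1)"
proof -
  let ?A = "{q :: complex. r < norm q \<and> norm q < R}"
  have oA: "open ?A" by (intro open_Collect_conj open_Collect_less continuous_intros)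
  have cA: "continuous_on (path_image (circlepath 0 t)) f" if "r < t" "t < R" for t
    using holomorphic_on_imp_continuous_on[OF f] by (rule continuous_on_subset) (use that r in auto)
  define T where "T t q = contour_integral (circlepath 0 t) (\<lambda>w. f w / (w - q))" for t q
  have int: "(\<lambda>w. f w / (w - q)) contour_integrable_on circlepath 0 t"
    if "r < t" "t < R" "q \<notin> path_image (circlepath 0 t)" for t q
    by (intro contour_integrable_continuous_circlepath continuous_intros cA) (use that in auto)
  have hol: "T t holomorphic_on - path_image (circlepath 0 t)" if "r < t" "t < R" for t
    unfolding T_def
    by (rule cauchy_transform_holomorphic_on[where B = "2 * pi * \<bar>t\<bar>"])
       (use that cA int in \<open>auto simp: vector_derivative_circlepath norm_mult\<close>)
  obtain M where M: "\<And>w. w \<in> path_image (circlepath 0 r1) \<Longrightarrow> norm (f w) \<le> M"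
  proof -
    have "bounded (f ` path_image (circlepath 0 r1))"
      by (intro compact_imp_bounded compact_continuous_image cA compact_path_image path_circlepath) (use r in auto)
    then show ?thesis using that unfolding bounded_iff by blast
  qed
  have M0: "0 \<le> M" using order_trans[OF norm_ge_zero M[of "of_real r1"]] r by simp
  show ?thesis
  proof (rule that[of "\<lambda>q. T R1 q / (2 * pi * \<i>)" "\<lambda>q. - T r1 q / (2 * pi * \<i>)" "M * (2 * pi * r1)"])
    show "(\<lambda>q. T R1 q / (2 * pi * \<i>)) holomorphic_on ball 0 R1"
      by (intro holomorphic_intros holomorphic_on_subset[OF hol]) (use r in auto)
    show "(\<lambda>q. - T r1 q / (2 * pi * \<i>)) holomorphic_on {q. r1 < norm q}"
      by (intro holomorphic_intros holomorphic_on_subset[OF hol]) (use r in auto)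
    show "norm (- T r1 q / (2 * pi * \<i>)) \<le> M * (2 * pi * r1) / (norm q - r1)" if q: "r1 < norm q" for q
    proof -
      have "norm (T r1 q) \<le> (M / (norm q - r1)) * (2 * pi * r1)"
        unfolding T_def
      proof (rule has_contour_integral_bound_circlepath)
        show "((\<lambda>w. f w / (w - q)) has_contour_integral
          contour_integral (circlepath 0 r1) (\<lambda>w. f w / (w - q))) (circlepath 0 r1)"
          by (intro has_contour_integral_integral int) (use q r in auto)
        fix w :: complex assume w: "norm (w - 0) = r1"
        have "norm q - r1 \<le> norm (w - q)" using w norm_triangle_ineq2[of q w] by (simp add: norm_minus_commute)
        then show "norm (f w / (w - q)) \<le> M / (norm q - r1)"
          unfolding norm_divide using M[of w] w r q M0 by (intro frac_le) auto
      qed (use r q M0 in auto)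
      moreover have "norm (- T r1 q / (2 * pi * \<i>)) \<le> norm (T r1 q)"
      proof -
        have "1 \<le> 2 * pi" using pi_gt3 by linarith
        then show ?thesis by (simp add: norm_divide norm_mult divide_le_eq mult_le_cancel_left1)
      qed
      ultimately show ?thesis by simp
    qed
    show "f q = T R1 q / (2 * pi * \<i>) + (- T r1 q / (2 * pi * \<i>))" if q: "r1 < norm q" "norm q < R1" for q
    proof -
      \<comment> \<open>The difference quotient extends over \<open>q\<close>, so its integrals over
        the two homotopic circles agree. The winding numbers 1 and 0 around \<open>q\<close> then
        leave exactly one copy of \<open>f q\<close>.\<close>
      define F where "F z = (if z = q then deriv f q else (f z - f q) / (z - q))" for z
      have F: "F holomorphic_on ?A"
        unfolding F_def by (rule pole_lemma[OF f]) (use oA q r in \<open>auto simp: interior_open\<close>)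
      have "homotopic_loops ?A (circlepath 0 r1) (circlepath 0 R1)"
      proof (rule homotopic_loops_linear)
        fix t :: real assume "t \<in> {0..1}"
        let ?e = "exp (2 * of_real pi * \<i> * of_real t)"
        have e: "norm ?e = 1" by simp
        show "closed_segment (circlepath 0 r1 t) (circlepath 0 R1 t) \<subseteq> ?A"
        proof
          fix w assume "w \<in> closed_segment (circlepath 0 r1 t) (circlepath 0 R1 t)"
          then obtain s where s: "0 \<le> s" "s \<le> 1"
            "w = (1 - s) *\<^sub>R circlepath 0 r1 t + s *\<^sub>R circlepath 0 R1 t"
            by (auto simp: closed_segment_def)
          then have w: "w = of_real ((1 - s) * r1 + s * R1) * ?e"
            by (simp add: circlepath scaleR_conv_of_real algebra_simps)
          have "r1 \<le> (1 - s) * r1 + s * R1" "(1 - s) * r1 + s * R1 \<le> R1"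
            using convex_bound_le[of r1 R1 R1 "1 - s" s] mult_left_mono[of r1 R1 s] s r
            by (auto simp: algebra_simps)
          then show "w \<in> ?A" unfolding w mem_Collect_eq norm_mult e norm_of_real using r by auto
        qed
      qed auto
      then have eq: "contour_integral (circlepath 0 r1) F = contour_integral (circlepath 0 R1) F"
        by (rule Cauchy_theorem_homotopic_loops[OF _ oA F]) auto
      have *: "contour_integral (circlepath 0 t) F = T t q - f q * (2 * pi * \<i> * winding_number (circlepath 0 t) q)"
        if t: "r < t" "t < R" "t \<noteq> norm q" for t
      proof -
        have qn: "q \<notin> path_image (circlepath 0 t)" using t r by auto
        have "((\<lambda>w. f w / (w - q) - f q * (1 / (w - q))) has_contour_integral
            T t q - f q * (2 * pi * \<i> * winding_number (circlepath 0 t) q)) (circlepath 0 t)"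
          unfolding T_def
          by (intro has_contour_integral_diff has_contour_integral_lmul has_contour_integral_integral int
              has_contour_integral_winding_number) (use t qn in auto)
        then have "(F has_contour_integral
            T t q - f q * (2 * pi * \<i> * winding_number (circlepath 0 t) q)) (circlepath 0 t)"
          by (rule has_contour_integral_eq) (use qn in \<open>auto simp: F_def diff_divide_distrib\<close>)
        then show ?thesis by (rule contour_integral_unique)
      qed
      have "winding_number (circlepath 0 R1) q = 1" using q by (intro winding_number_circlepath) auto
      moreover have "winding_number (circlepath 0 r1) q = 0"
        by (rule winding_number_zero_outside[where s = "cball 0 r1"]) (use q r in auto)
      ultimately have "T r1 q = T R1 q - f q * (2 * pi * \<i>)"
        using *[of r1] *[of R1] eq q r by simp
      then show ?thesis by (simp add: field_simps)
    qed
  qed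
qed

text \<open>In the coordinate \<open>q = exp(2\<pi>iz)\<close> the function \<open>b\<close> lives on an annulus, where it splits as
  \<open>f\<^sub>1 + f\<^sub>2\<close>; the solution is \<open>(\<Sum>n\<ge>1. f\<^sub>2(z - ni)) - (\<Sum>n\<ge>0. f\<^sub>1(z + ni) - f\<^sub>1(0))\<close>, where
  \<open>f\<^sub>1(0)\<close> refers to \<open>q = 0\<close> and is the obstruction \<open>c\<close>.\<close>

lemma vertical_difference_equation:
  assumes b: "b holomorphic_on {z. \<bar>Im z\<bar> < \<epsilon>}"
    and per: "\<And>z. \<bar>Im z\<bar> < \<epsilon> \<Longrightarrow> b (z + 1) = b z"
    and \<delta>: "0 < \<delta>" "\<delta> < \<epsilon>" "\<delta> < 1"
  obtains v c where
    "v holomorphic_on {z. - \<delta> < Im z \<and> Im z < 1 + \<delta>}"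
    "\<And>z. v (z + 1) = v z"
    "\<And>z. \<bar>Im z\<bar> < \<delta> \<Longrightarrow> v (z + \<i>) - v z = b z - c"
proof -
  define e where "e z = exp (2 * pi * \<i> * z)" for z
  have norm_e: "norm (e z) = exp (- (2 * pi * Im z))" for z by (simp add: e_def norm_exp_eq_Re)
  have norm_e_bounds: "exp (- (2 * pi * d)) < norm (e z)" "norm (e z) < exp (2 * pi * d)" if "\<bar>Im z\<bar> < d" for z d
  proof -
    have "2 * pi * Im z < 2 * pi * d" "2 * pi * (- Im z) < 2 * pi * d"
      using that by (intro mult_strict_left_mono; simp)+
    then show "exp (- (2 * pi * d)) < norm (e z)" "norm (e z) < exp (2 * pi * d)"
      unfolding norm_e by simp_all
  qed
  have e1: "e (z + 1) = e z" for z by (simp add: e_def ring_distribs exp_add exp_eq_1)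
  have per_nat: "b (z + of_nat n) = b z" if "\<bar>Im z\<bar> < \<epsilon>" for z n
    using that per[of "z + of_nat k" for k] by (induction n) (auto simp: add_ac)
  have per_int: "b z = b w" if strip: "\<bar>Im z\<bar> < \<epsilon>" and ezw: "e z = e w" for z w
  proof -
    obtain n :: int where "2 * pi * \<i> * z = 2 * pi * \<i> * w + of_real (of_int (2 * n) * pi) * \<i>"
      using ezw unfolding e_def exp_eq by blast
    then have "(2 * pi * \<i>) * (z - w - of_int n) = 0" by (simp add: algebra_simps)
    then have "z - w = of_int n" by simp
    then have zw: "z = w + of_int n" by (simp add: diff_eq_eq add.commute)
    show ?thesis
    proof (cases "0 \<le> n")
      case True
      then show ?thesis using per_nat[of w "nat n"] strip zw by simp
    next
      case False
      then show ?thesis using per_nat[of z "nat (- n)"] strip zw by simp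
    qed
  qed
  let ?A = "{q :: complex. exp (- (2 * pi * \<epsilon>)) < norm q \<and> norm q < exp (2 * pi * \<epsilon>)}"
  \<comment> \<open>The principal logarithm is an arbitrary choice and jumps along its cut; by
    \<open>per_int\<close> every other logarithm gives the same value.\<close>
  define f where "f q = b (Ln q / (2 * pi * \<i>))" for q
  have e_log: "e (l / (2 * pi * \<i>)) = exp l" for l by (simp add: e_def field_simps)
  have Im_log: "\<bar>Im (l / (2 * pi * \<i>))\<bar> < \<epsilon>" if "exp l \<in> ?A" for l
  proof -
    have eq: "2 * pi * Im (l / (2 * pi * \<i>)) = - Re l"
      by (simp add: Im_divide power2_eq_square field_simps)
    have "exp (- (2 * pi * \<epsilon>)) < exp (Re l)" "exp (Re l) < exp (2 * pi * \<epsilon>)"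
      using that by (auto simp: norm_exp_eq_Re)
    then have "2 * pi * (- \<epsilon>) < 2 * pi * Im (l / (2 * pi * \<i>))" "2 * pi * Im (l / (2 * pi * \<i>)) < 2 * pi * \<epsilon>"
      unfolding eq by auto
    then have "- \<epsilon> < Im (l / (2 * pi * \<i>))" "Im (l / (2 * pi * \<i>)) < \<epsilon>"
      by (simp_all only: mult_less_cancel_left_pos[of "2 * pi"] pi_gt_zero mult_pos_pos zero_less_numeral)
    then show ?thesis by linarith
  qed
  have f_log: "f (exp l) = b (l / (2 * pi * \<i>))" if "exp l \<in> ?A" for l
    unfolding f_def
  proof (rule per_int)
    have "exp (Ln (exp l)) = exp l" by simp
    then show "\<bar>Im (Ln (exp l) / (2 * pi * \<i>))\<bar> < \<epsilon>" using Im_log[of "Ln (exp l)"] that by metis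
    show "e (Ln (exp l) / (2 * pi * \<i>)) = e (l / (2 * pi * \<i>))" unfolding e_log by simp
  qed
  have fe: "f (e z) = b z" if "\<bar>Im z\<bar> < \<epsilon>" for z
  proof -
    have "e z \<in> ?A" using norm_e_bounds[OF that] by simp
    then show ?thesis using f_log[of "2 * pi * \<i> * z"] by (simp add: e_def)
  qed
  have oA: "open ?A" by (intro open_Collect_conj open_Collect_less continuous_intros)
  have f: "f holomorphic_on ?A"
  proof -
    have A0: "q \<noteq> 0" if "q \<in> ?A" for q using that exp_gt_zero[of "- (2 * pi * \<epsilon>)"] by force
    \<comment> \<open>The condition \<open>exp k * a = 1\<close> makes \<open>Ln (a * q) + k\<close>
      a logarithm of \<open>q\<close> with the cut rotated. The choices \<open>a = 1\<close>,
      \<open>k = 0\<close> and \<open>a = - 1\<close>, \<open>k = \<i> * pi\<close> cut along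
      opposite rays, so the two pieces cover the annulus.\<close>
    have piece: "f holomorphic_on ?A \<inter> {q. a * q \<notin> \<real>\<^sub>\<le>\<^sub>0}" if a: "exp k * a = 1" for a k
    proof -
      have exp_log: "exp (Ln (a * q) + k) = q" if "q \<in> ?A" for q
      proof -
        have "a * q \<noteq> 0" using a A0[OF that] by auto
        then have "exp (Ln (a * q) + k) = (exp k * a) * q" by (simp add: exp_add)
        then show ?thesis using a by simp
      qed
      have "(\<lambda>q. b ((Ln (a * q) + k) / (2 * pi * \<i>))) holomorphic_on ?A \<inter> {q. a * q \<notin> \<real>\<^sub>\<le>\<^sub>0}"
      proof (rule holomorphic_on_compose_gen[OF _ b, unfolded o_def])
        show "(\<lambda>q. (Ln (a * q) + k) / (2 * pi * \<i>)) holomorphic_on ?A \<inter> {q. a * q \<notin> \<real>\<^sub>\<le>\<^sub>0}"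
          by (intro holomorphic_intros) auto
        show "(\<lambda>q. (Ln (a * q) + k) / (2 * pi * \<i>)) ` (?A \<inter> {q. a * q \<notin> \<real>\<^sub>\<le>\<^sub>0}) \<subseteq> {z. \<bar>Im z\<bar> < \<epsilon>}"
          using Im_log exp_log by (metis (no_types, lifting) Int_iff image_subsetI mem_Collect_eq)
      qed
      then show ?thesis
      proof (rule holomorphic_transform)
        fix q assume "q \<in> ?A \<inter> {q. a * q \<notin> \<real>\<^sub>\<le>\<^sub>0}"
        then have q: "q \<in> ?A" "q \<noteq> 0" using A0 by auto
        have "exp (Ln (a * q) + k) = q" by (rule exp_log[OF q(1)])
        then show "b ((Ln (a * q) + k) / (2 * pi * \<i>)) = f q" using f_log[of "Ln (a * q) + k"] q by simp
      qed
    qed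
    have op: "open (?A \<inter> {q. a * q \<notin> \<real>\<^sub>\<le>\<^sub>0})" for a
    proof -
      have "open ((\<lambda>q. a * q) -` (- \<real>\<^sub>\<le>\<^sub>0))"
        by (intro open_vimage continuous_intros) (simp add: open_Compl)
      then show ?thesis using oA by (auto simp: vimage_def)
    qed
    have "f holomorphic_on (?A \<inter> {q. 1 * q \<notin> \<real>\<^sub>\<le>\<^sub>0}) \<union> (?A \<inter> {q. (- 1) * q \<notin> \<real>\<^sub>\<le>\<^sub>0})"
      by (intro holomorphic_on_Un op piece[of 0] piece[of "\<i> * pi"]) auto
    moreover have "?A \<subseteq> (?A \<inter> {q. 1 * q \<notin> \<real>\<^sub>\<le>\<^sub>0}) \<union> (?A \<inter> {q. (- 1) * q \<notin> \<real>\<^sub>\<le>\<^sub>0})"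
      using A0 by (auto simp: complex_nonpos_Reals_iff complex_eq_iff)
    ultimately show ?thesis by (rule holomorphic_on_subset)
  qed
  let ?r = "exp (- (2 * pi * \<delta>))"
  let ?R = "exp (2 * pi * \<delta>)"
  obtain f1 f2 C where f1: "f1 holomorphic_on ball 0 ?R" and f2: "f2 holomorphic_on {q. ?r < norm q}"
    and split: "\<And>q. ?r < norm q \<Longrightarrow> norm q < ?R \<Longrightarrow> f q = f1 q + f2 q"
    and C: "\<And>q. ?r < norm q \<Longrightarrow> norm (f2 q) \<le> C / (norm q - ?r)"
    by (rule annulus_splitting[OF f, of ?r ?R]) (use \<delta> in auto)
  have R1: "1 < ?R" using \<delta> by simp
  \<comment> \<open>The difference quotient of \<open>f1\<close> at 0, continued over 0. Its bound
    on the closed unit disc makes \<open>f1 q - f1 0\<close> decay linearly in \<open>q\<close>,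
    hence exponentially in \<open>Im z\<close>.\<close>
  define H where "H q = (if q = 0 then deriv f1 0 else (f1 q - f1 0) / (q - 0))" for q
  have "H holomorphic_on ball 0 ?R" unfolding H_def by (rule pole_lemma[OF f1]) auto
  then have contH: "continuous_on (cball 0 1) H"
    by (intro continuous_on_subset[OF holomorphic_on_imp_continuous_on]) (use R1 in \<open>auto simp del: one_less_exp_iff\<close>)
  obtain M where M: "\<And>q. q \<in> cball 0 1 \<Longrightarrow> norm (H q) \<le> M"
    using compact_imp_bounded[OF compact_continuous_image[OF contH compact_cball]] unfolding bounded_iff by blast
  have M0: "0 \<le> M" using order_trans[OF norm_ge_zero M[of 0]] by simp
  have f1b: "norm (f1 q - f1 0) \<le> M * norm q" if "norm q \<le> 1" for q
  proof -
    have "f1 q - f1 0 = H q * q" by (simp add: H_def)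
    then show ?thesis using M[of q] that by (simp add: norm_mult mult_right_mono)
  qed
  have C0: "0 \<le> C"
  proof -
    have "?r < norm (2 :: complex)" using \<delta> exp_le_one_iff[of "- (2 * pi * \<delta>)"] by (simp del: exp_le_one_iff)
    then have "0 \<le> C / (norm (2::complex) - ?r)" using order_trans[OF norm_ge_zero C[of 2]] by blast
    then show ?thesis using \<open>?r < norm (2::complex)\<close> by (simp add: zero_le_divide_iff)
  qed
  \<comment> \<open>One geometric majorant for both series; the actual rate
    \<open>exp (- (2 * pi))\<close> is weakened to \<open>exp (- 1)\<close>.\<close>
  let ?D = "\<lambda>n. (C + M) * (?R * exp (- 1) ^ n)"
  have D: "summable ?D" "\<And>n. 0 \<le> ?D n"
    using C0 M0 by (auto intro!: summable_mult summable_geometric)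
  let ?S1 = "{z. - \<delta> < Im z}"
  let ?S2 = "{z. Im z < 1 + \<delta>}"
  have o: "open ?S1" "open ?S2" by (intro open_Collect_less continuous_intros)+
  obtain F1 where F1: "F1 holomorphic_on ?S1"
    "\<And>z. z \<in> ?S1 \<Longrightarrow> (\<lambda>n. f1 (e (z + of_nat n * \<i>)) - f1 0) sums F1 z"
  proof (rule holomorphic_series_M_test[OF o(1), of "\<lambda>n z. f1 (e (z + of_nat n * \<i>)) - f1 0"])
    show "(\<lambda>z. f1 (e (z + of_nat n * \<i>)) - f1 0) holomorphic_on ?S1" for n
    proof -
      have "(\<lambda>z. f1 (e (z + of_nat n * \<i>))) holomorphic_on ?S1"
      proof (rule holomorphic_on_compose_gen[OF _ f1, unfolded o_def])
        have "norm (e (z + of_nat n * \<i>)) < ?R" if "- \<delta> < Im z" for z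
        proof -
          have "2 * pi * - (Im z + real n) < 2 * pi * \<delta>"
            by (rule mult_strict_left_mono) (use that in auto)
          moreover have "norm (e (z + of_nat n * \<i>)) = exp (2 * pi * - (Im z + real n))"
            by (simp add: norm_e algebra_simps)
          ultimately show ?thesis by (simp only: exp_less_cancel_iff)
        qed
        then show "(\<lambda>z. e (z + of_nat n * \<i>)) ` ?S1 \<subseteq> ball 0 ?R" by auto
      qed (unfold e_def, intro holomorphic_intros)
      then show ?thesis by (intro holomorphic_intros)
    qed
    show "\<forall>\<^sub>F n in sequentially. \<forall>z\<in>?S1. norm (f1 (e (z + of_nat n * \<i>)) - f1 0) \<le> ?D n"
      using eventually_ge_at_top[of 1]
    proof eventually_elim
      case (elim n)
      show ?case
      proof
        fix z assume "z \<in> ?S1"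
        then have z: "- \<delta> < Im z" by simp
        have "2 * pi * (real n - \<delta>) \<le> 2 * pi * (Im z + real n)"
          by (rule mult_left_mono) (use z in auto)
        then have ne: "norm (e (z + of_nat n * \<i>)) \<le> exp (2 * pi * \<delta> - 2 * pi * real n)"
          by (simp add: norm_e algebra_simps)
        have "2 * pi * \<delta> - 2 * pi * real n \<le> 0" using \<delta> elim by (simp add: algebra_simps)
        then have "norm (e (z + of_nat n * \<i>)) \<le> 1" using ne by (meson exp_le_one_iff order_trans)
        then have "norm (f1 (e (z + of_nat n * \<i>)) - f1 0) \<le> M * exp (2 * pi * \<delta> - 2 * pi * real n)"
          using f1b[of "e (z + of_nat n * \<i>)"] mult_left_mono[OF ne M0] by linarith
        also have "\<dots> \<le> M * exp (2 * pi * \<delta> - real n)"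
        proof -
          have "1 * real n \<le> 2 * pi * real n" using pi_gt3 by (intro mult_right_mono) auto
          then show ?thesis using M0 by (intro mult_left_mono) auto
        qed
        also have "\<dots> = M * (?R * exp (- 1) ^ n)" by (simp add: exp_diff exp_minus exp_of_nat_mult[symmetric] field_simps)
        also have "\<dots> \<le> (C + M) * (?R * exp (- 1) ^ n)" using C0 by (intro mult_right_mono) auto
        finally show "norm (f1 (e (z + of_nat n * \<i>)) - f1 0) \<le> ?D n" .
      qed
    qed
  qed (use D in auto)
  obtain F2 where F2: "F2 holomorphic_on ?S2"
    "\<And>z. z \<in> ?S2 \<Longrightarrow> (\<lambda>n. f2 (e (z - \<i> - of_nat n * \<i>))) sums F2 z"
  proof (rule holomorphic_series_M_test[OF o(2), of "\<lambda>n z. f2 (e (z - \<i> - of_nat n * \<i>))"])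
    have dom: "?r * exp (2 * pi * real n) < norm (e (z - \<i> - of_nat n * \<i>))" if "Im z < 1 + \<delta>" for z n
    proof -
      have "2 * pi * (Im z - 1 - real n) < 2 * pi * (\<delta> - real n)"
        by (rule mult_strict_left_mono) (use that in auto)
      then show ?thesis by (simp add: norm_e exp_add[symmetric] algebra_simps)
    qed
    have dom': "?r < norm (e (z - \<i> - of_nat n * \<i>))" if "Im z < 1 + \<delta>" for z n
    proof -
      have "?r * 1 \<le> ?r * exp (2 * pi * real n)" by (intro mult_left_mono) auto
      from le_less_trans[OF this dom[OF that]] show ?thesis by simp
    qed
    show "(\<lambda>z. f2 (e (z - \<i> - of_nat n * \<i>))) holomorphic_on ?S2" for n
    proof (rule holomorphic_on_compose_gen[OF _ f2, unfolded o_def])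
      show "(\<lambda>z. e (z - \<i> - of_nat n * \<i>)) ` ?S2 \<subseteq> {q. ?r < norm q}" using dom' by auto
    qed (unfold e_def, intro holomorphic_intros)
    show "\<forall>\<^sub>F n in sequentially. \<forall>z\<in>?S2. norm (f2 (e (z - \<i> - of_nat n * \<i>))) \<le> ?D n"
      using eventually_ge_at_top[of 1]
    proof eventually_elim
      case (elim n)
      show ?case
      proof
        fix z assume "z \<in> ?S2"
        then have z: "Im z < 1 + \<delta>" by simp
        \<comment> \<open>The additional 1 pays for the \<open>?r\<close> subtracted in the
          denominator of the bound on \<open>f2\<close>.\<close>
        have "exp (real n) + 1 \<le> exp (2 * pi * real n)"
        proof -
          have "real n + 1 \<le> 2 * pi * real n"
            using pi_gt3 elim mult_right_mono[of 2 "2 * pi" "real n"] by linarith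
          then have "exp (real n + 1) \<le> exp (2 * pi * real n)" by simp
          moreover have "exp (real n) * 2 \<le> exp (real n) * exp 1"
            using exp_ge_add_one_self[of 1] by (intro mult_left_mono) auto
          moreover have "1 \<le> exp (real n)" by simp
          ultimately show ?thesis unfolding exp_add by linarith
        qed
        then have "?r * (exp (real n) + 1) \<le> ?r * exp (2 * pi * real n)" by (intro mult_left_mono) auto
        then have lower: "?r * exp (real n) \<le> norm (e (z - \<i> - of_nat n * \<i>)) - ?r"
          using dom[OF z, of n] by (simp add: algebra_simps)
        have "norm (f2 (e (z - \<i> - of_nat n * \<i>))) \<le> C / (norm (e (z - \<i> - of_nat n * \<i>)) - ?r)"
          by (rule C[OF dom'[OF z]])
        also have "\<dots> \<le> C / (?r * exp (real n))"
          using lower C0 by (intro frac_le) auto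
        also have "\<dots> = C * (?R * exp (- 1) ^ n)"
          by (simp add: exp_minus exp_of_nat_mult[symmetric] field_simps)
        also have "\<dots> \<le> (C + M) * (?R * exp (- 1) ^ n)" using M0 by (intro mult_right_mono) auto
        finally show "norm (f2 (e (z - \<i> - of_nat n * \<i>))) \<le> ?D n" .
      qed
    qed
  qed (use D in auto)
  \<comment> \<open>Defined by the sums themselves rather than by \<open>F1\<close> and
    \<open>F2\<close>, whose values are controlled only on half-planes: period 1 then holds termwise
    at every point.\<close>
  define v where "v z = (\<Sum>n. f2 (e (z - \<i> - of_nat n * \<i>))) - (\<Sum>n. f1 (e (z + of_nat n * \<i>)) - f1 0)" for z
  have v: "v z = F2 z - F1 z" if "z \<in> ?S1 \<inter> ?S2" for z
    using sums_unique[OF F1(2)[of z]] sums_unique[OF F2(2)[of z]] that by (simp add: v_def)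
  show ?thesis
  proof (rule that[of v "f1 0"])
    show "v holomorphic_on {z. - \<delta> < Im z \<and> Im z < 1 + \<delta>}"
    proof (rule holomorphic_transform[of "\<lambda>z. F2 z - F1 z"])
      show "(\<lambda>z. F2 z - F1 z) holomorphic_on {z. - \<delta> < Im z \<and> Im z < 1 + \<delta>}"
        by (intro holomorphic_intros holomorphic_on_subset[OF F1(1)] holomorphic_on_subset[OF F2(1)]) auto
    qed (use v in auto)
    show "v (z + 1) = v z" for z
    proof -
      have "e (z + 1 + w) = e (z + w)" for w using e1[of "z + w"] by (simp add: add_ac)
      from this[of "- \<i> - of_nat n * \<i>" for n] this[of "of_nat n * \<i>" for n]
      show ?thesis by (simp add: v_def algebra_simps)
    qed
    show "v (z + \<i>) - v z = b z - f1 0" if z: "\<bar>Im z\<bar> < \<delta>" for z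
    proof -
      have zz: "- \<delta> < Im z" "Im z < \<delta>" using z by linarith+
      have "(\<lambda>n. f1 (e (z + \<i> + of_nat n * \<i>)) - f1 0) sums F1 (z + \<i>)" by (rule F1(2)) (use zz in auto)
      then have "(\<lambda>n. f1 (e (z + of_nat (Suc n) * \<i>)) - f1 0) sums F1 (z + \<i>)" by (simp add: algebra_simps)
      then have "(\<lambda>n. f1 (e (z + of_nat n * \<i>)) - f1 0) sums (F1 (z + \<i>) + (f1 (e z) - f1 0))"
        by (subst (asm) sums_Suc_iff) simp
      then have 1: "F1 z = F1 (z + \<i>) + (f1 (e z) - f1 0)"
        using F1(2)[of z] zz by (auto dest: sums_unique2)
      have "(\<lambda>n. f2 (e (z - \<i> - of_nat n * \<i>))) sums F2 z" by (rule F2(2)) (use zz \<delta> in auto)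
      then have "(\<lambda>n. f2 (e (z + \<i> - \<i> - of_nat (Suc n) * \<i>))) sums F2 z" by (simp add: algebra_simps)
      then have "(\<lambda>n. f2 (e (z + \<i> - \<i> - of_nat n * \<i>))) sums (F2 z + f2 (e z))"
        by (subst (asm) sums_Suc_iff) simp
      then have 2: "F2 (z + \<i>) = F2 z + f2 (e z)"
        using F2(2)[of "z + \<i>"] zz by (auto dest: sums_unique2)
      have "v (z + \<i>) = F2 (z + \<i>) - F1 (z + \<i>)" "v z = F2 z - F1 z" by (rule v; use zz \<delta> in auto)+
      moreover have "b z = f1 (e z) + f2 (e z)"
        using fe[of z] split[of "e z"] norm_e_bounds[OF z] z \<delta> by simp
      ultimately show ?thesis using 1 2 by simp
    qed
  qed
qed

section \<open>Extending functions from a fundamental strip\<close>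

definition quasiperiodic_extension ::
    "(complex \<Rightarrow> real) \<Rightarrow> complex \<Rightarrow> complex \<Rightarrow> (complex \<Rightarrow> complex) \<Rightarrow> complex \<Rightarrow> complex" where
  "quasiperiodic_extension p \<tau> c F z = F (z - of_int \<lfloor>p z\<rfloor> * \<tau>) + of_int \<lfloor>p z\<rfloor> * c"

text \<open>Covers both period directions: \<open>p = Re\<close> with \<open>\<tau> = 1\<close>, and
  \<open>p = Im\<close> with \<open>\<tau> = \<i>\<close>. The floor of \<open>p\<close> selects the
  translate of the fundamental strip that contains a point.\<close>

locale translation =
  fixes p :: "complex \<Rightarrow> real" and \<tau> :: complex
  assumes continuous_p: "continuous_on UNIV p"
    and p_shift: "p (z + of_int n * \<tau>) = p z + of_int n"
begin

lemma p_shift_diff: "p (z - of_int n * \<tau>) = p z - of_int n"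
  using p_shift[of z "- n"] by simp

lemma p_shift_1: "p (z + \<tau>) = p z + 1"
  using p_shift[of z 1] by simp

text \<open>The set is arbitrary on purpose: applied to a level set of a function, it turns
  invariance of a value under one period into invariance under all integer multiples.\<close>

lemma invariant_shift:
  assumes "\<And>z. z + \<tau> \<in> D \<longleftrightarrow> z \<in> D"
  shows "z + of_int n * \<tau> \<in> D \<longleftrightarrow> z \<in> D"
proof -
  have *: "z + of_nat n * \<tau> \<in> D \<longleftrightarrow> z \<in> D" for z n
    using assms[of "z + of_nat k * \<tau>" for k] by (induction n) (auto simp: algebra_simps)
  show ?thesis
  proof (cases "0 \<le> n")
    case True
    then show ?thesis using *[of z "nat n"] by simp
  next
    case False
    then show ?thesis using *[of "z + of_int n * \<tau>" "nat (- n)"] by simp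
  qed
qed

lemma quasiperiodic_extension_shift:
  "quasiperiodic_extension p \<tau> c F (z + \<tau>) = quasiperiodic_extension p \<tau> c F z + c"
  unfolding quasiperiodic_extension_def p_shift_1 by (simp add: algebra_simps)

text \<open>The formula for the extension changes where \<open>p\<close> passes an integer. The
  functional equation on the overlap \<open>\<bar>p z\<bar> < \<epsilon>\<close> says that
  neighbouring formulas agree there, so around each point a single translate of \<open>F\<close>
  describes the extension.\<close>

lemma quasiperiodic_extension_holomorphic:
  assumes D: "open D" "\<And>z. z + \<tau> \<in> D \<longleftrightarrow> z \<in> D" and \<epsilon>: "0 < \<epsilon>" "\<epsilon> < 1"
    and F: "F holomorphic_on D \<inter> {z. - \<epsilon> < p z \<and> p z < 1 + \<epsilon>}"
    and shift: "\<And>z. z \<in> D \<Longrightarrow> \<bar>p z\<bar> < \<epsilon> \<Longrightarrow> F (z + \<tau>) = F z + c"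
  shows "quasiperiodic_extension p \<tau> c F holomorphic_on D"
    and "\<And>z. z \<in> D \<Longrightarrow> - \<epsilon> < p z \<Longrightarrow> p z < 1 + \<epsilon> \<Longrightarrow> quasiperiodic_extension p \<tau> c F z = F z"
proof -
  let ?G = "quasiperiodic_extension p \<tau> c F"
  have G: "?G z = F (z - of_int n * \<tau>) + of_int n * c"
    if z: "z \<in> D" "- \<epsilon> < p z - of_int n" "p z - of_int n < 1 + \<epsilon>" for z n
  proof -
    have D': "z - of_int m * \<tau> \<in> D" for m using invariant_shift[OF D(2), of z "- m"] z by simp
    \<comment> \<open>As \<open>\<epsilon> < 1\<close>, the enlarged strip with number
      \<open>n\<close> reaches only into its two neighbours.\<close>
    consider "\<lfloor>p z\<rfloor> = n" | "\<lfloor>p z\<rfloor> = n - 1" | "\<lfloor>p z\<rfloor> = n + 1" using z(2,3) \<epsilon> by linarith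
    then show ?thesis
    proof cases
      case 2
      have "p z < of_int n" using 2 by linarith
      then have "F (z - of_int n * \<tau> + \<tau>) = F (z - of_int n * \<tau>) + c"
        using z(2) \<epsilon> by (intro shift D') (auto simp: p_shift_diff)
      then show ?thesis by (simp add: quasiperiodic_extension_def 2 algebra_simps)
    next
      case 3
      have "of_int n + 1 \<le> p z" using 3 by linarith
      then have "F (z - of_int (n + 1) * \<tau> + \<tau>) = F (z - of_int (n + 1) * \<tau>) + c"
        using z(3) \<epsilon> by (intro shift D', unfold p_shift_diff) auto
      then show ?thesis by (simp add: quasiperiodic_extension_def 3 algebra_simps)
    qed (simp add: quasiperiodic_extension_def)
  qed
  show "z \<in> D \<Longrightarrow> - \<epsilon> < p z \<Longrightarrow> p z < 1 + \<epsilon> \<Longrightarrow> ?G z = F z" for z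
    using G[of z 0] by simp
  have "?G field_differentiable at z" if z: "z \<in> D" for z
  proof -
    let ?n = "\<lfloor>p z\<rfloor>"
    let ?U = "D \<inter> {w. - \<epsilon> < p w - of_int ?n \<and> p w - of_int ?n < 1 + \<epsilon>}"
    have U: "open ?U" by (intro open_Int D open_Collect_conj open_Collect_less continuous_intros continuous_p)
    have "(\<lambda>w. F (w - of_int ?n * \<tau>)) holomorphic_on ?U"
      by (rule holomorphic_on_compose_gen[OF _ F, unfolded o_def])
         (use invariant_shift[OF D(2), of _ "- ?n"] in \<open>auto intro!: holomorphic_intros simp: p_shift_diff\<close>)
    then have "(\<lambda>w. F (w - of_int ?n * \<tau>) + of_int ?n * c) holomorphic_on ?U" by (intro holomorphic_intros)
    then have "?G holomorphic_on ?U" by (rule holomorphic_transform) (use G in auto)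
    moreover have "- \<epsilon> < p z - of_int ?n" "p z - of_int ?n < 1 + \<epsilon>" using \<epsilon> by linarith+
    then have "z \<in> ?U" using z by blast
    ultimately show ?thesis using U holomorphic_on_imp_differentiable_at by blast
  qed
  then show "?G holomorphic_on D"
    by (auto simp: holomorphic_on_def intro: field_differentiable_at_within)
qed

end

section \<open>The additive Cousin problem in the plane\<close>

text \<open>A Cech 1-cocycle of holomorphic functions on an open cover of the plane. For the torus,
  the indices are its points and \<open>N x\<close> is the full preimage of a neighbourhood of
  \<open>x\<close>.\<close>

locale cousin_problem =
  fixes J :: "'a set" and N :: "'a \<Rightarrow> complex set" and g :: "'a \<Rightarrow> 'a \<Rightarrow> complex \<Rightarrow> complex"
  assumes open_N: "x \<in> J \<Longrightarrow> open (N x)"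
    and cover: "\<exists>x\<in>J. z \<in> N x"
    and holomorphic_g: "x \<in> J \<Longrightarrow> y \<in> J \<Longrightarrow> g x y holomorphic_on N x \<inter> N y"
    and cocycle: "x \<in> J \<Longrightarrow> y \<in> J \<Longrightarrow> u \<in> J \<Longrightarrow> z \<in> N x \<Longrightarrow> z \<in> N y \<Longrightarrow> z \<in> N u \<Longrightarrow>
      g x u z = g x y z + g y u z"
begin

definition splits :: "complex set \<Rightarrow> ('a \<Rightarrow> complex \<Rightarrow> complex) \<Rightarrow> bool" where
  "splits W h \<longleftrightarrow> open W \<and> (\<forall>x\<in>J. h x holomorphic_on N x \<inter> W) \<and>
     (\<forall>x\<in>J. \<forall>y\<in>J. \<forall>z\<in>N x \<inter> N y \<inter> W. g x y z = h y z - h x z)"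

text \<open>The sheaf property. It produces index-free functions from local solutions: the
  difference of two splittings, or the failure of a splitting to be periodic.\<close>

lemma holomorphic_glue:
  assumes W: "open W" and F: "\<And>x. x \<in> J \<Longrightarrow> F x holomorphic_on N x \<inter> W"
    and eq: "\<And>x y z. x \<in> J \<Longrightarrow> y \<in> J \<Longrightarrow> z \<in> N x \<Longrightarrow> z \<in> N y \<Longrightarrow> z \<in> W \<Longrightarrow> F x z = F y z"
  obtains f where "f holomorphic_on W" "\<And>x z. x \<in> J \<Longrightarrow> z \<in> N x \<Longrightarrow> z \<in> W \<Longrightarrow> f z = F x z"
proof -
  define f where "f z = F (SOME x. x \<in> J \<and> z \<in> N x) z" for z
  have f: "f z = F x z" if "x \<in> J" "z \<in> N x" "z \<in> W" for x z
    unfolding f_def using someI[of "\<lambda>x. x \<in> J \<and> z \<in> N x" x] that eq by blast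
  have "f field_differentiable at z" if z: "z \<in> W" for z
  proof -
    obtain x where x: "x \<in> J" "z \<in> N x" using cover by blast
    have o: "open (N x \<inter> W)" using x W open_N by blast
    have "f holomorphic_on N x \<inter> W"
      by (rule holomorphic_transform[OF F[OF x(1)]]) (use f x in auto)
    then show ?thesis using o x z by (auto intro: holomorphic_on_imp_differentiable_at)
  qed
  then have "f holomorphic_on W"
    by (simp add: field_differentiable_at_within holomorphic_on_def)
  then show ?thesis using that f by blast
qed

text \<open>A Mayer-Vietoris argument: two splittings differ on \<open>W1 \<inter> W2\<close> by one
  function \<open>f\<close>, and \<open>f = g1 + g2\<close> allows the corrected splittings
  \<open>h1 - g1\<close> and \<open>h2 + g2\<close> to agree. Cutting down to \<open>V1\<close> and
  \<open>V2\<close> is the price for splitting \<open>f\<close> only near the junction.\<close>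

lemma splits_Un:
  assumes s1: "splits W1 h1" and s2: "splits W2 h2"
    and V: "open V1" "open V2" "V1 \<inter> V2 \<subseteq> W1 \<inter> W2"
    and add: "\<And>f. f holomorphic_on W1 \<inter> W2 \<Longrightarrow> \<exists>g1 g2. g1 holomorphic_on V1 \<and> g2 holomorphic_on V2 \<and>
       (\<forall>z\<in>V1 \<inter> V2. f z = g1 z + g2 z)"
  shows "\<exists>h. splits ((W1 \<inter> V1) \<union> (W2 \<inter> V2)) h"
proof -
  have W: "open W1" "open W2" using s1 s2 by (auto simp: splits_def)
  have hol: "h1 x holomorphic_on N x \<inter> W1" "h2 x holomorphic_on N x \<inter> W2" if "x \<in> J" for x
    using s1 s2 that by (auto simp: splits_def)
  obtain f where f: "f holomorphic_on W1 \<inter> W2"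
    "\<And>x z. x \<in> J \<Longrightarrow> z \<in> N x \<Longrightarrow> z \<in> W1 \<inter> W2 \<Longrightarrow> f z = h1 x z - h2 x z"
  proof (rule holomorphic_glue[of "W1 \<inter> W2" "\<lambda>x z. h1 x z - h2 x z"])
    show "(\<lambda>z. h1 x z - h2 x z) holomorphic_on N x \<inter> (W1 \<inter> W2)" if "x \<in> J" for x
      using hol[OF that] by (intro holomorphic_intros) (auto elim: holomorphic_on_subset)
    show "h1 x z - h2 x z = h1 y z - h2 y z"
      if "x \<in> J" "y \<in> J" "z \<in> N x" "z \<in> N y" "z \<in> W1 \<inter> W2" for x y z
    proof -
      have "g x y z = h1 y z - h1 x z" "g x y z = h2 y z - h2 x z"
        using s1 s2 that unfolding splits_def by blast+
      then show ?thesis by (simp add: algebra_simps)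
    qed
  qed (use W in auto)
  obtain g1 g2 where g: "g1 holomorphic_on V1" "g2 holomorphic_on V2"
    "\<And>z. z \<in> V1 \<inter> V2 \<Longrightarrow> f z = g1 z + g2 z" using add[OF f(1)] by blast
  define h where "h x z = (if z \<in> N x \<inter> (W1 \<inter> V1) then h1 x z - g1 z else h2 x z + g2 z)" for x z
  have agree: "h1 x z - g1 z = h2 x z + g2 z" if "x \<in> J" "z \<in> N x" "z \<in> V1" "z \<in> V2" for x z
  proof -
    have z: "z \<in> W1 \<inter> W2" using that V(3) by blast
    have "h1 x z - h2 x z = g1 z + g2 z" using f(2)[OF that(1,2) z] g(3)[of z] that by simp
    then show ?thesis by (simp add: algebra_simps)
  qed
  have "h x holomorphic_on N x \<inter> ((W1 \<inter> V1) \<union> (W2 \<inter> V2))" if x: "x \<in> J" for x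
    unfolding h_def Int_Un_distrib
  proof (rule holomorphic_on_If_Un)
    show "(\<lambda>z. h1 x z - g1 z) holomorphic_on N x \<inter> (W1 \<inter> V1)"
      using hol(1)[OF x] g(1) by (intro holomorphic_intros) (auto elim: holomorphic_on_subset)
    show "(\<lambda>z. h2 x z + g2 z) holomorphic_on N x \<inter> (W2 \<inter> V2)"
      using hol(2)[OF x] g(2) by (intro holomorphic_intros) (auto elim: holomorphic_on_subset)
  qed (use x open_N W V agree in \<open>auto\<close>)
  moreover have "g x y z = h y z - h x z"
    if "x \<in> J" "y \<in> J" "z \<in> N x" "z \<in> N y" "z \<in> (W1 \<inter> V1) \<union> (W2 \<inter> V2)" for x y z
    using s1 s2 that by (auto simp: splits_def h_def)
  ultimately show ?thesis using W V unfolding splits_def by (intro exI[of _ h]) auto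
qed

text \<open>By the cocycle identity, the row of the cocycle at a fixed index is already a splitting
  over that member of the cover.\<close>

lemma splits_local:
  assumes "x \<in> J"
  shows "splits (N x) (g x)"
proof -
  have "g y u z = g x u z - g x y z" if "y \<in> J" "u \<in> J" "z \<in> N y \<inter> N u \<inter> N x" for y u z
    using cocycle[of x y u z] assms that by simp
  moreover have "g x y holomorphic_on N y \<inter> N x" if "y \<in> J" for y
    using holomorphic_g[OF assms that] by (simp add: Int_commute)
  ultimately show ?thesis using open_N[OF assms] unfolding splits_def by blast
qed

text \<open>Bisection on the height: short segments lie in one member of the cover, and two adjacent
  segments are joined by splitting along a small square around the common end point. The open set
  \<open>W\<close> supplies the width that the segment lacks.\<close>

lemma splits_vertical_segment:
  assumes "c \<le> d"
  shows "\<exists>W h. splits W h \<and> cbox (Complex r c) (Complex r d) \<subseteq> W"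
proof -
  define P where "P c d \<longleftrightarrow> (\<exists>W h. splits W h \<and> cbox (Complex r c) (Complex r d) \<subseteq> W)" for c d
  have trans: "P c e" if trans: "P c d" "P d e" "c \<le> d" "d \<le> e" for c d e
  proof -
    obtain W1 h1 W2 h2 where s: "splits W1 h1" "splits W2 h2"
      and sub: "cbox (Complex r c) (Complex r d) \<subseteq> W1" "cbox (Complex r d) (Complex r e) \<subseteq> W2"
      using trans unfolding P_def by blast
    have o: "open (W1 \<inter> W2)" using s by (auto simp: splits_def)
    have "cbox (Complex r d) (Complex r d) \<subseteq> W1 \<inter> W2"
      using sub trans by (auto simp: in_cbox_complex_iff subset_iff)
    then obtain \<epsilon> where \<epsilon>: "0 < \<epsilon>"
      "cbox (Complex (r - \<epsilon>) (d - \<epsilon>)) (Complex (r + \<epsilon>) (d + \<epsilon>)) \<subseteq> W1 \<inter> W2"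
      using cbox_enlarge[OF o, of r d r d] by auto
    \<comment> \<open>Each half-strip is unbounded on its own side of the junction, so intersecting
      with it removes nothing of the segment already treated.\<close>
    let ?V1 = "{z. Im z < d + \<epsilon> \<and> r - \<epsilon> < Re z \<and> Re z < r + \<epsilon>}"
    let ?V2 = "{z. d - \<epsilon> < Im z \<and> r - \<epsilon> < Re z \<and> Re z < r + \<epsilon>}"
    have "\<exists>h. splits ((W1 \<inter> ?V1) \<union> (W2 \<inter> ?V2)) h"
    proof (rule splits_Un[OF s])
      show "open ?V1" "open ?V2"
        by (intro open_Collect_conj open_Collect_less continuous_intros)+
      show "?V1 \<inter> ?V2 \<subseteq> W1 \<inter> W2" using \<epsilon>(2) by (auto simp: in_cbox_complex_iff subset_iff)
      fix f assume f: "f holomorphic_on W1 \<inter> W2"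
      show "\<exists>g1 g2. g1 holomorphic_on ?V1 \<and> g2 holomorphic_on ?V2 \<and> (\<forall>z\<in>?V1 \<inter> ?V2. f z = g1 z + g2 z)"
      proof (rule rectangle_splitting_vertical[OF f \<epsilon>(2)])
        fix g1 g2
        assume g: "g1 holomorphic_on ?V1" "g2 holomorphic_on ?V2"
          "\<And>z. z \<in> box (Complex (r - \<epsilon>) (d - \<epsilon>)) (Complex (r + \<epsilon>) (d + \<epsilon>)) \<Longrightarrow> f z = g1 z + g2 z"
        have "f z = g1 z + g2 z" if "z \<in> ?V1 \<inter> ?V2" for z
          using that by (intro g(3)) (auto simp: in_box_complex_iff)
        then show ?thesis using g(1,2) by blast
      qed (use \<epsilon>(1) in auto)
    qed
    moreover have "cbox (Complex r c) (Complex r e) \<subseteq> (W1 \<inter> ?V1) \<union> (W2 \<inter> ?V2)"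
    proof
      fix z assume "z \<in> cbox (Complex r c) (Complex r e)"
      then show "z \<in> (W1 \<inter> ?V1) \<union> (W2 \<inter> ?V2)"
        using sub \<epsilon>(1) by (cases "Im z \<le> d") (auto simp: in_cbox_complex_iff subset_iff)
    qed
    ultimately show ?thesis unfolding P_def by blast
  qed
  have nearby: "\<exists>e>0. \<forall>a b. a \<le> y \<and> y \<le> b \<and> b - a < e \<longrightarrow> P a b" for y
  proof -
    obtain x where x: "x \<in> J" "Complex r y \<in> N x" using cover by blast
    then obtain e where e: "0 < e" "ball (Complex r y) e \<subseteq> N x" using open_N open_contains_ball by blast
    have "cbox (Complex r a) (Complex r b) \<subseteq> N x" if "a \<le> y" "y \<le> b" "b - a < e" for a b
    proof
      fix z assume z: "z \<in> cbox (Complex r a) (Complex r b)"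
      have "norm (Complex r y - z) \<le> \<bar>Re (Complex r y - z)\<bar> + \<bar>Im (Complex r y - z)\<bar>" by (rule cmod_le)
      also have "\<dots> < e" using z that by (auto simp: in_cbox_complex_iff)
      finally show "z \<in> N x" using e by (auto simp: dist_norm)
    qed
    then have "\<exists>W h. splits W h \<and> cbox (Complex r a) (Complex r b) \<subseteq> W"
      if "a \<le> y" "y \<le> b" "b - a < e" for a b
      using splits_local[OF x(1)] that by (intro exI[of _ "N x"] exI[of _ "g x"] conjI)
    then show ?thesis using e(1) unfolding P_def by blast
  qed
  have "P c d" by (rule Bolzano[of c d P, OF assms trans nearby])
  then show ?thesis unfolding P_def .
qed

text \<open>The same bisection on the width, with neighbourhoods of vertical segments as the small
  pieces and a thin rectangle around a vertical segment as the junction.\<close>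

lemma splits_rectangle:
  assumes "a \<le> b" "c \<le> d"
  shows "\<exists>W h. splits W h \<and> cbox (Complex a c) (Complex b d) \<subseteq> W"
proof -
  define P where "P a b \<longleftrightarrow> (\<exists>W h. splits W h \<and> cbox (Complex a c) (Complex b d) \<subseteq> W)" for a b
  have trans: "P a e" if trans: "P a b" "P b e" "a \<le> b" "b \<le> e" for a b e
  proof -
    obtain W1 h1 W2 h2 where s: "splits W1 h1" "splits W2 h2"
      and sub: "cbox (Complex a c) (Complex b d) \<subseteq> W1" "cbox (Complex b c) (Complex e d) \<subseteq> W2"
      using trans unfolding P_def by blast
    have o: "open (W1 \<inter> W2)" using s by (auto simp: splits_def)
    have "cbox (Complex b c) (Complex b d) \<subseteq> W1 \<inter> W2"
      using sub trans by (auto simp: in_cbox_complex_iff subset_iff)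
    then obtain \<epsilon> where \<epsilon>: "0 < \<epsilon>"
      "cbox (Complex (b - \<epsilon>) (c - \<epsilon>)) (Complex (b + \<epsilon>) (d + \<epsilon>)) \<subseteq> W1 \<inter> W2"
      using cbox_enlarge[OF o, of b c b d] assms by auto
    let ?V1 = "{z. Re z < b + \<epsilon> \<and> c - \<epsilon> < Im z \<and> Im z < d + \<epsilon>}"
    let ?V2 = "{z. b - \<epsilon> < Re z \<and> c - \<epsilon> < Im z \<and> Im z < d + \<epsilon>}"
    have "\<exists>h. splits ((W1 \<inter> ?V1) \<union> (W2 \<inter> ?V2)) h"
    proof (rule splits_Un[OF s])
      show "open ?V1" "open ?V2"
        by (intro open_Collect_conj open_Collect_less continuous_intros)+
      show "?V1 \<inter> ?V2 \<subseteq> W1 \<inter> W2" using \<epsilon>(2) by (auto simp: in_cbox_complex_iff subset_iff)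
      fix f assume f: "f holomorphic_on W1 \<inter> W2"
      show "\<exists>g1 g2. g1 holomorphic_on ?V1 \<and> g2 holomorphic_on ?V2 \<and> (\<forall>z\<in>?V1 \<inter> ?V2. f z = g1 z + g2 z)"
      proof (rule rectangle_splitting[OF f \<epsilon>(2)])
        fix g1 g2
        assume g: "g1 holomorphic_on ?V1" "g2 holomorphic_on ?V2"
          "\<And>z. z \<in> box (Complex (b - \<epsilon>) (c - \<epsilon>)) (Complex (b + \<epsilon>) (d + \<epsilon>)) \<Longrightarrow> f z = g1 z + g2 z"
        have "f z = g1 z + g2 z" if "z \<in> ?V1 \<inter> ?V2" for z
          using that by (intro g(3)) (auto simp: in_box_complex_iff)
        then show ?thesis using g(1,2) by blast
      qed (use \<epsilon>(1) assms(2) in auto)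
    qed
    moreover have "cbox (Complex a c) (Complex e d) \<subseteq> (W1 \<inter> ?V1) \<union> (W2 \<inter> ?V2)"
    proof
      fix z assume "z \<in> cbox (Complex a c) (Complex e d)"
      then show "z \<in> (W1 \<inter> ?V1) \<union> (W2 \<inter> ?V2)"
        using sub \<epsilon>(1) by (cases "Re z \<le> b") (auto simp: in_cbox_complex_iff subset_iff)
    qed
    ultimately show ?thesis unfolding P_def by blast
  qed
  have nearby: "\<exists>e>0. \<forall>a b. a \<le> r \<and> r \<le> b \<and> b - a < e \<longrightarrow> P a b" for r
  proof -
    obtain W h where W: "splits W h" "cbox (Complex r c) (Complex r d) \<subseteq> W"
      using splits_vertical_segment[OF assms(2)] by blast
    then obtain \<epsilon> where \<epsilon>: "0 < \<epsilon>" "cbox (Complex (r - \<epsilon>) (c - \<epsilon>)) (Complex (r + \<epsilon>) (d + \<epsilon>)) \<subseteq> W"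
      using cbox_enlarge[of W r c r d] assms by (auto simp: splits_def)
    have "cbox (Complex a c) (Complex b d) \<subseteq> W" if "a \<le> r" "r \<le> b" "b - a < \<epsilon>" for a b
      using \<epsilon> that by (auto simp: in_cbox_complex_iff subset_iff)
    then have "\<exists>W h. splits W h \<and> cbox (Complex a c) (Complex b d) \<subseteq> W"
      if "a \<le> r" "r \<le> b" "b - a < \<epsilon>" for a b
      using W(1) that by (intro exI[of _ W] exI[of _ h] conjI)
    then show ?thesis using \<epsilon>(1) unfolding P_def by blast
  qed
  have "P a b" by (rule Bolzano[of a b P, OF assms(1) trans nearby])
  then show ?thesis unfolding P_def .
qed

end

section \<open>Cousin data with periods 1 and \<i>\<close>

locale periodic_cousin_problem = cousin_problem +
  assumes N_1: "x \<in> J \<Longrightarrow> z + 1 \<in> N x \<longleftrightarrow> z \<in> N x"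
    and N_i: "x \<in> J \<Longrightarrow> z + \<i> \<in> N x \<longleftrightarrow> z \<in> N x"
    and g_1: "x \<in> J \<Longrightarrow> y \<in> J \<Longrightarrow> z \<in> N x \<Longrightarrow> z \<in> N y \<Longrightarrow> g x y (z + 1) = g x y z"
    and g_i: "x \<in> J \<Longrightarrow> y \<in> J \<Longrightarrow> z \<in> N x \<Longrightarrow> z \<in> N y \<Longrightarrow> g x y (z + \<i>) = g x y z"
begin

interpretation Re: translation Re 1
  by unfold_locales (auto intro!: continuous_intros)

interpretation Im: translation Im \<i>
  by unfold_locales (auto intro!: continuous_intros)

lemma N_1_int: "x \<in> J \<Longrightarrow> z - of_int n \<in> N x \<longleftrightarrow> z \<in> N x"
  using Re.invariant_shift[of "N x" z "- n"] N_1 by simp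

lemma N_i_int: "x \<in> J \<Longrightarrow> z - of_int n * \<i> \<in> N x \<longleftrightarrow> z \<in> N x"
  using Im.invariant_shift[of "N x" z "- n"] N_i by simp

lemma g_1_int:
  assumes "x \<in> J" "y \<in> J" "z \<in> N x" "z \<in> N y"
  shows "g x y (z - of_int n) = g x y z"
proof -
  let ?D = "{w \<in> N x \<inter> N y. g x y w = g x y z}"
  have "w + 1 \<in> ?D \<longleftrightarrow> w \<in> ?D" for w
    using N_1[OF assms(1), of w] N_1[OF assms(2), of w] g_1[OF assms(1,2), of w] by auto
  from Re.invariant_shift[OF this, of z "- n"] show ?thesis using assms by auto
qed

lemma g_i_int:
  assumes "x \<in> J" "y \<in> J" "z \<in> N x" "z \<in> N y"
  shows "g x y (z - of_int n * \<i>) = g x y z"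
proof -
  let ?D = "{w \<in> N x \<inter> N y. g x y w = g x y z}"
  have "w + \<i> \<in> ?D \<longleftrightarrow> w \<in> ?D" for w
    using N_i[OF assms(1), of w] N_i[OF assms(2), of w] g_i[OF assms(1,2), of w] by auto
  from Im.invariant_shift[OF this, of z "- n"] show ?thesis using assms by auto
qed

text \<open>The defect \<open>h x (z + 1) - h x z\<close> of a splitting near the closed unit square
  is independent of \<open>x\<close>, because the cocycle is periodic. Subtracting a solution
  \<open>u\<close> of the difference equation with this right-hand side makes the splitting continue
  periodically along the strip.\<close>

lemma splits_horizontal_strip:
  obtains \<epsilon> h where "0 < \<epsilon>" "\<epsilon> < 1" "splits {z. - \<epsilon> < Im z \<and> Im z < 1 + \<epsilon>} h"
    "\<And>x z. h x (z + 1) = h x z"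
proof -
  obtain W h where W: "splits W h" "cbox (Complex 0 0) (Complex 1 1) \<subseteq> W"
    using splits_rectangle[of 0 1 0 1] by auto
  have oW: "open W" using W(1) by (simp add: splits_def)
  obtain \<epsilon>0 where \<epsilon>0: "0 < \<epsilon>0" "cbox (Complex (0 - \<epsilon>0) (0 - \<epsilon>0)) (Complex (1 + \<epsilon>0) (1 + \<epsilon>0)) \<subseteq> W"
    using cbox_enlarge[OF oW W(2)] by auto
  \<comment> \<open>The cap 1/3 ensures \<open>\<epsilon> < 1/2\<close>, as the horizontal
    difference equation demands.\<close>
  define \<epsilon> where "\<epsilon> = min \<epsilon>0 (1/3)"
  have \<epsilon>: "0 < \<epsilon>" "\<epsilon> < 1/2" using \<epsilon>0 by (auto simp: \<epsilon>_def)
  have sub: "z \<in> W" if "- \<epsilon> \<le> Re z" "Re z \<le> 1 + \<epsilon>" "- \<epsilon> \<le> Im z" "Im z \<le> 1 + \<epsilon>" for z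
  proof -
    have "\<epsilon> \<le> \<epsilon>0" by (simp add: \<epsilon>_def)
    then show ?thesis using \<epsilon>0(2) that by (force simp: in_cbox_complex_iff subset_iff)
  qed
  have h: "h x holomorphic_on N x \<inter> W" if "x \<in> J" for x using W(1) that by (simp add: splits_def)
  have hg: "g x y z = h y z - h x z" if "x \<in> J" "y \<in> J" "z \<in> N x" "z \<in> N y" "z \<in> W" for x y z
    using W(1) that by (simp add: splits_def)
  let ?W = "{z. z \<in> W \<and> z + 1 \<in> W}"
  have o: "open ?W"
  proof -
    have "open ((\<lambda>z. z + 1) -` W)" by (intro open_vimage oW continuous_intros)
    then show ?thesis using oW by (auto simp: vimage_def intro: open_Collect_conj)
  qed
  obtain a where a: "a holomorphic_on ?W"
    "\<And>x z. x \<in> J \<Longrightarrow> z \<in> N x \<Longrightarrow> z \<in> ?W \<Longrightarrow> a z = h x (z + 1) - h x z"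
  proof (rule holomorphic_glue[of ?W "\<lambda>x z. h x (z + 1) - h x z"])
    show "(\<lambda>z. h x (z + 1) - h x z) holomorphic_on N x \<inter> ?W" if x: "x \<in> J" for x
    proof (intro holomorphic_on_diff)
      show "(\<lambda>z. h x (z + 1)) holomorphic_on N x \<inter> ?W"
        by (rule holomorphic_on_compose_gen[OF _ h[OF x], unfolded o_def])
           (use N_1[OF x] in \<open>auto intro!: holomorphic_intros\<close>)
      show "h x holomorphic_on N x \<inter> ?W" using h[OF x] by (rule holomorphic_on_subset) auto
    qed
    show "h x (z + 1) - h x z = h y (z + 1) - h y z"
      if "x \<in> J" "y \<in> J" "z \<in> N x" "z \<in> N y" "z \<in> ?W" for x y z
    proof -
      have "h y (z + 1) - h x (z + 1) = h y z - h x z"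
        using hg[of x y z] hg[of x y "z + 1"] g_1[of x y z] N_1[of x z] N_1[of y z] that by simp
      then show ?thesis by (simp add: algebra_simps)
    qed
  qed (use o that in blast)+
  have "cbox (Complex (- \<epsilon>) (- \<epsilon>)) (Complex \<epsilon> (1 + \<epsilon>)) \<subseteq> ?W"
    using \<epsilon> by (auto simp: in_cbox_complex_iff intro!: sub)
  then obtain u where u: "u holomorphic_on {z. - \<epsilon> < Re z \<and> Re z < 1 + \<epsilon> \<and> - \<epsilon> < Im z \<and> Im z < 1 + \<epsilon>}"
    "\<And>z. z \<in> box (Complex (- \<epsilon>) (- \<epsilon>)) (Complex \<epsilon> (1 + \<epsilon>)) \<Longrightarrow> u (z + 1) - u z = a z"
    by (rule horizontal_difference_equation[OF a(1)]) (use \<epsilon> in auto)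
  define H where "H x = quasiperiodic_extension Re 1 0 (\<lambda>z. h x z - u z)" for x
  have per: "H x (z + 1) = H x z" for x z unfolding H_def Re.quasiperiodic_extension_shift by simp
  let ?T = "{z. - \<epsilon> < Im z \<and> Im z < 1 + \<epsilon>}"
  have oT: "open ?T" by (intro open_Collect_conj open_Collect_less continuous_intros)
  have "H x holomorphic_on N x \<inter> ?T" if x: "x \<in> J" for x
    unfolding H_def
  proof (rule Re.quasiperiodic_extension_holomorphic(1))
    show "open (N x \<inter> ?T)" using open_N[OF x] oT by auto
    show "z + 1 \<in> N x \<inter> ?T \<longleftrightarrow> z \<in> N x \<inter> ?T" for z using N_1[OF x] by auto
    show "(\<lambda>z. h x z - u z) holomorphic_on N x \<inter> ?T \<inter> {z. - \<epsilon> < Re z \<and> Re z < 1 + \<epsilon>}"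
      by (intro holomorphic_intros holomorphic_on_subset[OF h[OF x]] holomorphic_on_subset[OF u(1)])
         (auto intro!: sub)
    fix z assume z: "z \<in> N x \<inter> ?T" "\<bar>Re z\<bar> < \<epsilon>"
    have "a z = h x (z + 1) - h x z" by (rule a(2)[OF x]) (use z \<epsilon> in \<open>auto intro!: sub\<close>)
    moreover have "u (z + 1) - u z = a z" by (rule u(2)) (use z in \<open>auto simp: in_box_complex_iff\<close>)
    ultimately show "h x (z + 1) - u (z + 1) = h x z - u z + 0" by (simp add: algebra_simps)
  qed (use \<epsilon> in auto)
  moreover have "g x y z = H y z - H x z"
    if xy: "x \<in> J" "y \<in> J" and z: "z \<in> N x" "z \<in> N y" "z \<in> ?T" for x y z
  proof -
    \<comment> \<open>The translate at which the extension reads its values; it lies near the unit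
      square, and there \<open>u\<close> cancels in the difference.\<close>
    let ?w = "z - of_int \<lfloor>Re z\<rfloor>"
    have "- \<epsilon> \<le> Re ?w" "Re ?w \<le> 1 + \<epsilon>" using \<epsilon> by (simp, linarith)+
    then have "?w \<in> W" by (rule sub) (use z in auto)
    then have "g x y ?w = h y ?w - h x ?w" using xy z N_1_int by (intro hg) auto
    then show ?thesis using g_1_int[OF xy z(1,2)] by (simp add: H_def quasiperiodic_extension_def)
  qed
  ultimately show ?thesis using that[of \<epsilon> H] \<epsilon> per oT by (auto simp: splits_def)
qed

text \<open>The defect for the period \<open>\<i>\<close> is again independent of the index, and it
  has period 1 since the splitting already does. Only its constant term resists the vertical
  difference equation; it survives as \<open>c\<close> and represents the cohomology class.\<close>

theorem splits_up_to_period: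
  obtains c H where "splits UNIV H" "\<And>x z. x \<in> J \<Longrightarrow> z \<in> N x \<Longrightarrow> H x (z + 1) = H x z"
    "\<And>x z. x \<in> J \<Longrightarrow> z \<in> N x \<Longrightarrow> H x (z + \<i>) = H x z + c"
proof -
  obtain \<epsilon> h where \<epsilon>: "0 < \<epsilon>" "\<epsilon> < 1" and s: "splits {z. - \<epsilon> < Im z \<and> Im z < 1 + \<epsilon>} h"
    and per: "\<And>x z. h x (z + 1) = h x z"
    using splits_horizontal_strip by blast
  let ?T = "{z. - \<epsilon> < Im z \<and> Im z < 1 + \<epsilon>}"
  have h: "h x holomorphic_on N x \<inter> ?T" if "x \<in> J" for x using s that by (simp add: splits_def)
  have hg: "g x y z = h y z - h x z" if "x \<in> J" "y \<in> J" "z \<in> N x" "z \<in> N y" "z \<in> ?T" for x y z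
    using s that by (simp add: splits_def)
  let ?S = "{z. \<bar>Im z\<bar> < \<epsilon>}"
  have oS: "open ?S" by (intro open_Collect_less continuous_intros)
  obtain b where b: "b holomorphic_on ?S"
    "\<And>x z. x \<in> J \<Longrightarrow> z \<in> N x \<Longrightarrow> z \<in> ?S \<Longrightarrow> b z = h x (z + \<i>) - h x z"
  proof (rule holomorphic_glue[of ?S "\<lambda>x z. h x (z + \<i>) - h x z"])
    show "(\<lambda>z. h x (z + \<i>) - h x z) holomorphic_on N x \<inter> ?S" if x: "x \<in> J" for x
    proof (intro holomorphic_on_diff)
      show "(\<lambda>z. h x (z + \<i>)) holomorphic_on N x \<inter> ?S"
        by (rule holomorphic_on_compose_gen[OF _ h[OF x], unfolded o_def])
           (use N_i[OF x] in \<open>auto intro!: holomorphic_intros\<close>)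
      show "h x holomorphic_on N x \<inter> ?S" using h[OF x] by (rule holomorphic_on_subset) auto
    qed
    show "h x (z + \<i>) - h x z = h y (z + \<i>) - h y z"
      if "x \<in> J" "y \<in> J" "z \<in> N x" "z \<in> N y" "z \<in> ?S" for x y z
    proof -
      have "g x y z = h y z - h x z" "g x y (z + \<i>) = h y (z + \<i>) - h x (z + \<i>)"
        using that N_i \<epsilon> by (auto intro!: hg)
      then have "h y (z + \<i>) - h x (z + \<i>) = h y z - h x z" using g_i[OF that(1-4)] by simp
      then show ?thesis by (simp add: algebra_simps)
    qed
  qed (use oS that in blast)+
  have b_per: "b (z + 1) = b z" if z: "\<bar>Im z\<bar> < \<epsilon>" for z
  proof -
    obtain x where x: "x \<in> J" "z \<in> N x" using cover by blast
    have "h x (z + 1 + \<i>) = h x (z + \<i>)" using per[of x "z + \<i>"] by (simp add: add_ac)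
    then show ?thesis using b(2)[of x z] b(2)[of x "z + 1"] x z N_1[of x z] per[of x z] by simp
  qed
  \<comment> \<open>The solution \<open>v\<close> is available only over a strip strictly narrower
    than the one on which \<open>b\<close> is known.\<close>
  define \<delta> where "\<delta> = \<epsilon> / 2"
  have \<delta>: "0 < \<delta>" "\<delta> < \<epsilon>" "\<delta> < 1" using \<epsilon> by (auto simp: \<delta>_def)
  obtain v c where v: "v holomorphic_on {z. - \<delta> < Im z \<and> Im z < 1 + \<delta>}"
    "\<And>z. v (z + 1) = v z" "\<And>z. \<bar>Im z\<bar> < \<delta> \<Longrightarrow> v (z + \<i>) - v z = b z - c"
    using vertical_difference_equation[OF b(1) b_per \<delta>] by blast
  define H where "H x = quasiperiodic_extension Im \<i> c (\<lambda>z. h x z - v z)" for x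
  show ?thesis
  proof (rule that)
    show "H x (z + \<i>) = H x z + c" for x z
      unfolding H_def by (rule Im.quasiperiodic_extension_shift)
    show "H x (z + 1) = H x z" for x z
    proof -
      have "h x (z + 1 - w) = h x (z - w)" "v (z + 1 - w) = v (z - w)" for w
        using per[of x "z - w"] v(2)[of "z - w"] by (simp_all add: algebra_simps)
      then show ?thesis by (simp add: H_def quasiperiodic_extension_def)
    qed
    have "H x holomorphic_on N x" if x: "x \<in> J" for x
      unfolding H_def
    proof (rule Im.quasiperiodic_extension_holomorphic(1)[OF open_N[OF x] N_i[OF x] \<delta>(1,3)])
      show "(\<lambda>z. h x z - v z) holomorphic_on N x \<inter> {z. - \<delta> < Im z \<and> Im z < 1 + \<delta>}"
        by (intro holomorphic_intros holomorphic_on_subset[OF h[OF x]] holomorphic_on_subset[OF v(1)])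
           (use \<delta> in auto)
      fix z assume z: "z \<in> N x" "\<bar>Im z\<bar> < \<delta>"
      then have "b z = h x (z + \<i>) - h x z" using b(2)[OF x] \<delta> by simp
      with v(3)[OF z(2)] show "h x (z + \<i>) - v (z + \<i>) = h x z - v z + c" by (simp add: algebra_simps)
    qed
    moreover have "g x y z = H y z - H x z"
      if xy: "x \<in> J" "y \<in> J" and z: "z \<in> N x" "z \<in> N y" for x y z
    proof -
      let ?w = "z - of_int \<lfloor>Im z\<rfloor> * \<i>"
      have "- \<epsilon> < Im ?w" "Im ?w < 1 + \<epsilon>" using \<epsilon> by (simp, linarith)+
      then have "?w \<in> ?T" by blast
      then have "g x y ?w = h y ?w - h x ?w" using xy z N_i_int by (intro hg) auto
      then show ?thesis using g_i_int[OF xy z(1,2)] by (simp add: H_def quasiperiodic_extension_def)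
    qed
    ultimately show "splits UNIV H" by (simp add: splits_def)
  qed
qed

end

section \<open>The torus\<close>

definition unit_square :: "complex set" where
  "unit_square = {z. 0 \<le> Re z \<and> Re z < 1 \<and> 0 \<le> Im z \<and> Im z < 1}"

definition torus_proj :: "complex \<Rightarrow> complex" where
  "torus_proj z = Complex (frac (Re z)) (frac (Im z))"

definition lattice_point :: "int \<Rightarrow> int \<Rightarrow> complex" where
  "lattice_point m n = of_int m + of_int n * \<i>"

lemma torus_proj_in: "torus_proj z \<in> unit_square"
  by (simp add: torus_proj_def unit_square_def frac_lt_1)

lemma torus_proj_id: "z \<in> unit_square \<Longrightarrow> torus_proj z = z"
  by (simp add: torus_proj_def unit_square_def frac_eq)

lemma torus_proj_eq_minus: "torus_proj z = z - lattice_point \<lfloor>Re z\<rfloor> \<lfloor>Im z\<rfloor>"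
  by (simp add: torus_proj_def lattice_point_def complex_eq_iff frac_def)

lemma torus_proj_add_lattice: "torus_proj (z + lattice_point m n) = torus_proj z"
  by (simp add: torus_proj_def lattice_point_def frac_def)

lemma torus_proj_eq_iff: "torus_proj z = torus_proj w \<longleftrightarrow> (\<exists>m n. z = w + lattice_point m n)"
proof
  assume "torus_proj z = torus_proj w"
  then have "z = w + lattice_point (\<lfloor>Re z\<rfloor> - \<lfloor>Re w\<rfloor>) (\<lfloor>Im z\<rfloor> - \<lfloor>Im w\<rfloor>)"
    unfolding torus_proj_eq_minus by (simp add: lattice_point_def complex_eq_iff)
  then show "\<exists>m n. z = w + lattice_point m n" by blast
qed (auto simp: torus_proj_add_lattice)

lemma torus_proj_1: "torus_proj (z + 1) = torus_proj z"
  using torus_proj_add_lattice[of z 1 0] by (simp add: lattice_point_def)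

lemma torus_proj_i: "torus_proj (z + \<i>) = torus_proj z"
  using torus_proj_add_lattice[of z 0 1] by (simp add: lattice_point_def)

lemma norm_lattice_point_less_1:
  assumes "norm (lattice_point m n) < 1"
  shows "lattice_point m n = 0"
proof -
  have "\<bar>Re (lattice_point m n)\<bar> < 1" "\<bar>Im (lattice_point m n)\<bar> < 1"
    using assms abs_Re_le_cmod[of "lattice_point m n"] abs_Im_le_cmod[of "lattice_point m n"] by linarith+
  then have "m = 0" "n = 0" by (simp_all add: lattice_point_def)
  then show ?thesis by (simp add: lattice_point_def)
qed

text \<open>The torus \<open>\<complex>/(\<int> + \<int>\<i>)\<close> is modelled on its set of representatives in the unit square, with the
  quotient topology of the projection.\<close>

definition torus_topology :: "complex topology" where
  "torus_topology = topology (\<lambda>U. U \<subseteq> unit_square \<and> open (torus_proj -` U))"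

lemma openin_torus: "openin torus_topology U \<longleftrightarrow> U \<subseteq> unit_square \<and> open (torus_proj -` U)"
proof -
  have "istopology (\<lambda>U. U \<subseteq> unit_square \<and> open (torus_proj -` U))"
    by (auto simp: istopology_def vimage_Union vimage_Int)
  then show ?thesis unfolding torus_topology_def by (simp add: topology_inverse')
qed

lemma topspace_torus: "topspace torus_topology = unit_square"
proof -
  have "torus_proj -` unit_square = UNIV" using torus_proj_in by auto
  then have "openin torus_topology unit_square" by (simp add: openin_torus)
  then show ?thesis using openin_torus openin_subset by (metis openin_topspace subset_antisym)
qed

text \<open>The saturation of an open set is the union of its lattice translates. Openness of the
  projection is what makes its local inverses continuous.\<close>

lemma openin_torus_proj_image:
  assumes "open V"
  shows "openin torus_topology (torus_proj ` V)"
proof -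
  have "torus_proj -` torus_proj ` V = (\<Union>(m, n)\<in>UNIV. (\<lambda>z. lattice_point m n + z) ` V)"
  proof (intro equalityI subsetI)
    fix z assume "z \<in> torus_proj -` torus_proj ` V"
    then obtain w where "torus_proj z = torus_proj w" "w \<in> V" by auto
    then show "z \<in> (\<Union>(m, n)\<in>UNIV. (\<lambda>z. lattice_point m n + z) ` V)"
      by (auto simp: torus_proj_eq_iff image_iff add.commute)
  next
    fix z assume "z \<in> (\<Union>(m, n)\<in>UNIV. (\<lambda>z. lattice_point m n + z) ` V)"
    then obtain m n w where "z = w + lattice_point m n" "w \<in> V" by (auto simp: add.commute)
    then show "z \<in> torus_proj -` torus_proj ` V" by (simp add: torus_proj_add_lattice)
  qed
  moreover have "open (\<Union>(m, n)\<in>UNIV. (\<lambda>z. lattice_point m n + z) ` V)"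
    using assms by (auto intro!: open_UN open_translation)
  ultimately show ?thesis using torus_proj_in by (auto simp: openin_torus)
qed

lemma continuous_map_torus_proj: "continuous_map euclidean torus_topology torus_proj"
  by (auto simp: continuous_map_def topspace_torus torus_proj_in openin_torus vimage_def)

lemma compact_space_torus: "compact_space torus_topology"
proof -
  have "compactin torus_topology (torus_proj ` cbox 0 (1 + \<i>))"
    by (intro image_compactin[OF _ continuous_map_torus_proj]) simp
  moreover have "torus_proj ` cbox 0 (1 + \<i>) = unit_square"
  proof
    show "unit_square \<subseteq> torus_proj ` cbox 0 (1 + \<i>)"
    proof
      fix z assume z: "z \<in> unit_square"
      then have "z \<in> cbox 0 (1 + \<i>)" by (simp add: unit_square_def in_cbox_complex_iff)
      then show "z \<in> torus_proj ` cbox 0 (1 + \<i>)" using torus_proj_id[OF z] by (metis image_eqI)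
    qed
  qed (use torus_proj_in in auto)
  ultimately show ?thesis by (simp add: compact_space_def topspace_torus)
qed

lemma connected_space_torus: "connected_space torus_topology"
proof -
  have "connectedin torus_topology (torus_proj ` UNIV)"
    by (rule connectedin_continuous_map_image[OF continuous_map_torus_proj])
       (simp add: convex_connected)
  moreover have "torus_proj ` UNIV = unit_square" using torus_proj_in torus_proj_id by (auto simp: image_iff) metis
  ultimately show ?thesis by (metis connectedin_topspace topspace_torus)
qed

text \<open>The exponentials of both coordinates, \<open>?E\<close>, embed the torus in a product of
  two circles. Disjoint neighbourhoods there pull back to open sets of the quotient
  topology.\<close>

lemma Hausdorff_space_torus: "Hausdorff_space torus_topology"
  unfolding Hausdorff_space_def topspace_torus
proof (intro allI impI)
  fix p q assume pq: "p \<in> unit_square \<and> q \<in> unit_square \<and> p \<noteq> q"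
  let ?E = "\<lambda>z. (cis (2 * pi * Re z), cis (2 * pi * Im z))"
  have E: "?E (torus_proj z) = ?E z" for z
  proof -
    have "cis (2 * pi * frac x) = cis (2 * pi * x)" for x
    proof -
      have "cis (2 * pi * frac x) = cis (2 * pi * x) / cis (2 * pi * of_int \<lfloor>x\<rfloor>)"
        unfolding cis_divide by (simp add: frac_def right_diff_distrib)
      also have "cis (2 * pi * of_int \<lfloor>x\<rfloor>) = 1" by (intro cis_multiple_2pi) simp
      finally show ?thesis by simp
    qed
    then show ?thesis by (simp add: torus_proj_def)
  qed
  have cis_inj: "x = y" if "cis (2 * pi * x) = cis (2 * pi * y)" "0 \<le> x" "x < 1" "0 \<le> y" "y < 1" for x y
  proof -
    have "cos (2 * pi * x) = cos (2 * pi * y) \<and> sin (2 * pi * x) = sin (2 * pi * y)"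
      using that(1) by (simp add: complex_eq_iff)
    then obtain n :: int where "2 * pi * x = 2 * pi * y + 2 * pi * n"
      using sin_cos_eq_iff[of "2 * pi * x" "2 * pi * y"] by auto
    then have "2 * pi * (x - y - of_int n) = 0" by (simp add: algebra_simps)
    then have xy: "x - y = of_int n" by simp
    then have "n = 0" using that by linarith
    then show ?thesis using xy by simp
  qed
  have "?E p \<noteq> ?E q"
  proof
    assume "?E p = ?E q"
    then have "Re p = Re q" "Im p = Im q"
      using pq by (auto simp: unit_square_def intro!: cis_inj)
    then show False using pq complex_eqI by blast
  qed
  from hausdorff[OF this]
  obtain U V where UV: "open U" "open V" "?E p \<in> U" "?E q \<in> V" "U \<inter> V = {}" by (elim exE conjE)
  have cont: "continuous_on UNIV ?E" by (intro continuous_intros)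
  have op: "openin torus_topology {z \<in> unit_square. ?E z \<in> W}" if "open W" for W
  proof -
    have "torus_proj -` {z \<in> unit_square. ?E z \<in> W} = ?E -` W" using E torus_proj_in by auto
    then show ?thesis using open_vimage[OF that cont] by (simp add: openin_torus)
  qed
  show "\<exists>U V. openin torus_topology U \<and> openin torus_topology V \<and> p \<in> U \<and> q \<in> V \<and> disjnt U V"
    using op[OF UV(1)] op[OF UV(2)] UV pq
    by (intro exI[of _ "{z \<in> unit_square. ?E z \<in> U}"] exI[of _ "{z \<in> unit_square. ?E z \<in> V}"])
       (auto simp: disjnt_def)
qed

section \<open>The complex structure of the torus\<close>

definition torus_chart :: "complex \<Rightarrow> complex \<Rightarrow> complex" where
  "torus_chart z = inv_into (ball z (1/2)) torus_proj"

definition torus_disc :: "complex \<Rightarrow> complex set" where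
  "torus_disc z = torus_proj ` ball z (1/2)"

definition torus_atlas :: "complex atlas" where
  "torus_atlas = (\<lambda>z. (torus_disc z, torus_chart z)) ` UNIV"

text \<open>This dictates the radius 1/2 of the charts: two points of such a disc are less than 1
  apart, and no nonzero lattice vector is that short.\<close>

lemma inj_on_torus_proj: "inj_on torus_proj (ball z (1/2))"
proof (rule inj_onI)
  fix u v assume uv: "u \<in> ball z (1/2)" "v \<in> ball z (1/2)" "torus_proj u = torus_proj v"
  then obtain m n where mn: "u = v + lattice_point m n" using torus_proj_eq_iff by blast
  have "dist u v < 1" using uv dist_triangle_half_r[of z u 1 v] by (simp add: dist_commute)
  then have "norm (lattice_point m n) < 1" by (simp add: mn dist_norm)
  then show "u = v" using norm_lattice_point_less_1 mn by simp
qed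

lemma torus_chart_proj: "u \<in> ball z (1/2) \<Longrightarrow> torus_chart z (torus_proj u) = u"
  unfolding torus_chart_def by (rule inv_into_f_f[OF inj_on_torus_proj])

lemma torus_proj_chart: "p \<in> torus_disc z \<Longrightarrow> torus_proj (torus_chart z p) = p"
  unfolding torus_chart_def torus_disc_def by (rule f_inv_into_f)

lemma torus_chart_in: "p \<in> torus_disc z \<Longrightarrow> torus_chart z p \<in> ball z (1/2)"
  unfolding torus_chart_def torus_disc_def by (rule inv_into_into)

lemma torus_chart_image: "torus_chart z ` (torus_disc z \<inter> W) = ball z (1/2) \<inter> torus_proj -` W"
proof
  show "torus_chart z ` (torus_disc z \<inter> W) \<subseteq> ball z (1/2) \<inter> torus_proj -` W"
    using torus_chart_in torus_proj_chart by auto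
  show "ball z (1/2) \<inter> torus_proj -` W \<subseteq> torus_chart z ` (torus_disc z \<inter> W)"
  proof
    fix u assume "u \<in> ball z (1/2) \<inter> torus_proj -` W"
    then show "u \<in> torus_chart z ` (torus_disc z \<inter> W)"
      using torus_chart_proj[of u z] by (intro image_eqI[of _ _ "torus_proj u"]) (auto simp: torus_disc_def)
  qed
qed

lemma inv_into_torus_chart:
  assumes "u \<in> ball z (1/2)"
  shows "inv_into (torus_disc z) (torus_chart z) u = torus_proj u"
proof (rule inv_into_f_eq)
  show "inj_on (torus_chart z) (torus_disc z)"
    by (rule inj_on_inverseI[of _ torus_proj]) (rule torus_proj_chart)
qed (use assms torus_chart_proj in \<open>auto simp: torus_disc_def\<close>)

lemma openin_torus_disc: "openin torus_topology (torus_disc z)"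
  unfolding torus_disc_def by (intro openin_torus_proj_image) simp

lemma centre_in_torus_disc: "z \<in> unit_square \<Longrightarrow> z \<in> torus_disc z"
  unfolding torus_disc_def using torus_proj_id[of z] by (metis centre_in_ball half_gt_zero zero_less_one image_eqI)

text \<open>The preimage of a disc consists of its lattice translates, and on each of them the chart
  undoes the translation. The lattice vector varies from one translate to another, hence the local
  formulation.\<close>

lemma torus_chart_locally_translation:
  assumes "torus_proj w0 \<in> torus_disc z"
  obtains m n S where "open S" "w0 \<in> S"
    "\<And>w. w \<in> S \<Longrightarrow> torus_proj w \<in> torus_disc z"
    "\<And>w. w \<in> S \<Longrightarrow> torus_chart z (torus_proj w) = w + lattice_point m n"
proof -
  have "torus_proj (torus_chart z (torus_proj w0)) = torus_proj w0" using torus_proj_chart assms by blast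
  then obtain m n where mn: "torus_chart z (torus_proj w0) = w0 + lattice_point m n"
    using torus_proj_eq_iff by blast
  let ?S = "(\<lambda>w. w + lattice_point m n) -` ball z (1/2)"
  have eq: "torus_chart z (torus_proj w) = w + lattice_point m n" "torus_proj w \<in> torus_disc z" if "w \<in> ?S" for w
  proof -
    have "w + lattice_point m n \<in> ball z (1/2)" using that by simp
    from torus_chart_proj[OF this] imageI[OF this, of torus_proj]
    show "torus_chart z (torus_proj w) = w + lattice_point m n" "torus_proj w \<in> torus_disc z"
      by (simp_all add: torus_proj_add_lattice torus_disc_def)
  qed
  show ?thesis
  proof (rule that[of ?S m n])
    show "open ?S" by (intro open_vimage continuous_intros) simp
    show "w0 \<in> ?S" using torus_chart_in[OF assms] mn by simp
  qed (fact eq)+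
qed

lemma torus_chart_proj_holomorphic:
  "(\<lambda>w. torus_chart z (torus_proj w)) holomorphic_on torus_proj -` torus_disc z"
proof (rule holomorphic_on_if_differentiable_at)
  fix w0 assume "w0 \<in> torus_proj -` torus_disc z"
  then have "torus_proj w0 \<in> torus_disc z" by simp
  then obtain m n S where S: "open S" "w0 \<in> S" "\<And>w. w \<in> S \<Longrightarrow> torus_proj w \<in> torus_disc z"
    "\<And>w. w \<in> S \<Longrightarrow> torus_chart z (torus_proj w) = w + lattice_point m n"
    by (rule torus_chart_locally_translation) (rule that)
  have "(\<lambda>w. w + lattice_point m n) holomorphic_on S" by (intro holomorphic_intros)
  then have "(\<lambda>w. torus_chart z (torus_proj w)) holomorphic_on S"
    by (rule holomorphic_transform) (use S in auto)
  then show "(\<lambda>w. torus_chart z (torus_proj w)) field_differentiable at w0"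
    using S(1,2) by (rule holomorphic_on_imp_differentiable_at)
qed

lemma compact_riemann_surface_torus: "compact_riemann_surface torus_topology torus_atlas"
  unfolding compact_riemann_surface_def
proof (intro conjI)
  show "topspace torus_topology \<noteq> {}" using torus_proj_in by (auto simp: topspace_torus)
  show "topspace torus_topology = (\<Union>(U, \<phi>)\<in>torus_atlas. U)"
  proof
    show "topspace torus_topology \<subseteq> (\<Union>(U, \<phi>)\<in>torus_atlas. U)"
      using centre_in_torus_disc by (force simp: topspace_torus torus_atlas_def)
    show "(\<Union>(U, \<phi>)\<in>torus_atlas. U) \<subseteq> topspace torus_topology"
      using openin_subset[OF openin_torus_disc] by (auto simp: torus_atlas_def)
  qed
  have "homeomorphic_map (subtopology torus_topology (torus_disc z)) (top_of_set (ball z (1/2))) (torus_chart z)" for z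
    unfolding homeomorphic_map_maps homeomorphic_maps_def
  proof (intro exI conjI)
    have sub: "torus_disc z \<subseteq> unit_square" using torus_proj_in by (auto simp: torus_disc_def)
    show "continuous_map (subtopology torus_topology (torus_disc z)) (top_of_set (ball z (1/2))) (torus_chart z)"
      unfolding continuous_map_in_subtopology
    proof
      show "torus_chart z \<in> topspace (subtopology torus_topology (torus_disc z)) \<rightarrow> ball z (1/2)"
        using torus_chart_in by auto
      have "{p \<in> torus_disc z. torus_chart z p \<in> V} = torus_proj ` (ball z (1/2) \<inter> V)" for V
      proof (intro equalityI subsetI)
        fix p assume "p \<in> {p \<in> torus_disc z. torus_chart z p \<in> V}"
        then have p: "p \<in> torus_disc z" "torus_chart z p \<in> V" by auto
        then show "p \<in> torus_proj ` (ball z (1/2) \<inter> V)"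
          using torus_chart_in[OF p(1)] torus_proj_chart[OF p(1)] by (metis IntI imageI)
      next
        fix p assume "p \<in> torus_proj ` (ball z (1/2) \<inter> V)"
        then show "p \<in> {p \<in> torus_disc z. torus_chart z p \<in> V}"
          using torus_chart_proj by (auto simp: torus_disc_def)
      qed
      then have "openin (subtopology torus_topology (torus_disc z)) {p \<in> torus_disc z. torus_chart z p \<in> V}"
        if "open V" for V
        using that by (auto simp: openin_open_subtopology[OF openin_torus_disc] intro: openin_torus_proj_image)
      then show "continuous_map (subtopology torus_topology (torus_disc z)) euclidean (torus_chart z)"
        using sub by (simp add: continuous_map_def topspace_torus Int_absorb1)
    qed
    show "continuous_map (top_of_set (ball z (1/2))) (subtopology torus_topology (torus_disc z)) torus_proj"
      using continuous_map_torus_proj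
      by (auto simp: continuous_map_in_subtopology torus_disc_def intro: continuous_map_from_subtopology)
  qed (use torus_chart_in torus_proj_chart torus_chart_proj in \<open>auto simp: topspace_torus\<close>)
  then show "\<forall>(U, \<phi>)\<in>torus_atlas. openin torus_topology U \<and> open (\<phi> ` U) \<and>
      homeomorphic_map (subtopology torus_topology U) (top_of_set (\<phi> ` U)) \<phi>"
    using torus_chart_image[of _ UNIV] by (auto simp: torus_atlas_def openin_torus_disc)
  show "\<forall>(U, \<phi>)\<in>torus_atlas. \<forall>(V, \<psi>)\<in>torus_atlas. (\<psi> \<circ> inv_into U \<phi>) holomorphic_on \<phi> ` (U \<inter> V)"
  proof (clarsimp simp: torus_atlas_def torus_chart_image)
    fix z z'
    show "(torus_chart z' \<circ> inv_into (torus_disc z) (torus_chart z)) holomorphic_on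
        ball z (1/2) \<inter> torus_proj -` torus_disc z'"
      by (rule holomorphic_transform[OF holomorphic_on_subset[OF torus_chart_proj_holomorphic[of z']]])
         (auto simp: inv_into_torus_chart)
  qed
qed (use Hausdorff_space_torus compact_space_torus connected_space_torus in auto)

text \<open>In a chart the inverse is \<open>torus_proj\<close> itself, so the coordinate
  expressions are restrictions of one function on the plane. All further work on the torus takes
  place upstairs.\<close>

lemma holomorphic_fun_torus:
  assumes W: "openin torus_topology W"
  shows "holomorphic_fun torus_atlas W f \<longleftrightarrow> (\<lambda>z. f (torus_proj z)) holomorphic_on torus_proj -` W"
proof -
  have oW: "open (torus_proj -` W)" using W by (simp add: openin_torus)
  have "(f \<circ> inv_into (torus_disc z) (torus_chart z)) holomorphic_on ball z (1/2) \<inter> torus_proj -` W \<longleftrightarrow>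
      (\<lambda>z. f (torus_proj z)) holomorphic_on ball z (1/2) \<inter> torus_proj -` W" for z
    by (rule holomorphic_cong) (auto simp: inv_into_torus_chart)
  then have "holomorphic_fun torus_atlas W f \<longleftrightarrow>
      (\<forall>z. (\<lambda>z. f (torus_proj z)) holomorphic_on ball z (1/2) \<inter> torus_proj -` W)"
    by (simp add: holomorphic_fun_def torus_atlas_def torus_chart_image)
  also have "\<dots> \<longleftrightarrow> (\<lambda>z. f (torus_proj z)) holomorphic_on torus_proj -` W"
  proof
    assume *: "\<forall>z. (\<lambda>z. f (torus_proj z)) holomorphic_on ball z (1/2) \<inter> torus_proj -` W"
    show "(\<lambda>z. f (torus_proj z)) holomorphic_on torus_proj -` W"
    proof (rule holomorphic_on_if_differentiable_at)
      fix z assume "z \<in> torus_proj -` W"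
      then have "open (ball z (1/2) \<inter> torus_proj -` W)" "z \<in> ball z (1/2) \<inter> torus_proj -` W"
        using oW by auto
      then show "(\<lambda>z. f (torus_proj z)) field_differentiable at z"
        using * holomorphic_on_imp_differentiable_at by blast
    qed
  qed (auto elim: holomorphic_on_subset)
  finally show ?thesis .
qed

lemma holomorphic_section_torus:
  assumes W: "openin torus_topology W"
  shows "holomorphic_section torus_atlas {unit_square} (\<lambda>_ _ _. 1) W s \<longleftrightarrow>
    (\<lambda>z. s (unit_square, torus_proj z)) holomorphic_on torus_proj -` W"
proof -
  have "unit_square \<inter> W = W" using openin_subset[OF W] by (auto simp: topspace_torus)
  then show ?thesis by (simp add: holomorphic_section_def holomorphic_fun_torus[OF W])
qed

lemma doubly_periodic_entire_constant:
  fixes f :: "complex \<Rightarrow> complex"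
  assumes f: "f holomorphic_on UNIV" and per: "\<And>z. f (z + 1) = f z" "\<And>z. f (z + \<i>) = f z"
  obtains c where "\<And>z. f z = c"
proof -
  interpret Re: translation Re 1 by unfold_locales (auto intro!: continuous_intros)
  interpret Im: translation Im \<i> by unfold_locales (auto intro!: continuous_intros)
  have per': "f (torus_proj z) = f z" for z
  proof -
    \<comment> \<open>Level sets of \<open>f\<close> are stable under each period, so the value is
      unchanged by the reduction to the unit square.\<close>
    have "z + of_int (- \<lfloor>Re z\<rfloor>) * 1 \<in> {w. f w = f z} \<longleftrightarrow> z \<in> {w. f w = f z}"
      by (rule Re.invariant_shift) (use per in auto)
    moreover have "z - of_int \<lfloor>Re z\<rfloor> + of_int (- \<lfloor>Im z\<rfloor>) * \<i> \<in> {w. f w = f z} \<longleftrightarrow> z - of_int \<lfloor>Re z\<rfloor> \<in> {w. f w = f z}"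
      by (rule Im.invariant_shift) (use per in auto)
    ultimately show ?thesis by (simp add: torus_proj_eq_minus lattice_point_def algebra_simps)
  qed
  have "compact (f ` cbox 0 (1 + \<i>))"
    using holomorphic_on_imp_continuous_on[OF f] by (intro compact_continuous_image) (auto elim: continuous_on_subset)
  then have "bounded (f ` cbox 0 (1 + \<i>))" by (rule compact_imp_bounded)
  moreover have "range f \<subseteq> f ` cbox 0 (1 + \<i>)"
  proof
    fix y assume "y \<in> range f"
    then obtain z where "y = f (torus_proj z)" using per' by auto
    moreover have "torus_proj z \<in> cbox 0 (1 + \<i>)"
      using torus_proj_in[of z] by (simp add: unit_square_def in_cbox_complex_iff)
    ultimately show "y \<in> f ` cbox 0 (1 + \<i>)" by blast
  qed
  ultimately have "f constant_on UNIV" using Liouville_theorem[OF f] bounded_subset by blast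
  then show ?thesis using that by (auto simp: constant_on_def)
qed

section \<open>The cohomology of the structure sheaf of the torus\<close>

definition lattice_shift :: "complex \<Rightarrow> complex \<Rightarrow> complex" where
  "lattice_shift x z = torus_chart x (torus_proj z) - z"

text \<open>Two charts differ on an overlap by a lattice vector, locally constant; the cocycle
  records its coefficient at \<open>\<i>\<close>. This coefficient is the relevant one because
  splittings upstairs have period 1 and drift only in the direction \<open>\<i>\<close>.\<close>

definition period_cocycle :: "complex \<times> complex \<times> complex set \<times> complex \<Rightarrow> complex" where
  "period_cocycle = (\<lambda>(x, y, U, p). of_real (Im (torus_chart y p - torus_chart x p)))"

lemma lattice_shift_locally_constant:
  assumes "torus_proj w0 \<in> torus_disc x"
  obtains S where "open S" "w0 \<in> S" "\<And>w. w \<in> S \<Longrightarrow> torus_proj w \<in> torus_disc x"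
    "\<And>w. w \<in> S \<Longrightarrow> lattice_shift x w = lattice_shift x w0"
proof -
  obtain m n S where S: "open S" "w0 \<in> S" "\<And>w. w \<in> S \<Longrightarrow> torus_proj w \<in> torus_disc x"
    "\<And>w. w \<in> S \<Longrightarrow> torus_chart x (torus_proj w) = w + lattice_point m n"
    using assms by (rule torus_chart_locally_translation) (rule that)
  have "lattice_shift x w = lattice_shift x w0" if "w \<in> S" for w
    using S(2,4) that by (simp add: lattice_shift_def)
  then show ?thesis using that[of S] S(1-3) by blast
qed

lemma lattice_shift_holomorphic:
  "(\<lambda>z. of_real (Im (lattice_shift x z)) :: complex) holomorphic_on torus_proj -` torus_disc x"
proof (rule holomorphic_on_if_differentiable_at)
  fix w0 assume "w0 \<in> torus_proj -` torus_disc x"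
  then have "torus_proj w0 \<in> torus_disc x" by simp
  then obtain S where S: "open S" "w0 \<in> S" "\<And>w. w \<in> S \<Longrightarrow> torus_proj w \<in> torus_disc x"
    "\<And>w. w \<in> S \<Longrightarrow> lattice_shift x w = lattice_shift x w0"
    by (rule lattice_shift_locally_constant) (rule that)
  have "(\<lambda>z. of_real (Im (lattice_shift x z)) :: complex) holomorphic_on S"
    by (rule holomorphic_transform[OF holomorphic_on_const[of "of_real (Im (lattice_shift x w0))"]])
       (simp only: S(4))
  then show "(\<lambda>z. of_real (Im (lattice_shift x z)) :: complex) field_differentiable at w0"
    using S(1,2) by (rule holomorphic_on_imp_differentiable_at)
qed

lemma pointed_cover_torus_disc: "pointed_cover torus_topology torus_disc"
  using openin_torus_disc centre_in_torus_disc by (simp add: pointed_cover_def topspace_torus)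

lemma pointed_cover_Int:
  "pointed_cover X N \<Longrightarrow> pointed_cover X N' \<Longrightarrow> pointed_cover X (\<lambda>x. N x \<inter> N' x)"
  by (auto simp: pointed_cover_def)

lemma cech_cocycles1_torus:
  "f \<in> cech_cocycles1 torus_topology torus_atlas {unit_square} (\<lambda>_ _ _. 1) \<longleftrightarrow>
    (\<exists>N. pointed_cover torus_topology N \<and>
      (\<forall>x\<in>unit_square. \<forall>y\<in>unit_square.
        (\<lambda>z. f (x, y, unit_square, torus_proj z)) holomorphic_on torus_proj -` (N x \<inter> N y)) \<and>
      (\<forall>x\<in>unit_square. \<forall>y\<in>unit_square. \<forall>u\<in>unit_square. \<forall>p\<in>N x \<inter> N y \<inter> N u.
        f (x, u, unit_square, p) = f (x, y, unit_square, p) + f (y, u, unit_square, p)))"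
proof -
  have "holomorphic_section torus_atlas {unit_square} (\<lambda>_ _ _. 1) (N x \<inter> N y) (\<lambda>(U, p). f (x, y, U, p)) \<longleftrightarrow>
      (\<lambda>z. f (x, y, unit_square, torus_proj z)) holomorphic_on torus_proj -` (N x \<inter> N y)"
    if "pointed_cover torus_topology N" "x \<in> unit_square" "y \<in> unit_square" for N x y
    using that by (subst holomorphic_section_torus) (auto simp: pointed_cover_def topspace_torus)
  moreover have "unit_square \<inter> N x = N x" if "pointed_cover torus_topology N" "x \<in> unit_square" for N x
    using that openin_subset by (force simp: pointed_cover_def topspace_torus)
  ultimately show ?thesis
    unfolding cech_cocycles1_def mem_Collect_eq topspace_torus
    by (intro ex_cong1 conj_cong refl) simp_all
qed

lemma cech_coboundaries1_torus:
  "f \<in> cech_coboundaries1 torus_topology torus_atlas {unit_square} (\<lambda>_ _ _. 1) \<longleftrightarrow>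
    (\<exists>N h. pointed_cover torus_topology N \<and>
      (\<forall>x\<in>unit_square. (\<lambda>z. h (x, unit_square, torus_proj z)) holomorphic_on torus_proj -` N x) \<and>
      (\<forall>x\<in>unit_square. \<forall>y\<in>unit_square. \<forall>p\<in>N x \<inter> N y.
        f (x, y, unit_square, p) = h (y, unit_square, p) - h (x, unit_square, p)))"
proof -
  have "holomorphic_section torus_atlas {unit_square} (\<lambda>_ _ _. 1) (N x) (\<lambda>(U, p). h (x, U, p)) \<longleftrightarrow>
      (\<lambda>z. h (x, unit_square, torus_proj z)) holomorphic_on torus_proj -` N x"
    if "pointed_cover torus_topology N" "x \<in> unit_square" for N x and h :: "complex \<times> complex set \<times> complex \<Rightarrow> complex"
    using that by (subst holomorphic_section_torus) (auto simp: pointed_cover_def topspace_torus)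
  moreover have "unit_square \<inter> N x = N x" if "pointed_cover torus_topology N" "x \<in> unit_square" for N x
    using that openin_subset by (force simp: pointed_cover_def topspace_torus)
  ultimately show ?thesis
    unfolding cech_coboundaries1_def mem_Collect_eq topspace_torus
    by (intro ex_cong1 conj_cong refl) simp_all
qed

text \<open>Upstairs the cocycle is the coboundary of the lattice shifts. These are not periodic, so
  this does not make it a coboundary on the torus.\<close>

lemma period_cocycle_proj:
  "period_cocycle (x, y, U, torus_proj z) = of_real (Im (lattice_shift y z)) - of_real (Im (lattice_shift x z))"
  by (simp add: period_cocycle_def lattice_shift_def)

lemma period_cocycle_in:
  "period_cocycle \<in> cech_cocycles1 torus_topology torus_atlas {unit_square} (\<lambda>_ _ _. 1)"
  unfolding cech_cocycles1_torus
proof (intro exI conjI ballI)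
  show "pointed_cover torus_topology torus_disc" by (rule pointed_cover_torus_disc)
  show "(\<lambda>z. period_cocycle (x, y, unit_square, torus_proj z)) holomorphic_on
      torus_proj -` (torus_disc x \<inter> torus_disc y)" for x y
    unfolding period_cocycle_proj
    by (intro holomorphic_on_diff holomorphic_on_subset[OF lattice_shift_holomorphic]) auto
qed (simp add: period_cocycle_def)

text \<open>A splitting \<open>H\<close> in the plane descends to the torus by evaluating
  \<open>H x\<close> at the lift of the point given by the chart at \<open>x\<close>. Where the
  charts at \<open>x\<close> and \<open>y\<close> pick different lifts, the drift of
  \<open>H\<close> enters as a multiple of the period cocycle.\<close>

lemma torus_cocycle_reduction:
  assumes "f \<in> cech_cocycles1 torus_topology torus_atlas {unit_square} (\<lambda>_ _ _. 1)"
  obtains c where "(\<lambda>q. f q - c * period_cocycle q) \<in>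
    cech_coboundaries1 torus_topology torus_atlas {unit_square} (\<lambda>_ _ _. 1)"
proof -
  obtain N where N: "pointed_cover torus_topology N"
    and hol: "\<And>x y. x \<in> unit_square \<Longrightarrow> y \<in> unit_square \<Longrightarrow>
      (\<lambda>z. f (x, y, unit_square, torus_proj z)) holomorphic_on torus_proj -` (N x \<inter> N y)"
    and coc: "\<And>x y u p. x \<in> unit_square \<Longrightarrow> y \<in> unit_square \<Longrightarrow> u \<in> unit_square \<Longrightarrow> p \<in> N x \<inter> N y \<inter> N u \<Longrightarrow>
      f (x, u, unit_square, p) = f (x, y, unit_square, p) + f (y, u, unit_square, p)"
    using assms unfolding cech_cocycles1_torus by blast
  have N': "openin torus_topology (N x)" "x \<in> N x" if "x \<in> unit_square" for x
    using N that by (auto simp: pointed_cover_def topspace_torus)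
  interpret P: periodic_cousin_problem unit_square "\<lambda>x. torus_proj -` N x"
    "\<lambda>x y z. f (x, y, unit_square, torus_proj z)"
  proof unfold_locales
    show "open (torus_proj -` N x)" if "x \<in> unit_square" for x
      using N'(1)[OF that] by (simp add: openin_torus)
    show "\<exists>x\<in>unit_square. z \<in> torus_proj -` N x" for z
      using N'(2) torus_proj_in by (intro bexI[of _ "torus_proj z"]) auto
    show "(\<lambda>z. f (x, y, unit_square, torus_proj z)) holomorphic_on torus_proj -` N x \<inter> torus_proj -` N y"
      if "x \<in> unit_square" "y \<in> unit_square" for x y
      using hol[OF that] by (simp only: vimage_Int)
    show "f (x, u, unit_square, torus_proj z) =
        f (x, y, unit_square, torus_proj z) + f (y, u, unit_square, torus_proj z)"
      if "x \<in> unit_square" "y \<in> unit_square" "u \<in> unit_square" "z \<in> torus_proj -` N x"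
        "z \<in> torus_proj -` N y" "z \<in> torus_proj -` N u" for x y u z
      by (rule coc[OF that(1-3)]) (use that(4-) in blast)
  qed (simp_all only: vimage_eq torus_proj_1 torus_proj_i)
  obtain c H where H: "P.splits UNIV H"
    "\<And>x z. x \<in> unit_square \<Longrightarrow> z \<in> torus_proj -` N x \<Longrightarrow> H x (z + 1) = H x z"
    "\<And>x z. x \<in> unit_square \<Longrightarrow> z \<in> torus_proj -` N x \<Longrightarrow> H x (z + \<i>) = H x z + c"
    by (rule P.splits_up_to_period) (rule that)
  have Hhol: "H x holomorphic_on torus_proj -` N x" if "x \<in> unit_square" for x
    using H(1) that by (simp add: P.splits_def)
  have Hdiff: "f (x, y, unit_square, torus_proj z) = H y z - H x z"
    if "x \<in> unit_square" "y \<in> unit_square" "torus_proj z \<in> N x" "torus_proj z \<in> N y" for x y z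
    using H(1) that by (simp add: P.splits_def)
  interpret Re: translation Re 1 by unfold_locales (auto intro!: continuous_intros)
  interpret Im: translation Im \<i> by unfold_locales (auto intro!: continuous_intros)
  have shift: "H x (w + lattice_point m n) - of_int n * c = H x w"
    if x: "x \<in> unit_square" and w: "torus_proj w \<in> N x" for x w m n
  proof -
    \<comment> \<open>Subtracting \<open>Im z * c\<close> absorbs the drift, so that the set is
      stable under both periods.\<close>
    let ?D = "{z. torus_proj z \<in> N x \<and> H x z - of_real (Im z) * c = H x w - of_real (Im w) * c}"
    have "z + 1 \<in> ?D \<longleftrightarrow> z \<in> ?D" for z using H(2)[OF x, of z] torus_proj_1[of z] by auto
    from Re.invariant_shift[OF this, of w m] w have "w + of_int m \<in> ?D" by simp
    moreover have "z + \<i> \<in> ?D \<longleftrightarrow> z \<in> ?D" for z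
      using H(3)[OF x, of z] torus_proj_i[of z] by (auto simp: algebra_simps)
    note Im.invariant_shift[OF this, of "w + of_int m" n]
    ultimately have "w + of_int m + of_int n * \<i> \<in> ?D" by blast
    then have "H x (w + lattice_point m n) - of_real (Im w + of_int n) * c = H x w - of_real (Im w) * c"
      by (simp add: lattice_point_def add.assoc)
    then show ?thesis by (simp add: algebra_simps)
  qed
  show ?thesis
  proof (rule that[of "- c"], unfold cech_coboundaries1_torus, intro exI conjI ballI)
    \<comment> \<open>With lifts \<open>?v = ?u + lattice_point m n\<close> one has
      \<open>H y ?v = H y ?u + n * c\<close>, so the coboundary of \<open>?h\<close> exceeds
      \<open>f\<close> by \<open>n * c\<close>; hence the coefficient \<open>- c\<close>.\<close>
    let ?h = "\<lambda>(x, U :: complex set, p). H x (torus_chart x p)"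
    show "pointed_cover torus_topology (\<lambda>x. N x \<inter> torus_disc x)"
      by (rule pointed_cover_Int[OF N pointed_cover_torus_disc])
    show "(\<lambda>z. ?h (x, unit_square, torus_proj z)) holomorphic_on torus_proj -` (N x \<inter> torus_disc x)"
      if x: "x \<in> unit_square" for x
      unfolding prod.case
    proof (rule holomorphic_on_compose_gen[OF _ Hhol[OF x], unfolded o_def])
      show "(\<lambda>z. torus_chart x (torus_proj z)) holomorphic_on torus_proj -` (N x \<inter> torus_disc x)"
        by (rule holomorphic_on_subset[OF torus_chart_proj_holomorphic]) auto
    qed (auto simp: torus_proj_chart)
    fix x y p
    assume x: "x \<in> unit_square" and y: "y \<in> unit_square"
      and p: "p \<in> (N x \<inter> torus_disc x) \<inter> (N y \<inter> torus_disc y)"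
    let ?u = "torus_chart x p" and ?v = "torus_chart y p"
    have uv: "torus_proj ?u = p" "torus_proj ?v = p" using p torus_proj_chart by auto
    then obtain m n where mn: "?v = ?u + lattice_point m n" using torus_proj_eq_iff by metis
    then have "period_cocycle (x, y, unit_square, p) = of_int n"
      by (simp add: period_cocycle_def lattice_point_def)
    moreover have "H y ?v - of_int n * c = H y ?u" unfolding mn using shift[OF y] p uv by simp
    moreover have "f (x, y, unit_square, p) = H y ?u - H x ?u"
      using Hdiff[OF x y, of ?u] p uv by simp
    ultimately show "f (x, y, unit_square, p) - - c * period_cocycle (x, y, unit_square, p) =
        ?h (y, unit_square, p) - ?h (x, unit_square, p)"
      by (simp add: algebra_simps)
  qed
qed

text \<open>If \<open>c\<close> times the cocycle bounds \<open>h\<close>, the functions \<open>h\<^sub>x\<close> corrected by the lattice shifts glue to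
  an entire function \<open>G\<close> with \<open>G(z + 1) = G(z)\<close> and \<open>G(z + \<i>) = G(z) + c\<close>; its derivative is
  constant by Liouville's theorem, so \<open>c = 0\<close>.\<close>

lemma period_cocycle_nontrivial:
  assumes "(\<lambda>q. c * period_cocycle q) \<in>
    cech_coboundaries1 torus_topology torus_atlas {unit_square} (\<lambda>_ _ _. 1)"
  shows "c = 0"
proof -
  obtain N h where N: "pointed_cover torus_topology N"
    and h: "\<And>x. x \<in> unit_square \<Longrightarrow> (\<lambda>z. h (x, unit_square, torus_proj z)) holomorphic_on torus_proj -` N x"
    and eq: "\<And>x y p. x \<in> unit_square \<Longrightarrow> y \<in> unit_square \<Longrightarrow> p \<in> N x \<inter> N y \<Longrightarrow>
      c * period_cocycle (x, y, unit_square, p) = h (y, unit_square, p) - h (x, unit_square, p)"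
    using assms unfolding cech_coboundaries1_torus by blast
  define F where "F x z = h (x, unit_square, torus_proj z) - c * of_real (Im (lattice_shift x z))" for x z
  define G where "G z = F (torus_proj z) z" for z
  have in_N: "torus_proj z \<in> N (torus_proj z)" for z
    using N torus_proj_in by (auto simp: pointed_cover_def topspace_torus)
  have F_eq: "F y z = F x z" if "x \<in> unit_square" "y \<in> unit_square" "torus_proj z \<in> N x" "torus_proj z \<in> N y" for x y z
    using eq[of x y "torus_proj z"] that by (simp add: F_def period_cocycle_proj algebra_simps)
  have G: "G holomorphic_on UNIV"
  proof (rule holomorphic_on_if_differentiable_at)
    fix z0
    let ?x = "torus_proj z0"
    let ?S = "torus_proj -` N ?x \<inter> torus_proj -` torus_disc ?x"
    have "open ?S"
      using N openin_torus_disc[of ?x] torus_proj_in[of z0]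
      by (auto simp: pointed_cover_def topspace_torus openin_torus)
    moreover have "z0 \<in> ?S" using in_N centre_in_torus_disc torus_proj_in by auto
    moreover have "F ?x holomorphic_on ?S"
      unfolding F_def
      by (intro holomorphic_on_diff holomorphic_on_mult holomorphic_on_const
          holomorphic_on_subset[OF h[OF torus_proj_in]] holomorphic_on_subset[OF lattice_shift_holomorphic]) auto
    then have "G holomorphic_on ?S"
      by (rule holomorphic_transform) (use F_eq in_N torus_proj_in in \<open>auto simp: G_def\<close>)
    ultimately show "G field_differentiable at z0" using holomorphic_on_imp_differentiable_at by blast
  qed
  have G1: "G (z + 1) = G z" and Gi: "G (z + \<i>) = G z + c" for z
    unfolding G_def F_def lattice_shift_def torus_proj_1 torus_proj_i by (simp_all add: algebra_simps)
  have dG: "(G has_field_derivative deriv G z) (at z)" for z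
    using G by (auto intro: holomorphic_derivI)
  have "deriv G (z + 1) = deriv G z" for z
  proof -
    have "((\<lambda>w. G (w + 1)) has_field_derivative deriv G (z + 1)) (at z)"
      using dG[of "z + 1"] by (simp add: DERIV_shift)
    then show ?thesis unfolding G1 using dG DERIV_unique by blast
  qed
  moreover have "deriv G (z + \<i>) = deriv G z" for z
  proof -
    have "((\<lambda>w. G (w + \<i>)) has_field_derivative deriv G (z + \<i>)) (at z)"
      using dG[of "z + \<i>"] by (simp add: DERIV_shift)
    moreover have "((\<lambda>w. G w + c) has_field_derivative deriv G z) (at z)"
      using dG by (auto intro!: derivative_eq_intros)
    ultimately show ?thesis unfolding Gi using DERIV_unique by blast
  qed
  moreover have "deriv G holomorphic_on UNIV" using G by (intro holomorphic_deriv) auto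
  ultimately obtain a where a: "\<And>z. deriv G z = a" using doubly_periodic_entire_constant by metis
  have "\<exists>b. \<forall>z. G z - a * z = b"
  proof -
    have "((\<lambda>z. G z - a * z) has_field_derivative 0) (at z)" for z
      using dG[of z] a by (auto intro!: derivative_eq_intros)
    then show ?thesis using has_field_derivative_zero_constant[of UNIV "\<lambda>z. G z - a * z"] by auto
  qed
  then obtain b where b: "\<And>z. G z = a * z + b" by (metis diff_eq_eq add.commute)
  \<comment> \<open>An affine function of period 1 is constant, and then its increment
    \<open>c\<close> along \<open>\<i>\<close> vanishes.\<close>
  have "a = 0" using G1[of 0] b[of 0] b[of 1] by simp
  then show "c = 0" using Gi[of 0] b[of 0] b[of "\<i>"] by simp
qed

lemma lessThan_1_nat: "{..<1 :: nat} = {0}"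
  by auto

lemma has_genus_torus: "has_genus torus_topology torus_atlas 1"
  unfolding has_genus_def has_h1_def has_quotient_dim_def topspace_torus
proof (intro exI[of _ "\<lambda>_. period_cocycle"] conjI allI impI ballI)
  fix f assume "f \<in> cech_cocycles1 torus_topology torus_atlas {unit_square} (\<lambda>_ _ _. 1)"
  then obtain c where "(\<lambda>q. f q - c * period_cocycle q) \<in>
      cech_coboundaries1 torus_topology torus_atlas {unit_square} (\<lambda>_ _ _. 1)"
    by (rule torus_cocycle_reduction)
  then show "\<exists>c :: nat \<Rightarrow> complex. (\<lambda>q. f q - (\<Sum>i<1. c i * period_cocycle q)) \<in>
      cech_coboundaries1 torus_topology torus_atlas {unit_square} (\<lambda>_ _ _. 1)"
    by (intro exI[of _ "\<lambda>_. c"]) (simp add: lessThan_1_nat del: One_nat_def)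
qed (use period_cocycle_in period_cocycle_nontrivial in \<open>auto simp: lessThan_1_nat simp del: One_nat_def\<close>)

lemma has_h0_torus: "has_h0 torus_topology torus_atlas {unit_square} (\<lambda>_ _ _. 1) 1"
  unfolding has_h0_def has_quotient_dim_def topspace_torus
proof (intro exI[of _ "\<lambda>_ _. 1"] conjI allI impI ballI)
  have op: "openin torus_topology unit_square" by (metis openin_topspace topspace_torus)
  show "(\<lambda>_. 1) \<in> {s. holomorphic_section torus_atlas {unit_square} (\<lambda>_ _ _. 1) unit_square s}"
    by (simp add: holomorphic_section_torus[OF op])
  fix s assume "s \<in> {s. holomorphic_section torus_atlas {unit_square} (\<lambda>_ _ _. 1) unit_square s}"
  then have "(\<lambda>z. s (unit_square, torus_proj z)) holomorphic_on torus_proj -` unit_square"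
    by (simp add: holomorphic_section_torus[OF op])
  moreover have "torus_proj -` unit_square = UNIV" using torus_proj_in by auto
  ultimately obtain c where c: "\<And>z. s (unit_square, torus_proj z) = c"
    using doubly_periodic_entire_constant[of "\<lambda>z. s (unit_square, torus_proj z)"] torus_proj_1 torus_proj_i
    by auto
  have "s (unit_square, p) = c" if "p \<in> unit_square" for p using c[of p] torus_proj_id[OF that] by simp
  then show "\<exists>c :: nat \<Rightarrow> complex. (\<lambda>x. s x - (\<Sum>i<1. c i * 1)) \<in> {s. \<forall>U\<in>{unit_square}. \<forall>p\<in>U. s (U, p) = 0}"
    by (intro exI[of _ "\<lambda>_. c"]) (simp add: lessThan_1_nat del: One_nat_def)
next
  fix c :: "nat \<Rightarrow> complex" and i :: nat
  assume "(\<lambda>x. \<Sum>i<1. c i * 1) \<in> {s. \<forall>U\<in>{unit_square}. \<forall>p\<in>U. s (U, p) = 0}" "i < 1"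
  then show "c i = 0" using torus_proj_in[of 0] by (auto simp: lessThan_1_nat simp del: One_nat_def)
qed

lemma line_bundle_torus: "line_bundle torus_topology torus_atlas {unit_square} (\<lambda>_ _ _. 1)"
proof -
  have op: "openin torus_topology unit_square" by (metis openin_topspace topspace_torus)
  show ?thesis by (simp add: line_bundle_def op topspace_torus holomorphic_fun_torus)
qed

text \<open>For the trivial bundle on the torus, the constants give h^0 = 1 and the genus gives h^1
  = 1, so the Euler characteristic is 0.\<close>

lemma one_in_h1_values: "1 \<in> h1_values 1 0"
proof -
  have "has_h1 torus_topology torus_atlas {unit_square} (\<lambda>_ _ _. 1) 1"
    using has_genus_torus by (simp add: has_genus_def topspace_torus)
  moreover have "int 1 - int 1 = int 0" by simp
  ultimately show ?thesis
    unfolding h1_values_def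
    using compact_riemann_surface_torus has_genus_torus line_bundle_torus has_h0_torus by blast
qed

section \<open>Line bundles over a surface of genus one\<close>

locale riemann_surface =
  fixes X :: "'a topology" and A :: "'a atlas"
  assumes surface: "compact_riemann_surface X A"
begin

lemma chart:
  assumes "(C, \<phi>) \<in> A"
  shows "openin X C" "open (\<phi> ` C)" "homeomorphic_map (subtopology X C) (top_of_set (\<phi> ` C)) \<phi>"
  using surface assms unfolding compact_riemann_surface_def by blast+

lemma topspace_subtopology_chart: "(C, \<phi>) \<in> A \<Longrightarrow> topspace (subtopology X C) = C"
  using chart(1) openin_subset by fastforce

lemma chart_exists: "p \<in> topspace X \<Longrightarrow> \<exists>C \<phi>. (C, \<phi>) \<in> A \<and> p \<in> C"
  using surface unfolding compact_riemann_surface_def by blast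

lemma inj_on_chart: "(C, \<phi>) \<in> A \<Longrightarrow> inj_on \<phi> C"
  using homeomorphic_imp_injective_map[OF chart(3)] topspace_subtopology_chart by metis

lemma open_chart_image:
  assumes "(C, \<phi>) \<in> A" "openin X W"
  shows "open (\<phi> ` (C \<inter> W))"
proof -
  have "openin (subtopology X C) (C \<inter> W)" using assms(2) by (simp add: openin_subtopology_Int2)
  then have "openin (top_of_set (\<phi> ` C)) (\<phi> ` (C \<inter> W))"
    using homeomorphic_imp_open_map[OF chart(3)[OF assms(1)]] by (simp add: open_map_def)
  then show ?thesis using chart(2)[OF assms(1)] by (metis openin_open_eq)
qed

lemma openin_chart_preimage:
  assumes "(C, \<phi>) \<in> A" "open V"
  shows "openin X {p \<in> C. \<phi> p \<in> V}"
proof -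
  have "continuous_map (subtopology X C) euclidean \<phi>"
    using homeomorphic_imp_continuous_map[OF chart(3)[OF assms(1)]] by (simp add: continuous_map_in_subtopology)
  then have "openin (subtopology X C) {p \<in> topspace (subtopology X C). \<phi> p \<in> V}"
    using assms(2) by (intro openin_continuous_map_preimage) auto
  then have "openin (subtopology X C) {p \<in> C. \<phi> p \<in> V}"
    unfolding topspace_subtopology_chart[OF assms(1)] .
  then show ?thesis using openin_trans_full chart(1)[OF assms(1)] by blast
qed

lemma holomorphic_fun_subset: "holomorphic_fun A W f \<Longrightarrow> W' \<subseteq> W \<Longrightarrow> holomorphic_fun A W' f"
  unfolding holomorphic_fun_def by (force elim: holomorphic_on_subset)

lemma inv_into_chart_in:
  "(C, \<phi>) \<in> A \<Longrightarrow> u \<in> \<phi> ` (C \<inter> W) \<Longrightarrow> inv_into C \<phi> u \<in> W"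
  using inj_on_chart[of C \<phi>] by auto

lemma holomorphic_fun_cong:
  assumes "holomorphic_fun A W f" "\<And>p. p \<in> W \<Longrightarrow> f p = g p"
  shows "holomorphic_fun A W g"
  unfolding holomorphic_fun_def
proof (clarify)
  fix C \<phi> assume C: "(C, \<phi>) \<in> A"
  have "(f \<circ> inv_into C \<phi>) holomorphic_on \<phi> ` (C \<inter> W)"
    using assms(1) C by (auto simp: holomorphic_fun_def)
  then show "(g \<circ> inv_into C \<phi>) holomorphic_on \<phi> ` (C \<inter> W)"
    by (rule holomorphic_transform) (use inv_into_chart_in[OF C] assms(2) in \<open>simp add: o_def\<close>)
qed

lemma holomorphic_fun_const: "holomorphic_fun A W (\<lambda>_. c)"
  by (auto simp: holomorphic_fun_def o_def)

lemma holomorphic_fun_mult: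
  assumes "holomorphic_fun A W f" "holomorphic_fun A W g"
  shows "holomorphic_fun A W (\<lambda>p. f p * g p)"
  using assms by (auto simp: holomorphic_fun_def o_def intro!: holomorphic_on_mult)

lemma holomorphic_fun_add:
  assumes "holomorphic_fun A W f" "holomorphic_fun A W g"
  shows "holomorphic_fun A W (\<lambda>p. f p + g p)"
  using assms by (auto simp: holomorphic_fun_def o_def intro!: holomorphic_on_add)

lemma holomorphic_fun_divide:
  assumes "holomorphic_fun A W f" "holomorphic_fun A W g" "\<And>p. p \<in> W \<Longrightarrow> g p \<noteq> 0"
  shows "holomorphic_fun A W (\<lambda>p. f p / g p)"
  unfolding holomorphic_fun_def
proof (clarify)
  fix C \<phi> assume C: "(C, \<phi>) \<in> A"
  have "(f \<circ> inv_into C \<phi>) holomorphic_on \<phi> ` (C \<inter> W)" "(g \<circ> inv_into C \<phi>) holomorphic_on \<phi> ` (C \<inter> W)"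
    using assms C by (auto simp: holomorphic_fun_def)
  moreover have "(g \<circ> inv_into C \<phi>) u \<noteq> 0" if "u \<in> \<phi> ` (C \<inter> W)" for u
    using inv_into_chart_in[OF C that] assms(3) by simp
  ultimately show "((\<lambda>p. f p / g p) \<circ> inv_into C \<phi>) holomorphic_on \<phi> ` (C \<inter> W)"
    using holomorphic_on_divide by (fastforce simp: o_def)
qed

lemma holomorphic_fun_local:
  assumes W: "openin X W"
    and nearby: "\<And>q. q \<in> W \<Longrightarrow> \<exists>W'. openin X W' \<and> q \<in> W' \<and> holomorphic_fun A (W' \<inter> W) f"
  shows "holomorphic_fun A W f"
  unfolding holomorphic_fun_def
proof (clarify)
  fix C \<phi> assume C: "(C, \<phi>) \<in> A"
  show "(f \<circ> inv_into C \<phi>) holomorphic_on \<phi> ` (C \<inter> W)"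
  proof (rule holomorphic_on_if_differentiable_at)
    fix u assume "u \<in> \<phi> ` (C \<inter> W)"
    then obtain q where q: "u = \<phi> q" "q \<in> C" "q \<in> W" by auto
    obtain W' where W': "openin X W'" "q \<in> W'" "holomorphic_fun A (W' \<inter> W) f" using nearby[OF q(3)] by blast
    have "(f \<circ> inv_into C \<phi>) holomorphic_on \<phi> ` (C \<inter> (W' \<inter> W))"
      using W'(3) C by (auto simp: holomorphic_fun_def)
    moreover have "open (\<phi> ` (C \<inter> (W' \<inter> W)))" using W W' by (intro open_chart_image[OF C]) auto
    moreover have "u \<in> \<phi> ` (C \<inter> (W' \<inter> W))" using q W' by auto
    ultimately show "(f \<circ> inv_into C \<phi>) field_differentiable at u"
      by (rule holomorphic_on_imp_differentiable_at)
  qed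
qed

end

section \<open>Line bundles and the zeros of their sections\<close>

locale holomorphic_line_bundle = riemann_surface +
  fixes \<V> :: "'a set set" and t :: "'a transition"
  assumes is_line_bundle: "line_bundle X A \<V> t"
begin

lemma transition_nonzero: "U \<in> \<V> \<Longrightarrow> V \<in> \<V> \<Longrightarrow> p \<in> U \<Longrightarrow> p \<in> V \<Longrightarrow> t U V p \<noteq> 0"
  using is_line_bundle by (auto simp: line_bundle_def)

lemma trivialisation_exists: "p \<in> topspace X \<Longrightarrow> \<exists>U\<in>\<V>. p \<in> U"
  using is_line_bundle by (auto simp: line_bundle_def)

lemma openin_trivialisation: "U \<in> \<V> \<Longrightarrow> openin X U"
  using is_line_bundle by (auto simp: line_bundle_def)

lemma section_transition:
  "holomorphic_section A \<V> t W s \<Longrightarrow> U \<in> \<V> \<Longrightarrow> V \<in> \<V> \<Longrightarrow> p \<in> U \<Longrightarrow> p \<in> V \<Longrightarrow> p \<in> W \<Longrightarrow>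
    s (U, p) = t U V p * s (V, p)"
  unfolding holomorphic_section_def by blast

lemma section_holomorphic:
  "holomorphic_section A \<V> t W s \<Longrightarrow> U \<in> \<V> \<Longrightarrow> holomorphic_fun A (U \<inter> W) (\<lambda>p. s (U, p))"
  unfolding holomorphic_section_def by blast

lemma section_subset:
  "holomorphic_section A \<V> t W s \<Longrightarrow> W' \<subseteq> W \<Longrightarrow> holomorphic_section A \<V> t W' s"
  unfolding holomorphic_section_def
  by (meson holomorphic_fun_subset IntE IntI inf_mono order_refl subsetD)

lemma section_zero_iff:
  assumes "holomorphic_section A \<V> t W s" "U \<in> \<V>" "V \<in> \<V>" "p \<in> U" "p \<in> V" "p \<in> W"
  shows "s (U, p) = 0 \<longleftrightarrow> s (V, p) = 0"
  using section_transition[OF assms] transition_nonzero assms by auto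

definition zeros :: "('a set \<times> 'a \<Rightarrow> complex) \<Rightarrow> 'a set" where
  "zeros s = {p. \<exists>U\<in>\<V>. p \<in> U \<and> s (U, p) = 0}"

text \<open>The identity theorem in a chart disc: the coordinate function of the section vanishes
  identically, or is nonzero at the centre, or has an isolated zero there. Transition functions do
  not vanish, so the zeros are the same in every trivialisation.\<close>

lemma zeros_alternative:
  assumes s: "holomorphic_section A \<V> t (topspace X) s" and p: "p \<in> topspace X"
  shows "\<exists>P. openin X P \<and> p \<in> P \<and> (P \<subseteq> zeros s \<or> (P - {p}) \<inter> zeros s = {})"
proof -
  obtain U where U: "U \<in> \<V>" "p \<in> U" using trivialisation_exists[OF p] by blast
  obtain C \<phi> where C: "(C, \<phi>) \<in> A" "p \<in> C" using chart_exists[OF p] by blast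
  have UX: "U \<subseteq> topspace X" using openin_trivialisation[OF U(1)] openin_subset by blast
  define f where "f u = s (U, inv_into C \<phi> u)" for u
  have "holomorphic_fun A U (\<lambda>p. s (U, p))"
    using section_holomorphic[OF s U(1)] UX by (simp add: Int_absorb2)
  then have hol: "f holomorphic_on \<phi> ` (C \<inter> U)"
    using C(1) unfolding holomorphic_fun_def f_def o_def by fast
  have "open (\<phi> ` (C \<inter> U))" using open_chart_image[OF C(1) openin_trivialisation[OF U(1)]] .
  then obtain r where r: "0 < r" "ball (\<phi> p) r \<subseteq> \<phi> ` (C \<inter> U)"
    using U C open_contains_ball by (metis IntI imageI)
  have holr: "f holomorphic_on ball (\<phi> p) r" using hol r(2) by (rule holomorphic_on_subset)
  have q: "q \<in> U \<and> f (\<phi> q) = s (U, q)" if "q \<in> C" "\<phi> q \<in> ball (\<phi> p) r" for q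
  proof -
    have "\<phi> q \<in> \<phi> ` (C \<inter> U)" using that r by blast
    then have "q \<in> U" using inj_on_chart[OF C(1)] that(1) by (auto dest: inj_onD)
    then show ?thesis using inj_on_chart[OF C(1)] that(1) by (simp add: f_def)
  qed
  have zero: "q \<in> zeros s \<longleftrightarrow> f (\<phi> q) = 0" if "q \<in> C" "\<phi> q \<in> ball (\<phi> p) r" for q
  proof -
    have "q \<in> U" "f (\<phi> q) = s (U, q)" using q[OF that] by auto
    moreover have "s (V, q) = 0 \<longleftrightarrow> s (U, q) = 0" if "V \<in> \<V>" "q \<in> V" for V
      using section_zero_iff[OF s that(1) U(1) that(2)] \<open>q \<in> U\<close> UX by blast
    ultimately show ?thesis using U(1) unfolding zeros_def mem_Collect_eq by metis
  qed
  consider "\<forall>u\<in>ball (\<phi> p) r. f u = 0" | "f (\<phi> p) \<noteq> 0" | v where "f (\<phi> p) = 0" "v \<in> ball (\<phi> p) r" "f v \<noteq> 0"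
    by blast
  then show ?thesis
  proof cases
    case 1
    show ?thesis
      using openin_chart_preimage[OF C(1) open_ball, of "\<phi> p" r] 1 zero C r
      by (intro exI[of _ "{q \<in> C. \<phi> q \<in> ball (\<phi> p) r}"]) auto
  next
    case 2
    have "open (ball (\<phi> p) r \<inter> f -` (- {0}))"
      using holomorphic_on_imp_continuous_on[OF holr] by (rule continuous_open_preimage) auto
    from openin_chart_preimage[OF C(1) this] show ?thesis
      using 2 zero C r
      by (intro exI[of _ "{q \<in> C. \<phi> q \<in> ball (\<phi> p) r \<inter> f -` (- {0})}"]) auto
  next
    case 3
    obtain e where e: "0 < e" "ball (\<phi> p) e \<subseteq> ball (\<phi> p) r" "\<And>z. z \<in> ball (\<phi> p) e - {\<phi> p} \<Longrightarrow> f z \<noteq> 0"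
      using isolated_zeros[OF holr open_ball connected_ball _ 3(1) 3(2,3)] r(1) by (metis centre_in_ball)
    have "q \<notin> zeros s" if "q \<in> C" "\<phi> q \<in> ball (\<phi> p) e" "q \<noteq> p" for q
    proof -
      have "\<phi> q \<noteq> \<phi> p" using inj_on_chart[OF C(1)] that C(2) by (auto dest: inj_onD)
      then show ?thesis using zero[of q] e that by blast
    qed
    then show ?thesis
      using openin_chart_preimage[OF C(1) open_ball, of "\<phi> p" e] C e(1)
      by (intro exI[of _ "{q \<in> C. \<phi> q \<in> ball (\<phi> p) e}"]) auto
  qed
qed

text \<open>By the local alternative the interior of the zero set is closed as well as open. It
  misses \<open>p0\<close>, so connectedness makes it empty.\<close>

lemma zeros_isolated:
  assumes s: "holomorphic_section A \<V> t (topspace X) s"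
    and nz: "U0 \<in> \<V>" "p0 \<in> U0" "s (U0, p0) \<noteq> 0" and p: "p \<in> topspace X"
  shows "\<exists>P. openin X P \<and> p \<in> P \<and> (P - {p}) \<inter> zeros s = {}"
proof -
  let ?I = "{p. \<exists>P. openin X P \<and> p \<in> P \<and> P \<subseteq> zeros s}"
  have I: "openin X ?I"
    by (subst openin_subopen) (blast intro: openin_subset)
  have nI: "openin X (topspace X - ?I)"
  proof (subst openin_subopen, intro ballI)
    fix q assume q: "q \<in> topspace X - ?I"
    then obtain P where P: "openin X P" "q \<in> P" "(P - {q}) \<inter> zeros s = {}"
      using zeros_alternative[OF s, of q] by blast
    have "P \<subseteq> topspace X - ?I"
      using P q openin_subset[OF P(1)] by blast
    then show "\<exists>T. openin X T \<and> q \<in> T \<and> T \<subseteq> topspace X - ?I" using P by blast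
  qed
  have p0: "p0 \<in> topspace X" using nz openin_trivialisation openin_subset by blast
  have "p0 \<notin> zeros s"
  proof
    assume "p0 \<in> zeros s"
    then obtain U where "U \<in> \<V>" "p0 \<in> U" "s (U, p0) = 0" by (auto simp: zeros_def)
    then show False using section_zero_iff[OF s nz(1) _ nz(2) _ p0] nz(3) by blast
  qed
  then have "p0 \<in> topspace X - ?I" using p0 by auto
  moreover have "connected_space X" using surface by (simp add: compact_riemann_surface_def)
  ultimately have "?I = {}"
    using I nI openin_subset[OF I] unfolding connected_space_def
    by (metis (no_types, lifting) Diff_disjoint Diff_partition empty_iff order_refl)
  then show ?thesis using zeros_alternative[OF s p] by blast
qed

section \<open>Multiplication by a section on Cech cohomology\<close>

abbreviation structure_cocycles :: "('a \<times> 'a \<times> 'a set \<times> 'a \<Rightarrow> complex) set" where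
  "structure_cocycles \<equiv> cech_cocycles1 X A {topspace X} (\<lambda>_ _ _. 1)"

abbreviation structure_coboundaries :: "('a \<times> 'a \<times> 'a set \<times> 'a \<Rightarrow> complex) set" where
  "structure_coboundaries \<equiv> cech_coboundaries1 X A {topspace X} (\<lambda>_ _ _. 1)"

text \<open>The map on cochains induced by the sheaf map from functions to sections that sends 1 to
  \<open>s\<close>. Its argument is read at the single trivialising set \<open>topspace X\<close> of
  the product bundle.\<close>

definition section_times ::
    "('a set \<times> 'a \<Rightarrow> complex) \<Rightarrow> ('a \<times> 'a \<times> 'a set \<times> 'a \<Rightarrow> complex) \<Rightarrow> 'a \<times> 'a \<times> 'a set \<times> 'a \<Rightarrow> complex" where
  "section_times s f = (\<lambda>(x, y, U, p). f (x, y, topspace X, p) * s (U, p))"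

lemma section_scale_add:
  assumes "holomorphic_section A \<V> t W s" "holomorphic_section A \<V> t W s'"
  shows "holomorphic_section A \<V> t W (\<lambda>q. a * s q + b * s' q)"
  unfolding holomorphic_section_def
proof (intro conjI ballI)
  fix U assume U: "U \<in> \<V>"
  show "holomorphic_fun A (U \<inter> W) (\<lambda>p. a * s (U, p) + b * s' (U, p))"
    by (intro holomorphic_fun_add holomorphic_fun_mult holomorphic_fun_const
        section_holomorphic[OF assms(1) U] section_holomorphic[OF assms(2) U])
  fix V p assume "V \<in> \<V>" "p \<in> U \<inter> V \<inter> W"
  then have "s (U, p) = t U V p * s (V, p)" "s' (U, p) = t U V p * s' (V, p)"
    using section_transition[OF assms(1) U] section_transition[OF assms(2) U] by auto
  then show "a * s (U, p) + b * s' (U, p) = t U V p * (a * s (V, p) + b * s' (V, p))"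
    by (simp add: distrib_left mult.left_commute)
qed

text \<open>The two cochains may bound over different pointed covers; intersecting these pointwise
  gives a common refinement with the same indices.\<close>

lemma coboundaries_combination:
  assumes "f \<in> cech_coboundaries1 X A \<V> t" "f' \<in> cech_coboundaries1 X A \<V> t"
  shows "(\<lambda>q. a * f q + b * f' q) \<in> cech_coboundaries1 X A \<V> t"
proof -
  obtain N h where N: "pointed_cover X N"
     "\<forall>x\<in>topspace X. holomorphic_section A \<V> t (N x) (\<lambda>(U, p). h (x, U, p))"
     "\<forall>x\<in>topspace X. \<forall>y\<in>topspace X. \<forall>U\<in>\<V>. \<forall>p\<in>U \<inter> N x \<inter> N y. f (x, y, U, p) = h (y, U, p) - h (x, U, p)"
    using assms(1) unfolding cech_coboundaries1_def mem_Collect_eq by (elim exE conjE)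
  obtain N' h' where N': "pointed_cover X N'"
     "\<forall>x\<in>topspace X. holomorphic_section A \<V> t (N' x) (\<lambda>(U, p). h' (x, U, p))"
     "\<forall>x\<in>topspace X. \<forall>y\<in>topspace X. \<forall>U\<in>\<V>. \<forall>p\<in>U \<inter> N' x \<inter> N' y. f' (x, y, U, p) = h' (y, U, p) - h' (x, U, p)"
    using assms(2) unfolding cech_coboundaries1_def mem_Collect_eq by (elim exE conjE)
  show ?thesis unfolding cech_coboundaries1_def mem_Collect_eq
  proof (intro exI conjI ballI)
    show "pointed_cover X (\<lambda>x. N x \<inter> N' x)" using N(1) N'(1) by (rule pointed_cover_Int)
    fix x assume x: "x \<in> topspace X"
    have "holomorphic_section A \<V> t (N x \<inter> N' x) (\<lambda>(U, p). h (x, U, p))"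
      "holomorphic_section A \<V> t (N x \<inter> N' x) (\<lambda>(U, p). h' (x, U, p))"
      using N(2) N'(2) x section_subset by (meson Int_lower1 Int_lower2)+
    from section_scale_add[OF this]
    show "holomorphic_section A \<V> t (N x \<inter> N' x) (\<lambda>(U, p). (\<lambda>q. a * h q + b * h' q) (x, U, p))"
      by (simp add: case_prod_unfold)
  next
    fix x y U p assume "x \<in> topspace X" "y \<in> topspace X" "U \<in> \<V>" "p \<in> U \<inter> (N x \<inter> N' x) \<inter> (N y \<inter> N' y)"
    then have eq: "f (x, y, U, p) = h (y, U, p) - h (x, U, p)" "f' (x, y, U, p) = h' (y, U, p) - h' (x, U, p)"
      using N(3) N'(3) by auto
    show "a * f (x, y, U, p) + b * f' (x, y, U, p) =
        (\<lambda>q. a * h q + b * h' q) (y, U, p) - (\<lambda>q. a * h q + b * h' q) (x, U, p)"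
      unfolding eq by (simp add: algebra_simps)
  qed
qed

lemma section_times_coboundaries:
  assumes s: "holomorphic_section A \<V> t (topspace X) s" and f: "f \<in> structure_coboundaries"
  shows "section_times s f \<in> cech_coboundaries1 X A \<V> t"
proof -
  let ?T = "topspace X"
  obtain N h where N: "pointed_cover X N"
     "\<forall>x\<in>?T. holomorphic_section A {?T} (\<lambda>_ _ _. 1) (N x) (\<lambda>(U, p). h (x, U, p))"
     "\<forall>x\<in>?T. \<forall>y\<in>?T. \<forall>U\<in>{?T}. \<forall>p\<in>U \<inter> N x \<inter> N y. f (x, y, U, p) = h (y, U, p) - h (x, U, p)"
    using f unfolding cech_coboundaries1_def mem_Collect_eq by (elim exE conjE)
  show ?thesis unfolding cech_coboundaries1_def mem_Collect_eq
  proof (intro exI conjI ballI)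
    let ?h = "\<lambda>(x, U, p). h (x, ?T, p) * s (U, p)"
    show "pointed_cover X N" by fact
    show "holomorphic_section A \<V> t (N x) (\<lambda>(U, p). ?h (x, U, p))" if x: "x \<in> ?T" for x
      unfolding holomorphic_section_def
    proof (intro conjI ballI)
      have NX: "N x \<subseteq> ?T" using N(1) x openin_subset by (auto simp: pointed_cover_def)
      have h: "holomorphic_fun A (N x) (\<lambda>p. h (x, ?T, p))"
        using N(2)[rule_format, OF x] Int_absorb1[OF NX] by (simp add: holomorphic_section_def)
      fix U assume U: "U \<in> \<V>"
      have "holomorphic_fun A (U \<inter> N x) (\<lambda>p. s (U, p))"
        using section_holomorphic[OF s U] by (rule holomorphic_fun_subset) (use NX in auto)
      moreover have "holomorphic_fun A (U \<inter> N x) (\<lambda>p. h (x, ?T, p))"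
        using h by (rule holomorphic_fun_subset) auto
      ultimately show "holomorphic_fun A (U \<inter> N x) (\<lambda>p. case (U, p) of (U, p) \<Rightarrow> ?h (x, U, p))"
        using holomorphic_fun_mult by fastforce
      fix V p assume "V \<in> \<V>" "p \<in> U \<inter> V \<inter> N x"
      then have "s (U, p) = t U V p * s (V, p)" using section_transition[OF s U] NX by blast
      then show "(case (U, p) of (U, p) \<Rightarrow> ?h (x, U, p)) = t U V p * (case (V, p) of (U, p) \<Rightarrow> ?h (x, U, p))"
        by simp
    qed
    fix x y U p assume x: "x \<in> ?T" "y \<in> ?T" "U \<in> \<V>" "p \<in> U \<inter> N x \<inter> N y"
    then have "p \<in> ?T" using openin_trivialisation openin_subset by blast
    then have "f (x, y, ?T, p) = h (y, ?T, p) - h (x, ?T, p)" using N(3) x by simp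
    then show "section_times s f (x, y, U, p) = ?h (y, U, p) - ?h (x, U, p)"
      by (simp add: section_times_def left_diff_distrib)
  qed
qed

text \<open>Division by \<open>s\<close> is harmless on the cover obtained from a given one by removing from the
  neighbourhood of \<open>x\<close> all zeros of \<open>s\<close> other than \<open>x\<close>: a double intersection with \<open>x \<noteq> y\<close> then
  contains no zero, and the components with \<open>x = y\<close> of a cocycle vanish.\<close>

lemma section_times_surjective:
  assumes s: "holomorphic_section A \<V> t (topspace X) s"
    and nz: "U0 \<in> \<V>" "p0 \<in> U0" "s (U0, p0) \<noteq> 0"
    and F: "F \<in> cech_cocycles1 X A \<V> t"
  obtains f where "f \<in> structure_cocycles" "(\<lambda>q. F q - section_times s f q) \<in> cech_coboundaries1 X A \<V> t"
proof -
  let ?T = "topspace X"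
  obtain N where N: "pointed_cover X N"
    and hol': "\<forall>x\<in>?T. \<forall>y\<in>?T. holomorphic_section A \<V> t (N x \<inter> N y) (\<lambda>(U, p). F (x, y, U, p))"
    and coc': "\<forall>x\<in>?T. \<forall>y\<in>?T. \<forall>z\<in>?T. \<forall>U\<in>\<V>. \<forall>p\<in>U \<inter> N x \<inter> N y \<inter> N z.
        F (x, z, U, p) = F (x, y, U, p) + F (y, z, U, p)"
    using F unfolding cech_cocycles1_def mem_Collect_eq by (elim exE conjE)
  note hol = hol'[rule_format] and coc = coc'[rule_format]
  define N' where "N' x = N x \<inter> (?T - (zeros s - {x}))" for x
  have "openin X (?T - (zeros s - {x}))" for x
  proof (subst openin_subopen, intro ballI)
    fix q assume q: "q \<in> ?T - (zeros s - {x})"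
    then obtain P where P: "openin X P" "q \<in> P" "(P - {q}) \<inter> zeros s = {}"
      using zeros_isolated[OF s nz] by blast
    then show "\<exists>T. openin X T \<and> q \<in> T \<and> T \<subseteq> ?T - (zeros s - {x})"
      using q openin_subset[OF P(1)] by (intro exI[of _ P]) blast
  qed
  then have N': "pointed_cover X N'" using N by (auto simp: pointed_cover_def N'_def)
  have N'N: "N' x \<subseteq> N x" "N' x \<subseteq> ?T" for x by (auto simp: N'_def)
  have nonzero: "s (U, p) \<noteq> 0" if "U \<in> \<V>" "p \<in> U" "p \<in> N' x" "p \<in> N' y" "x \<noteq> y" for U p x y
    using that by (auto simp: N'_def zeros_def)
  have diag: "F (x, x, U, p) = 0" if "x \<in> ?T" "U \<in> \<V>" "p \<in> U" "p \<in> N x" for x U p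
    using coc[of x x x U p] that by simp
  define V where "V p = (SOME U. U \<in> \<V> \<and> p \<in> U)" for p
  have V: "V p \<in> \<V>" "p \<in> V p" if "p \<in> ?T" for p
    using someI_ex[of "\<lambda>U. U \<in> \<V> \<and> p \<in> U"] trivialisation_exists[OF that] unfolding V_def by blast+
  \<comment> \<open>A quotient of two sections is a function: the transition factors cancel, so any
    trivialisation \<open>V p\<close> around the point may be used.\<close>
  define f where "f = (\<lambda>(x, y, U :: 'a set, p). F (x, y, V p, p) / s (V p, p))"
  have f: "f (x, y, W, p) = F (x, y, U, p) / s (U, p)"
    if "x \<in> ?T" "y \<in> ?T" "p \<in> N' x" "p \<in> N' y" "U \<in> \<V>" "p \<in> U" for x y U W p
  proof -
    have p: "p \<in> ?T" "p \<in> N x" "p \<in> N y" using that N'N by auto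
    have "F (x, y, V p, p) = t (V p) U p * F (x, y, U, p)"
      using section_transition[OF hol[OF that(1,2)] V(1)[OF p(1)] that(5) V(2)[OF p(1)] that(6)] p by simp
    moreover have "s (V p, p) = t (V p) U p * s (U, p)"
      using section_transition[OF s V(1)[OF p(1)] that(5) V(2)[OF p(1)] that(6) p(1)] .
    moreover have "t (V p) U p \<noteq> 0" using transition_nonzero V[OF p(1)] that by blast
    ultimately show ?thesis by (simp add: f_def)
  qed
  show ?thesis
  proof (rule that[of f])
    show "f \<in> structure_cocycles"
      unfolding cech_cocycles1_def mem_Collect_eq
    proof (intro exI conjI ballI)
      show "pointed_cover X N'" by fact
      show "holomorphic_section A {?T} (\<lambda>_ _ _. 1) (N' x \<inter> N' y) (\<lambda>(U, p). f (x, y, U, p))"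
        if x: "x \<in> ?T" and y: "y \<in> ?T" for x y
      proof -
        have W: "openin X (N' x \<inter> N' y)" using N' x y by (auto simp: pointed_cover_def)
        have "holomorphic_fun A (N' x \<inter> N' y) (\<lambda>p. f (x, y, ?T, p))"
        proof (rule holomorphic_fun_local[OF W])
          fix q assume q: "q \<in> N' x \<inter> N' y"
          then have qT: "q \<in> ?T" using N'N by auto
          let ?W = "V q \<inter> (N' x \<inter> N' y)"
          have "holomorphic_fun A ?W (\<lambda>p. f (x, y, ?T, p))"
          proof (cases "x = y")
            \<comment> \<open>The neighbourhood of \<open>x\<close> may still contain a zero of
              \<open>s\<close>, namely \<open>x\<close>. No division problem arises, since the
              numerator \<open>F (x, x, _)\<close> is identically 0.\<close>
            case True
            show ?thesis
            proof (rule holomorphic_fun_cong[OF holomorphic_fun_const[of _ 0]])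
              fix p assume "p \<in> ?W"
              then show "0 = f (x, y, ?T, p)"
                using f[of x y p "V q" ?T] diag[of x "V q" p] V[OF qT] x y N'N True by auto
            qed
          next
            case False
            have "holomorphic_fun A ?W (\<lambda>p. F (x, y, V q, p))"
              using section_holomorphic[OF hol[OF x y] V(1)[OF qT]] N'N
              by (auto elim!: holomorphic_fun_subset)
            moreover have "holomorphic_fun A ?W (\<lambda>p. s (V q, p))"
              using section_holomorphic[OF s V(1)[OF qT]] by (rule holomorphic_fun_subset) (use N'N in auto)
            ultimately have "holomorphic_fun A ?W (\<lambda>p. F (x, y, V q, p) / s (V q, p))"
              by (rule holomorphic_fun_divide) (use nonzero[of "V q" _ x y] V(1)[OF qT] False in auto)
            then show ?thesis
              by (rule holomorphic_fun_cong) (use f[of x y _ "V q"] V(1)[OF qT] x y in auto)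
          qed
          then show "\<exists>W'. openin X W' \<and> q \<in> W' \<and> holomorphic_fun A (W' \<inter> (N' x \<inter> N' y)) (\<lambda>p. f (x, y, ?T, p))"
            using openin_trivialisation V[OF qT] by blast
        qed
        moreover have "?T \<inter> (N' x \<inter> N' y) = N' x \<inter> N' y" using N'N by auto
        ultimately show ?thesis by (simp add: holomorphic_section_def)
      qed
      fix x y z U p
      assume x: "x \<in> ?T" "y \<in> ?T" "z \<in> ?T" "U \<in> {?T}" "p \<in> U \<inter> N' x \<inter> N' y \<inter> N' z"
      then have "p \<in> ?T" "p \<in> V p \<inter> N x \<inter> N y \<inter> N z" "V p \<in> \<V>" using V[of p] N'N by auto
      then show "f (x, z, U, p) = f (x, y, U, p) + f (y, z, U, p)"
        using coc[OF x(1-3), of "V p" p] by (simp add: f_def add_divide_distrib)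
    qed
    show "(\<lambda>q. F q - section_times s f q) \<in> cech_coboundaries1 X A \<V> t"
      unfolding cech_coboundaries1_def mem_Collect_eq
    proof (intro exI conjI ballI)
      show "pointed_cover X N'" by fact
      show "holomorphic_section A \<V> t (N' x) (\<lambda>(U, p). (\<lambda>_. 0) (x, U, p))" for x
        by (simp add: holomorphic_section_def holomorphic_fun_const)
      fix x y U p assume x: "x \<in> ?T" "y \<in> ?T" "U \<in> \<V>" "p \<in> U \<inter> N' x \<inter> N' y"
      then have fq: "f (x, y, ?T, p) = F (x, y, U, p) / s (U, p)" by (intro f) auto
      show "F (x, y, U, p) - section_times s f (x, y, U, p) = (\<lambda>_. 0) (y, U, p) - (\<lambda>_. 0) (x, U, p)"
        using fq nonzero[of U p x y] diag[of x U p] x N'N by (cases "x = y") (auto simp: section_times_def)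
    qed
  qed
qed

text \<open>Every class of the bundle is a multiple of the one class \<open>?M\<close>, the image of
  a generator of the cohomology of the structure sheaf. Two independent classes are therefore
  impossible.\<close>

lemma h1_le_1:
  assumes genus: "has_genus X A 1" and h0: "has_h0 X A \<V> t h0" "1 \<le> h0" and h1: "has_h1 X A \<V> t n"
  shows "n \<le> 1"
proof (rule ccontr)
  assume "\<not> n \<le> 1"
  then have n: "2 \<le> n" by simp
  let ?B = "cech_coboundaries1 X A \<V> t"
  obtain \<sigma> :: "nat \<Rightarrow> 'a set \<times> 'a \<Rightarrow> complex" where
    \<sigma>: "\<forall>i<h0. \<sigma> i \<in> {s. holomorphic_section A \<V> t (topspace X) s}"
    and \<sigma>_ind: "\<forall>c. (\<lambda>x. \<Sum>i<h0. c i * \<sigma> i x) \<in> {s. \<forall>U\<in>\<V>. \<forall>p\<in>U. s (U, p) = 0} \<longrightarrow> (\<forall>i<h0. c i = 0)"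
    using h0(1) unfolding has_h0_def has_quotient_dim_def by (elim exE conjE)
  have s: "holomorphic_section A \<V> t (topspace X) (\<sigma> 0)" using \<sigma> h0(2) by simp
  \<comment> \<open>A basis element vanishing everywhere would give a nontrivial relation, with the
    first unit vector as coefficients.\<close>
  obtain U0 p0 where nz: "U0 \<in> \<V>" "p0 \<in> U0" "\<sigma> 0 (U0, p0) \<noteq> 0"
  proof (rule ccontr)
    assume "\<not> thesis"
    then have z: "\<forall>U\<in>\<V>. \<forall>p\<in>U. \<sigma> 0 (U, p) = 0" using that by blast
    have "(\<Sum>i<h0. (if i = 0 then 1 else 0) * \<sigma> i x) = \<sigma> 0 x" for x
      using h0(2) by (simp add: if_distrib[of "\<lambda>a. a * _"] cong: if_cong)
    then show False using \<sigma>_ind[rule_format, of "\<lambda>i. if i = 0 then 1 else 0" 0] z h0(2) by auto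
  qed
  obtain b :: "nat \<Rightarrow> 'a \<times> 'a \<times> 'a set \<times> 'a \<Rightarrow> complex" where
    b: "\<forall>z\<in>structure_cocycles. \<exists>c. (\<lambda>x. z x - (\<Sum>i<1. c i * b i x)) \<in> structure_coboundaries"
    using genus unfolding has_genus_def has_h1_def has_quotient_dim_def by (elim exE conjE)
  obtain e :: "nat \<Rightarrow> 'a \<times> 'a \<times> 'a set \<times> 'a \<Rightarrow> complex" where
    e: "\<forall>i<n. e i \<in> cech_cocycles1 X A \<V> t"
    and e_ind: "\<forall>c. (\<lambda>x. \<Sum>i<n. c i * e i x) \<in> ?B \<longrightarrow> (\<forall>i<n. c i = 0)"
    using h1 unfolding has_h1_def has_quotient_dim_def by (elim exE conjE)
  let ?M = "section_times (\<sigma> 0) (b 0)"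
  have reduce: "\<exists>c. (\<lambda>q. F q - c * ?M q) \<in> ?B" if F: "F \<in> cech_cocycles1 X A \<V> t" for F
  proof -
    obtain f where f: "f \<in> structure_cocycles" "(\<lambda>q. F q - section_times (\<sigma> 0) f q) \<in> ?B"
      using section_times_surjective[OF s nz F] by blast
    obtain c :: "nat \<Rightarrow> complex" where "(\<lambda>x. f x - (\<Sum>i<1. c i * b i x)) \<in> structure_coboundaries"
      using b[rule_format, OF f(1)] by (elim exE)
    then have "(\<lambda>x. f x - c 0 * b 0 x) \<in> structure_coboundaries" by simp
    from section_times_coboundaries[OF s this] coboundaries_combination[OF f(2), of _ 1 1]
    have "(\<lambda>q. 1 * (F q - section_times (\<sigma> 0) f q) + 1 * section_times (\<sigma> 0) (\<lambda>x. f x - c 0 * b 0 x) q) \<in> ?B"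
      by blast
    also have "(\<lambda>q. 1 * (F q - section_times (\<sigma> 0) f q) + 1 * section_times (\<sigma> 0) (\<lambda>x. f x - c 0 * b 0 x) q) =
        (\<lambda>q. F q - c 0 * ?M q)"
      by (rule ext) (simp add: section_times_def case_prod_unfold algebra_simps)
    finally show ?thesis ..
  qed
  obtain c0 c1 where c0: "(\<lambda>q. e 0 q - c0 * ?M q) \<in> ?B" and c1: "(\<lambda>q. e 1 q - c1 * ?M q) \<in> ?B"
    using reduce[OF e[rule_format, of 0]] reduce[OF e[rule_format, of 1]] n by auto
  have two: "a = 0 \<and> a' = 0" if B: "(\<lambda>q. a * e 0 q + a' * e 1 q) \<in> ?B" for a a'
  proof -
    let ?c = "\<lambda>i :: nat. if i = 0 then a else if i = 1 then a' else 0"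
    have "(\<Sum>i<n. ?c i * e i q) = (\<Sum>i\<in>{0, 1}. ?c i * e i q)" for q
      using n by (intro sum.mono_neutral_right) auto
    then have "(\<Sum>i<n. ?c i * e i q) = a * e 0 q + a' * e 1 q" for q by simp
    then have "\<forall>i<n. ?c i = 0" using e_ind[rule_format, of ?c] B by simp
    then have "?c 0 = 0" "?c 1 = 0" using n by (metis less_le_trans pos2 one_less_numeral_iff semiring_norm(76))+
    then show ?thesis by simp
  qed
  \<comment> \<open>Eliminating \<open>?M\<close>: independence forces both coefficients to vanish,
    and then \<open>e 0\<close> itself is a coboundary.\<close>
  have "(\<lambda>q. c1 * (e 0 q - c0 * ?M q) + (- c0) * (e 1 q - c1 * ?M q)) \<in> ?B"
    by (rule coboundaries_combination[OF c0 c1])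
  then have "(\<lambda>q. c1 * e 0 q + (- c0) * e 1 q) \<in> ?B" by (simp add: algebra_simps)
  then have "c1 = 0" "c0 = 0" using two by fastforce+
  then have "(\<lambda>q. 1 * e 0 q + 0 * e 1 q) \<in> ?B" using c0 by simp
  then show False using two by fastforce
qed

end

text \<open>Euler characteristic 0 turns a positive h^1 into a positive h^0, and thus into the
  section needed for \<open>h1_le_1\<close>.\<close>

lemma h1_values_1_0_subset: "h1_values 1 0 \<subseteq> {0, 1}"
proof
  fix n assume "n \<in> h1_values 1 0"
  then obtain X :: "complex topology" and A \<V> t h0 where
    h: "compact_riemann_surface X A" "has_genus X A 1" "line_bundle X A \<V> t"
      "has_h0 X A \<V> t h0" "has_h1 X A \<V> t n" "int h0 - int n = int 0"
    unfolding h1_values_def by blast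
  interpret holomorphic_line_bundle X A \<V> t by unfold_locales (use h in auto)
  have "n \<le> 1" if "1 \<le> n" using h1_le_1[OF h(2,4) _ h(5)] h(6) that by simp
  then show "n \<in> {0, 1}" by (cases n) auto
qed

text \<open>The preceding bound makes the set finite, so that its \<open>Max\<close> dominates the
  value attained by the torus.\<close>

lemma max_h1_1_0: "1 \<le> max_h1 1 0"
proof -
  have "finite (h1_values 1 0)" using h1_values_1_0_subset by (rule finite_subset) simp
  then show ?thesis unfolding max_h1_def using one_in_h1_values by (rule Max_ge)
qed

section \<open>Lattice cohomology in degree zero\<close>

definition intersection :: "'v::{finite,linorder} plumbing \<Rightarrow> 'v \<Rightarrow> 'v \<Rightarrow> rat" where
  "intersection \<Gamma> i j = (if i = j then of_int (euler \<Gamma> i) else of_nat (edges \<Gamma> i j))"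

lemma form_eq: "form \<Gamma> x y = (\<Sum>i\<in>UNIV. \<Sum>j\<in>UNIV. x i * y j * intersection \<Gamma> i j)"
  by (simp add: form_def intersection_def)

lemma form_add_left: "form \<Gamma> (\<lambda>i. x i + y i) z = form \<Gamma> x z + form \<Gamma> y z"
  by (simp add: form_eq sum.distrib distrib_right)

lemma form_add_right: "form \<Gamma> x (\<lambda>i. y i + z i) = form \<Gamma> x y + form \<Gamma> x z"
  by (simp add: form_eq sum.distrib distrib_left distrib_right)

lemma form_scale: "form \<Gamma> (\<lambda>i. c * x i) (\<lambda>i. c * y i) = c^2 * form \<Gamma> x y"
  by (simp add: form_eq sum_distrib_left power2_eq_square mult_ac)

lemma form_base_right: "form \<Gamma> x (emb (base j)) = (\<Sum>i\<in>UNIV. x i * intersection \<Gamma> i j)"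
  by (simp add: form_eq emb_def base_def if_distrib[of of_int] if_distrib[of "\<lambda>a. _ * a * _"] cong: if_cong)

lemma form_sum_right: "form \<Gamma> x y = (\<Sum>j\<in>UNIV. y j * form \<Gamma> x (emb (base j)))"
  unfolding form_eq[of _ _ y] form_base_right
  by (subst sum.swap) (simp add: sum_distrib_left mult_ac)

lemma form_emb_Ints: "form \<Gamma> (emb a) (emb b) \<in> \<int>"
  unfolding form_eq emb_def intersection_def by (intro Ints_sum Ints_mult Ints_of_int) auto

locale negative_definite_plumbing =
  fixes \<Gamma> :: "'v::{finite,linorder} plumbing"
  assumes graph: "plumbing_graph \<Gamma>" and negative: "negative_definite \<Gamma>"
begin

lemma intersection_commute: "intersection \<Gamma> i j = intersection \<Gamma> j i"
  using graph by (simp add: intersection_def plumbing_graph_def)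

lemma form_commute: "form \<Gamma> x y = form \<Gamma> y x"
  unfolding form_eq by (subst sum.swap) (simp add: intersection_commute mult_ac)

text \<open>Definiteness is given on integral vectors only; scaling transfers it to rational ones,
  among which \<open>canonical \<Gamma>\<close> has to be found.\<close>

lemma clear_denominators:
  fixes x :: "'v \<Rightarrow> rat"
  obtains d :: int and l where "d \<noteq> 0" "emb l = (\<lambda>i. of_int d * x i)"
proof -
  have "\<exists>a b :: int. b \<noteq> 0 \<and> of_int b * x i = of_int a" for i
  proof -
    obtain a b :: int where "0 < b" "x i = Fract a b" by (cases "x i") auto
    then show ?thesis by (intro exI[of _ a] exI[of _ b]) (simp add: Fract_of_int_quotient)
  qed
  then obtain a b :: "'v \<Rightarrow> int" where ab: "\<And>i. b i \<noteq> 0" "\<And>i. of_int (b i) * x i = of_int (a i)" by metis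
  define d where "d = (\<Prod>i\<in>UNIV. b i)"
  have "of_int d * x i = of_int ((\<Prod>j\<in>UNIV - {i}. b j) * a i)" for i
  proof -
    have "d = (\<Prod>j\<in>UNIV - {i}. b j) * b i" unfolding d_def by (subst prod.remove[of _ i]) (auto simp: mult.commute)
    then show ?thesis using ab(2)[of i] by (simp add: mult.assoc)
  qed
  moreover have "d \<noteq> 0" using ab(1) by (simp add: d_def)
  ultimately show ?thesis using that[of d "\<lambda>i. (\<Prod>j\<in>UNIV - {i}. b j) * a i"] by (simp add: emb_def)
qed

lemma form_nondegenerate:
  assumes "\<And>j. form \<Gamma> x (emb (base j)) = 0"
  shows "x = (\<lambda>_. 0)"
proof -
  obtain d l where d: "d \<noteq> 0" "emb l = (\<lambda>i. of_int d * x i)" by (rule clear_denominators)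
  have "form \<Gamma> x x = 0" using form_sum_right[of \<Gamma> x x] assms by simp
  then have "form \<Gamma> (emb l) (emb l) = 0" unfolding d(2) form_scale by simp
  then have "l = (\<lambda>_. 0)" using negative unfolding negative_definite_def by fastforce
  then have "of_int d * x i = 0" for i using fun_cong[OF d(2), of i] by (simp add: emb_def)
  then show ?thesis using d(1) by auto
qed

text \<open>A nondegenerate square matrix is invertible. This supplies the existence behind the
  definite description of \<open>canonical\<close>.\<close>

lemma form_solvable: "\<exists>x. \<forall>j. form \<Gamma> x (emb (base j)) = b j"
proof -
  define M :: "((rat, 'v) vec, 'v) vec" where "M = (\<chi> j i. intersection \<Gamma> i j)"
  have M: "(M *v x) $ j = form \<Gamma> (\<lambda>i. x $ i) (emb (base j))" for x j
    by (simp add: M_def matrix_vector_mult_def form_base_right mult.commute)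
  have "inj ((*v) M)"
  proof (rule injI)
    fix x y assume "M *v x = M *v y"
    then have "M *v (x - y) = 0" by (simp add: matrix_vector_mult_diff_distrib)
    then have "(\<lambda>i. (x - y) $ i) = (\<lambda>_. 0)" using M[of "x - y"] by (intro form_nondegenerate) simp
    then show "x = y" by (simp add: vec_eq_iff fun_eq_iff)
  qed
  then obtain B where "B ** M = mat 1" using matrix_left_invertible_injective by blast
  then have "M ** B = mat 1" using matrix_left_right_inverse by blast
  then have eq: "M *v (B *v c) = c" for c by (simp only: matrix_vector_mul_assoc matrix_vector_mul_lid)
  have "form \<Gamma> (\<lambda>i. (B *v (\<chi> j. b j)) $ i) (emb (base j)) = b j" for j
    unfolding M[symmetric] eq by simp
  then show ?thesis by (intro exI allI)
qed

lemma dual_lattice_iff: "x \<in> dual_lattice \<Gamma> \<longleftrightarrow> (\<forall>j. form \<Gamma> x (emb (base j)) \<in> \<int>)"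
proof
  assume *: "\<forall>j. form \<Gamma> x (emb (base j)) \<in> \<int>"
  have "form \<Gamma> x (emb l) \<in> \<int>" for l
    unfolding form_sum_right[of \<Gamma> x "emb l"] using * by (auto intro!: Ints_sum Ints_mult simp: emb_def)
  then show "x \<in> dual_lattice \<Gamma>" by (simp add: dual_lattice_def)
qed (simp add: dual_lattice_def)

lemma canonical:
  "canonical \<Gamma> \<in> dual_lattice \<Gamma>"
  "form \<Gamma> (canonical \<Gamma>) (emb (base j)) = of_int (- euler \<Gamma> j - 2 + 2 * int (genus \<Gamma> j))"
proof -
  let ?P = "\<lambda>k. k \<in> dual_lattice \<Gamma> \<and>
     (\<forall>j. form \<Gamma> k (emb (base j)) = of_int (- euler \<Gamma> j - 2 + 2 * int (genus \<Gamma> j)))"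
  obtain k where k: "\<forall>j. form \<Gamma> k (emb (base j)) = of_int (- euler \<Gamma> j - 2 + 2 * int (genus \<Gamma> j))"
    using form_solvable[of "\<lambda>j. of_int (- euler \<Gamma> j - 2 + 2 * int (genus \<Gamma> j))"] by blast
  have "?P (canonical \<Gamma>)" unfolding canonical_def
  proof (rule theI[of ?P])
    show "?P k" using k Ints_of_int unfolding dual_lattice_iff by metis
    fix k' assume k': "?P k'"
    have "form \<Gamma> (\<lambda>i. k' i - k i) (emb (base j)) = 0" for j
      using form_add_left[of \<Gamma> "\<lambda>i. k' i - k i" k "emb (base j)"] k k' by simp
    from form_nondegenerate[OF this] show "k' = k" by (simp add: fun_eq_iff)
  qed
  then show "canonical \<Gamma> \<in> dual_lattice \<Gamma>"
    "form \<Gamma> (canonical \<Gamma>) (emb (base j)) = of_int (- euler \<Gamma> j - 2 + 2 * int (genus \<Gamma> j))" by blast+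
qed

abbreviation chi_K :: "('v \<Rightarrow> int) \<Rightarrow> rat" where "chi_K \<equiv> chi \<Gamma> (canonical \<Gamma>)"

abbreviation w0 :: "('v \<Rightarrow> int) \<Rightarrow> int" where "w0 \<equiv> weight0 \<Gamma> (canonical \<Gamma>)"

abbreviation w1 :: "('v \<Rightarrow> int) \<Rightarrow> 'v \<Rightarrow> int" where "w1 \<equiv> weight1 \<Gamma> (canonical \<Gamma>)"

lemma emb_add: "emb (\<lambda>i. a i + b i) = (\<lambda>i. emb a i + emb b i)"
  by (simp add: emb_def)

lemma chi_add: "chi_K (\<lambda>i. a i + b i) = chi_K a + chi_K b - form \<Gamma> (emb a) (emb b)"
proof -
  have "form \<Gamma> (emb b) (emb a) = form \<Gamma> (emb a) (emb b)" by (rule form_commute)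
  then show ?thesis
    unfolding chi_def emb_add form_add_left form_add_right by (simp add: field_simps)
qed

lemma chi_zero: "chi_K (\<lambda>_. 0) = 0"
  by (simp add: chi_def form_def emb_def)

text \<open>The adjunction formula: the Euler number cancels between (E_j, E_j) and (K,
  E_j).\<close>

lemma chi_base: "chi_K (base j) = 1 - of_nat (genus \<Gamma> j)"
proof -
  have "form \<Gamma> (emb (base j)) (emb (base j)) = intersection \<Gamma> j j"
    unfolding form_base_right
    by (simp add: emb_def base_def if_distrib[of of_int] if_distrib[of "\<lambda>a. a * _"] cong: if_cong)
  then show ?thesis
    using canonical(2)[of j] form_commute[of "emb (base j)" "canonical \<Gamma>"]
    by (simp add: chi_def form_add_right intersection_def field_simps)
qed

text \<open>Values in a discrete set are what lets the minimum in the definition of rationality be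
  attained.\<close>

lemma two_chi_Ints: "2 * chi_K l \<in> \<int>"
proof -
  have "form \<Gamma> (emb l) (canonical \<Gamma>) \<in> \<int>"
    using canonical(1) form_commute by (simp add: dual_lattice_def)
  then have "- (form \<Gamma> (emb l) (emb l) + form \<Gamma> (emb l) (canonical \<Gamma>)) \<in> \<int>"
    using form_emb_Ints by (intro Ints_minus Ints_add)
  moreover have "2 * chi_K l = - (form \<Gamma> (emb l) (emb l) + form \<Gamma> (emb l) (canonical \<Gamma>))"
    by (simp add: chi_def form_add_right)
  ultimately show ?thesis by simp
qed

text \<open>The positive and the negative part have disjoint supports. Their intersection number
  therefore involves only edge numbers, with coefficients at most 0.\<close>

lemma chi_positive_negative_part:
  "chi_K (\<lambda>i. max (l i) 0) + chi_K (\<lambda>i. min (l i) 0) \<le> chi_K l"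
proof -
  have "form \<Gamma> (emb (\<lambda>i. max (l i) 0)) (emb (\<lambda>i. min (l i) 0)) \<le> 0"
    unfolding form_eq
  proof (intro sum_nonpos)
    fix i j
    show "emb (\<lambda>i. max (l i) 0) i * emb (\<lambda>i. min (l i) 0) j * intersection \<Gamma> i j \<le> 0"
    proof (cases "i = j")
      case True
      then show ?thesis by (auto simp: emb_def max_def min_def)
    next
      case False
      have "emb (\<lambda>i. max (l i) 0) i * emb (\<lambda>i. min (l i) 0) j \<le> 0"
        by (rule mult_nonneg_nonpos) (auto simp: emb_def)
      then show ?thesis by (rule mult_nonpos_nonneg) (use False in \<open>simp add: intersection_def\<close>)
    qed
  qed
  moreover have "(\<lambda>i. max (l i) 0 + min (l i) 0) = l" by (auto simp: max_def min_def)
  ultimately show ?thesis using chi_add[of "\<lambda>i. max (l i) 0" "\<lambda>i. min (l i) 0"] by simp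
qed

lemma weight1_ge: "w0 l \<le> w1 l j" "w0 (translate l {j}) \<le> w1 l j"
  by (auto simp: weight1_def Let_def)

lemma weight_vertex: "weight \<Gamma> (canonical \<Gamma>) (l, {}) = w0 l"
  by (simp add: weight_def)

lemma weight_edge: "weight \<Gamma> (canonical \<Gamma>) (l, {j}) = w1 l j"
proof -
  have "{w1 (translate l I') j' | I' j'. j' \<in> {j} \<and> I' \<subseteq> {j} - {j'}} = {w1 l j}"
    by (auto simp: translate_def)
  then show ?thesis by (simp add: weight_def)
qed

section \<open>Cocycles of degree zero\<close>

lemma cocycles_0_iff:
  "\<phi> \<in> cocycles \<Gamma> (canonical \<Gamma>) 0 \<longleftrightarrow> \<phi> \<in> cochains 0 \<and>
    (\<forall>l j. poly_shift (nat (w1 l j - w0 (translate l {j}))) (\<phi> (translate l {j}, {})) =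
      poly_shift (nat (w1 l j - w0 l)) (\<phi> (l, {})))"
proof (cases "\<phi> \<in> cochains 0")
  case True
  have edge: "delta \<Gamma> (canonical \<Gamma>) \<phi> (l, {j}) =
      poly_shift (nat (w1 l j - w0 (translate l {j}))) (\<phi> (translate l {j}, {})) -
      poly_shift (nat (w1 l j - w0 l)) (\<phi> (l, {}))" for l j
    by (simp add: delta_def weight_edge weight_vertex Let_def cong: conj_cong)
  have other: "delta \<Gamma> (canonical \<Gamma>) \<phi> (l, I) = 0" if "\<not> (\<exists>j. I = {j})" for l I
  proof -
    have "I - {i} \<noteq> {}" if "i \<in> I" for i using that \<open>\<not> (\<exists>j. I = {j})\<close> by blast
    then have "\<phi> (l', I - {i}) = 0" if "i \<in> I" for i l'
      using True that by (auto simp: cochains_def card_eq_0_iff)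
    then show ?thesis by (simp add: delta_def Let_def)
  qed
  have "delta \<Gamma> (canonical \<Gamma>) \<phi> = (\<lambda>_. 0) \<longleftrightarrow> (\<forall>l j. delta \<Gamma> (canonical \<Gamma>) \<phi> (l, {j}) = 0)"
  proof
    assume *: "\<forall>l j. delta \<Gamma> (canonical \<Gamma>) \<phi> (l, {j}) = 0"
    show "delta \<Gamma> (canonical \<Gamma>) \<phi> = (\<lambda>_. 0)"
    proof
      fix c :: "'v cube"
      obtain l I where c: "c = (l, I)" by (cases c)
      show "delta \<Gamma> (canonical \<Gamma>) \<phi> c = 0"
        using * other[of I l] unfolding c by (cases "\<exists>j. I = {j}") auto
    qed
  qed simp
  then show ?thesis using True by (simp add: cocycles_def edge)
qed (simp add: cocycles_def)

lemma poly_shift_smult: "poly_shift n (smult a p) = smult a (poly_shift n p)"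
  by (rule poly_eqI) (simp add: coeff_poly_shift)

lemma poly_shift_add: "poly_shift n (p + q) = poly_shift n p + poly_shift n (q :: int poly)"
  by (rule poly_eqI) (simp add: coeff_poly_shift)

lemma cocycles_combination:
  assumes "\<phi> \<in> cocycles \<Gamma> (canonical \<Gamma>) 0" "\<psi> \<in> cocycles \<Gamma> (canonical \<Gamma>) 0"
  shows "(\<lambda>c. smult a (\<phi> c) + smult b (\<psi> c)) \<in> cocycles \<Gamma> (canonical \<Gamma>) 0"
  using assms unfolding cocycles_0_iff by (simp add: cochains_def poly_shift_smult poly_shift_add)

text \<open>Homogeneity in degree \<open>2 * n\<close> forces the exponent \<open>n - w0 l\<close>
  at the vertex \<open>l\<close>, so the only freedom is the choice of integer coefficients on the
  sublevel set; here they are 0 or 1.\<close>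

definition indicator_cochain :: "int \<Rightarrow> (('v \<Rightarrow> int) \<Rightarrow> bool) \<Rightarrow> 'v cube \<Rightarrow> tower" where
  "indicator_cochain n P = (\<lambda>(l, I). if I = {} \<and> w0 l \<le> n \<and> P l then monom 1 (nat (n - w0 l)) else 0)"

lemma indicator_cochain_homogeneous:
  "cochain_homogeneous \<Gamma> (canonical \<Gamma>) (2 * n) (indicator_cochain n P)"
  by (auto simp: cochain_homogeneous_def indicator_cochain_def tower_homogeneous_def weight_vertex split: if_splits)

text \<open>Across an edge of weight above \<open>n\<close> the powers of \<open>U\<close> kill both
  end values. Across any other edge both are shifted to the same monomial, and only membership in
  \<open>P\<close> is compared.\<close>

lemma indicator_cochain_cocycle:
  assumes "\<And>l j. w1 l j \<le> n \<Longrightarrow> P (translate l {j}) \<longleftrightarrow> P l"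
  shows "indicator_cochain n P \<in> cocycles \<Gamma> (canonical \<Gamma>) 0"
  unfolding cocycles_0_iff
proof (intro conjI allI)
  show "indicator_cochain n P \<in> cochains 0" by (auto simp: cochains_def indicator_cochain_def)
  fix l j
  have shift: "poly_shift (nat (w1 l j - w0 m)) (indicator_cochain n P (m, {})) =
      (if w1 l j \<le> n \<and> P m then monom 1 (nat (n - w1 l j)) else 0)" if "w0 m \<le> w1 l j" for m
    using that by (auto simp: indicator_cochain_def poly_shift_monom nat_diff_distrib[symmetric] intro!: arg_cong[of _ _ "monom 1"])
  show "poly_shift (nat (w1 l j - w0 (translate l {j}))) (indicator_cochain n P (translate l {j}, {})) =
      poly_shift (nat (w1 l j - w0 l)) (indicator_cochain n P (l, {}))"
    unfolding shift[OF weight1_ge(1)] shift[OF weight1_ge(2)] using assms[of l j] by auto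
qed

end

section \<open>Consequences of the isomorphism with the tower\<close>

locale rational_criterion = negative_definite_plumbing +
  assumes tower: "lattice_cohomology_iso_tower \<Gamma> (canonical \<Gamma>) 0"
begin

text \<open>As there are no coboundaries in degree \<open>0\<close>, the isomorphism gives a map on cocycles.\<close>

lemma cocycle_iso:
  obtains G where
    "\<And>\<phi> n. \<phi> \<in> cocycles \<Gamma> (canonical \<Gamma>) 0 \<Longrightarrow> cochain_homogeneous \<Gamma> (canonical \<Gamma>) n \<phi> \<Longrightarrow> tower_homogeneous n (G \<phi>)"
    "\<And>\<phi>. \<phi> \<in> cocycles \<Gamma> (canonical \<Gamma>) 0 \<Longrightarrow> G \<phi> = 0 \<Longrightarrow> \<phi> = (\<lambda>_. 0)"
    "\<And>\<phi> \<psi> a b. \<phi> \<in> cocycles \<Gamma> (canonical \<Gamma>) 0 \<Longrightarrow> \<psi> \<in> cocycles \<Gamma> (canonical \<Gamma>) 0 \<Longrightarrow>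
      G (\<lambda>c. smult a (\<phi> c) + smult b (\<psi> c)) = smult a (G \<phi>) + smult b (G \<psi>)"
proof -
  let ?Z = "cocycles \<Gamma> (canonical \<Gamma>) 0"
  let ?cl = "cohomology_class \<Gamma> (canonical \<Gamma>) 0"
  obtain F where bij: "bij_betw F (lattice_cohomology \<Gamma> (canonical \<Gamma>) 0) UNIV"
    and add: "\<forall>\<phi>\<in>?Z. \<forall>\<psi>\<in>?Z. F (?cl (\<lambda>c. \<phi> c + \<psi> c)) = F (?cl \<phi>) + F (?cl \<psi>)"
    and "\<forall>\<phi>\<in>?Z. F (?cl (\<lambda>c. poly_shift 1 (\<phi> c))) = poly_shift 1 (F (?cl \<phi>))"
    and deg: "\<forall>n. F ` lattice_cohomology_degree \<Gamma> (canonical \<Gamma>) 0 n = {x. tower_homogeneous n x}"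
    using tower unfolding lattice_cohomology_iso_tower_def by (elim exE conjE)
  have zero: "(\<lambda>_. 0) \<in> ?Z" by (simp add: cocycles_0_iff cochains_def)
  have neg: "(\<lambda>c. - \<phi> c) \<in> ?Z" if "\<phi> \<in> ?Z" for \<phi>
    using cocycles_combination[OF that zero, of "- 1" 0] by simp
  have G0: "F (?cl (\<lambda>_. 0)) = 0" using add[rule_format, OF zero zero] by simp
  have Gneg: "F (?cl (\<lambda>c. - \<phi> c)) = - F (?cl \<phi>)" if "\<phi> \<in> ?Z" for \<phi>
    using add[rule_format, OF that neg[OF that]] G0 by (simp add: eq_neg_iff_add_eq_0 add.commute)
  have smult_Z: "(\<lambda>c. smult a (\<phi> c)) \<in> ?Z" if "\<phi> \<in> ?Z" for a \<phi>
    using cocycles_combination[OF that zero, of a 0] by simp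
  \<comment> \<open>Compatibility with integer scalars is recovered from additivity, for natural
    numbers by induction and then for negative ones.\<close>
  have Gnat: "F (?cl (\<lambda>c. smult (int m) (\<phi> c))) = smult (int m) (F (?cl \<phi>))" if "\<phi> \<in> ?Z" for m \<phi>
  proof (induction m)
    case (Suc m)
    have "(\<lambda>c. smult (int (Suc m)) (\<phi> c)) = (\<lambda>c. smult (int m) (\<phi> c) + \<phi> c)"
      by (simp add: smult_add_left add.commute)
    then show ?case using add[rule_format, OF smult_Z[OF that, of "int m"] that] Suc
      by (simp add: smult_add_left add.commute)
  qed (simp add: G0)
  have Gsmult: "F (?cl (\<lambda>c. smult a (\<phi> c))) = smult a (F (?cl \<phi>))" if "\<phi> \<in> ?Z" for a \<phi>
  proof (cases "0 \<le> a")
    case True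
    then show ?thesis using Gnat[OF that, of "nat a"] by simp
  next
    case False
    then show ?thesis using Gnat[OF neg[OF that], of "nat (- a)"] Gneg[OF that] by simp
  qed
  show ?thesis
  proof (rule that[of "\<lambda>\<phi>. F (?cl \<phi>)"])
    fix \<phi> \<psi> a b assume \<phi>: "\<phi> \<in> ?Z" and \<psi>: "\<psi> \<in> ?Z"
    show "F (?cl (\<lambda>c. smult a (\<phi> c) + smult b (\<psi> c))) = smult a (F (?cl \<phi>)) + smult b (F (?cl \<psi>))"
      using add[rule_format, OF smult_Z[OF \<phi>] smult_Z[OF \<psi>]] Gsmult[OF \<phi>] Gsmult[OF \<psi>] by simp
  next
    fix \<phi> n assume "\<phi> \<in> ?Z" "cochain_homogeneous \<Gamma> (canonical \<Gamma>) n \<phi>"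
    then have "?cl \<phi> \<in> lattice_cohomology_degree \<Gamma> (canonical \<Gamma>) 0 n"
      by (auto simp: lattice_cohomology_degree_def)
    then show "tower_homogeneous n (F (?cl \<phi>))" using deg by blast
  next
    fix \<phi> assume \<phi>: "\<phi> \<in> ?Z" "F (?cl \<phi>) = 0"
    then have "?cl \<phi> = ?cl (\<lambda>_. 0)"
      using zero G0 unfolding lattice_cohomology_def
      by (intro inj_onD[OF bij_betw_imp_inj_on[OF bij, unfolded lattice_cohomology_def]]) simp_all
    moreover have "\<phi> \<in> ?cl \<phi>" using \<phi> by (simp add: cohomology_class_def coboundaries_def)
    ultimately show "\<phi> = (\<lambda>_. 0)" by (simp add: cohomology_class_def coboundaries_def)
  qed
qed

text \<open>The tower is zero in negative degrees, whereas a vertex of negative weight would support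
  a nonzero cocycle of twice that degree.\<close>

lemma weight0_nonneg: "0 \<le> w0 l"
proof (rule ccontr)
  assume neg: "\<not> 0 \<le> w0 l"
  obtain G where G: "\<And>\<phi> n. \<phi> \<in> cocycles \<Gamma> (canonical \<Gamma>) 0 \<Longrightarrow> cochain_homogeneous \<Gamma> (canonical \<Gamma>) n \<phi> \<Longrightarrow> tower_homogeneous n (G \<phi>)"
    "\<And>\<phi>. \<phi> \<in> cocycles \<Gamma> (canonical \<Gamma>) 0 \<Longrightarrow> G \<phi> = 0 \<Longrightarrow> \<phi> = (\<lambda>_. 0)"
    "\<And>\<phi> \<psi> a b. \<phi> \<in> cocycles \<Gamma> (canonical \<Gamma>) 0 \<Longrightarrow> \<psi> \<in> cocycles \<Gamma> (canonical \<Gamma>) 0 \<Longrightarrow>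
      G (\<lambda>c. smult a (\<phi> c) + smult b (\<psi> c)) = smult a (G \<phi>) + smult b (G \<psi>)"
    by (rule cocycle_iso) (rule that)
  let ?\<phi> = "indicator_cochain (w0 l) (\<lambda>_. True)"
  have \<phi>: "?\<phi> \<in> cocycles \<Gamma> (canonical \<Gamma>) 0" by (rule indicator_cochain_cocycle) simp
  have "tower_homogeneous (2 * w0 l) (G ?\<phi>)" by (rule G(1)[OF \<phi> indicator_cochain_homogeneous])
  then have "coeff (G ?\<phi>) d = 0" for d using neg by (force simp: tower_homogeneous_def)
  then have "G ?\<phi> = 0" by (simp add: poly_eq_iff)
  then have "?\<phi> (l, {}) = 0" using G(2)[OF \<phi>] by simp
  then show False by (simp add: indicator_cochain_def)
qed

lemma chi_nonneg: "0 \<le> chi_K l"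
  using weight0_nonneg[of l] by (simp add: weight0_def)

text \<open>The edges of weight \<open>0\<close> do not leave the negative orthant: the positive part of the other end
  of such an edge would be some \<open>E\<^sub>j\<close> with \<open>\<chi>\<^sub>K(E\<^sub>j) = 0\<close>, hence \<open>g\<^sub>j = 1\<close>, and then the edge
  has positive weight because \<open>M\<^sup>1(0) > 0\<close>.\<close>

lemma nonpos_edge_invariant:
  assumes w: "w1 l j \<le> 0"
  shows "(\<forall>i. translate l {j} i \<le> 0) \<longleftrightarrow> (\<forall>i. l i \<le> 0)"
proof
  assume l: "\<forall>i. l i \<le> 0"
  have w0: "w0 l = 0" "w0 (translate l {j}) = 0"
    using weight1_ge[of l j] weight0_nonneg[of l] weight0_nonneg[of "translate l {j}"] w by linarith+
  show "\<forall>i. translate l {j} i \<le> 0"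
  proof (rule ccontr)
    assume "\<not> (\<forall>i. translate l {j} i \<le> 0)"
    then obtain i where i: "0 < translate l {j} i" by (auto simp: not_le)
    then have "i = j" using l[rule_format, of i] by (simp add: translate_def split: if_splits)
    then have "l j = 0" using i l[rule_format, of j] by (simp add: translate_def)
    then have "(\<lambda>i. max (translate l {j} i) 0) = base j"
      using l by (auto simp: translate_def base_def fun_eq_iff)
    then have "chi_K (base j) \<le> chi_K (translate l {j})"
      using chi_positive_negative_part[of "translate l {j}"] chi_nonneg[of "\<lambda>i. min (translate l {j} i) 0"] by simp
    \<comment> \<open>\<open>w0\<close> is a floor, so weight 0 gives only a value below 1; since
      \<chi>(E_j) = 1 - g_j is an integer in [0, 1), the genus is 1.\<close>
    moreover have "chi_K (translate l {j}) < 1" using w0(2) unfolding weight0_def by linarith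
    moreover have "0 \<le> chi_K (base j)" by (rule chi_nonneg)
    ultimately have "genus \<Gamma> j = 1" unfolding chi_base by simp
    then have "w1 l j = int (max_h1 1 0)" by (simp add: weight1_def w0)
    then show False using w max_h1_1_0 by simp
  qed
next
  assume "\<forall>i. translate l {j} i \<le> 0"
  moreover have "l i \<le> translate l {j} i" for i by (simp add: translate_def)
  ultimately show "\<forall>i. l i \<le> 0" by (meson order_trans)
qed

text \<open>At a counterexample \<open>l\<close> the indicators of the nonpositive orthant and of
  its complement are independent cocycles of degree 0: the first is nonzero at the origin, the
  second at \<open>l\<close>. The tower has only the constants in this degree.\<close>

lemma chi_pos:
  assumes l: "\<And>j. 0 \<le> l j" "l \<noteq> (\<lambda>_. 0)"
  shows "0 < chi_K l"
proof (rule ccontr)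
  assume "\<not> 0 < chi_K l"
  then have "chi_K l = 0" using chi_nonneg[of l] by simp
  then have w0l: "w0 l = 0" by (simp add: weight0_def)
  have w00: "w0 (\<lambda>_. 0) = 0" by (simp add: weight0_def chi_zero)
  let ?P = "\<lambda>l :: 'v \<Rightarrow> int. \<forall>i. l i \<le> 0"
  let ?\<phi> = "indicator_cochain 0 ?P" and ?\<psi> = "indicator_cochain 0 (\<lambda>l. \<not> ?P l)"
  obtain G where G: "\<And>\<phi> n. \<phi> \<in> cocycles \<Gamma> (canonical \<Gamma>) 0 \<Longrightarrow> cochain_homogeneous \<Gamma> (canonical \<Gamma>) n \<phi> \<Longrightarrow> tower_homogeneous n (G \<phi>)"
    "\<And>\<phi>. \<phi> \<in> cocycles \<Gamma> (canonical \<Gamma>) 0 \<Longrightarrow> G \<phi> = 0 \<Longrightarrow> \<phi> = (\<lambda>_. 0)"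
    "\<And>\<phi> \<psi> a b. \<phi> \<in> cocycles \<Gamma> (canonical \<Gamma>) 0 \<Longrightarrow> \<psi> \<in> cocycles \<Gamma> (canonical \<Gamma>) 0 \<Longrightarrow>
      G (\<lambda>c. smult a (\<phi> c) + smult b (\<psi> c)) = smult a (G \<phi>) + smult b (G \<psi>)"
    by (rule cocycle_iso) (rule that)
  have \<phi>: "?\<phi> \<in> cocycles \<Gamma> (canonical \<Gamma>) 0" and \<psi>: "?\<psi> \<in> cocycles \<Gamma> (canonical \<Gamma>) 0"
    by (rule indicator_cochain_cocycle; simp add: nonpos_edge_invariant)+
  have const: "\<exists>a. x = [:a:]" if "tower_homogeneous (2 * 0) x" for x
  proof (intro exI poly_eqI)
    fix d show "coeff x d = coeff [:coeff x 0:] d"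
      using that by (cases d) (auto simp: tower_homogeneous_def)
  qed
  obtain a b where a: "G ?\<phi> = [:a:]" and b: "G ?\<psi> = [:b:]"
    using const G(1)[OF \<phi> indicator_cochain_homogeneous] G(1)[OF \<psi> indicator_cochain_homogeneous] by blast
  \<comment> \<open>The relation between the images \<open>a\<close> and \<open>b\<close>. Its value
    at \<open>l\<close> is \<open>- a\<close>, so \<open>a = 0\<close>; then \<open>?\<phi>\<close>
    vanishes, against its value 1 at the origin.\<close>
  let ?\<theta> = "\<lambda>c. smult b (?\<phi> c) + smult (- a) (?\<psi> c)"
  have "G ?\<theta> = 0" unfolding G(3)[OF \<phi> \<psi>] a b by simp
  then have \<theta>: "?\<theta> = (\<lambda>_. 0)" by (rule G(2)[OF cocycles_combination[OF \<phi> \<psi>]])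
  have "\<not> ?P l" using l by (meson antisym ext)
  then have "?\<phi> (l, {}) = 0" "?\<psi> (l, {}) = 1" by (auto simp: indicator_cochain_def w0l)
  then have "a = 0" using fun_cong[OF \<theta>, of "(l, {})"] by simp
  then have "?\<phi> ((\<lambda>_. 0), {}) = 0" using G(2)[OF \<phi>] a by simp
  then show False by (simp add: indicator_cochain_def w00)
qed

text \<open>On nonzero effective cycles, twice \<chi> takes positive integer values, so a minimum
  exists by well-ordering and is positive.\<close>

lemma rational_graph: "rational_graph \<Gamma>"
proof -
  let ?S = "{l :: 'v \<Rightarrow> int. (\<forall>j. 0 \<le> l j) \<and> l \<noteq> (\<lambda>_. 0)}"
  have "\<exists>n. 2 * chi_K l = of_int n" for l using two_chi_Ints[of l] by (auto elim: Ints_cases)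
  then obtain f where f: "\<And>l. 2 * chi_K l = of_int (f l)" by metis
  have pos: "0 < chi_K l" if "l \<in> ?S" for l using that by (intro chi_pos) auto
  have "(\<lambda>_. 1) \<in> ?S" by (auto simp: fun_eq_iff)
  from ex_has_least_nat[of "\<lambda>l. l \<in> ?S", OF this, of "\<lambda>l. nat (f l)"]
  obtain m where m: "m \<in> ?S" "\<forall>l. l \<in> ?S \<longrightarrow> nat (f m) \<le> nat (f l)" by (elim exE conjE)
  have "chi_K m \<le> chi_K l" if l: "l \<in> ?S" for l
  proof -
    have f_pos: "0 < f l" if "l \<in> ?S" for l
    proof -
      have "(0 :: rat) < of_int (f l)" using pos[OF that] unfolding f[symmetric] by simp
      then show ?thesis by simp
    qed
    have "f m \<le> f l" using m(2)[rule_format, OF l] f_pos[OF l] f_pos[OF m(1)] by linarith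
    then have "(of_int (f m) :: rat) \<le> of_int (f l)" by simp
    then show ?thesis using f[of l] f[of m] by simp
  qed
  then show ?thesis unfolding rational_graph_def Let_def using m(1) pos by blast
qed

end

theorem proposition4p1p3:
  fixes \<Gamma> :: "'v::{finite,linorder} plumbing"
  assumes "plumbing_graph \<Gamma>"
    and "connected_plumbing \<Gamma>"
    and "negative_definite \<Gamma>"
    and "lattice_cohomology_iso_tower \<Gamma> (canonical \<Gamma>) 0"
  shows "rational_graph \<Gamma>"
proof -
  interpret rational_criterion \<Gamma> by unfold_locales (use assms in auto)
  show ?thesis by (rule rational_graph)
qed

end
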